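(* Let $W$ be a well-generated irreducible complex reflection group with reflection arrangement $\mathscr{A}$ and order multiplicity $\omega$, let $t_1,\dots,t_\ell$ be the flat invariants and $\eta_1,\dots,\eta_\ell$ the flat derivations, $R=S^W=\mathbb{C}[t_1,\dots,t_\ell]$, $T=\mathbb{C}[t_1,\dots,t_{\ell-1}]$ and $D=\partial_{t_\ell}$. For $1\le j\le \ell$ and $k\in\mathbb{Z}$ put $\xi_j^{(k)}:=\nabla_D^{k}(\eta_j)$, $\Xi^{(k)}:=\{\xi_1^{(k)},\dots,\xi_\ell^{(k)}\}$ and $\Xi:=\bigcup_{k\in\mathbb{Z}}\Xi^{(k)}$. Let $k\in\mathbb{Z}$. Then the following hold: (1) the $S$-module $\mathfrak{D}(\mathscr{A},-k\omega+1)$ is free with basis $\Xi^{(k)}$; (2) the $R$-module $\mathfrak{D}(\mathscr{A},-k\omega+1)^W$ is free with basis $\Xi^{(k)}$; (3) the $T$-module $\mathfrak{D}(\mathscr{A},-k\omega+1)^W$ is free with basis $\bigcup_{p\le k}\Xi^{(p)}$; (4) the $T$-module $\mathfrak{D}(\mathscr{A},-\infty)^W$ is free with basis $\Xi$.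
   Context: Reflection group. $V\cong\mathbb{C}^\ell$, and $W\subset \mathrm{GL}(V)$ is a finite irreducible group generated by (complex) reflections; it is well-generated if it is generated by $\ell$ reflections. $I$ is a $W$-invariant Hermitian inner product on $V$, $I^*$ the induced one on $V^*$. $\mathscr{A}$ is the set of reflecting hyperplanes; for $H\in\mathscr{A}$, $e_H$ is the order of the pointwise stabilizer of $H$ in $W$, $\omega(H):=e_H$, and $\alpha_H\in V^*$ is fixed with $H=\ker\alpha_H$, $I^*(\alpha_H,\alpha_H)=1$. Derivations. $S=\mathrm{Sym}(V^* )=\mathbb{C}[x_1,\dots,x_\ell]$ for a basis $x_1,\dots,x_\ell$ of $V^*$; $F=\mathrm{Frac}(S)$; $\mathrm{Der}_S=\bigoplus_i S\,\partial_{x_i}\subset \mathrm{Der}_F=\bigoplus_i F\,\partial_{x_i}$. $W$ acts on $\mathrm{Der}_F$ by $(w\theta)(f)=w(\theta(w^{-1}f))$, and $(\cdot)^W$ denotes $W$-invariants. A derivation $\theta=\sum_i (f_i/g_i)\partial_{x_i}$ with all $f_i$ homogeneous of degree $p$ (or $0$) and all $g_i\ne0$ homogeneous of degree $q$ is called homogeneous with $\mathrm{pdeg}\,\theta=p-q$. Logarithmic vector fields. $Q_{\mathscr{A}}=\prod_{H}\alpha_H$, $S'=S[Q_{\mathscr{A}}^{-1}]$, $\mathrm{Der}_{S'}=\bigoplus_i S'\partial_{x_i}$, and $S_{\langle\alpha_H\rangle}$ is the localization of $S$ at the prime ideal $\langle\alpha_H\rangle$. Then $$\mathfrak{D}(\mathscr{A},-\infty)=\{\theta\in\mathrm{Der}_{S'}\mid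 \theta(\beta)\in S_{\langle\alpha_H\rangle}\text{ for all }H\in\mathscr{A},\ \beta\in V^*\text{ with }I^*(\alpha_H,\beta)=0\},$$ and for $\nu:\mathscr{A}\to\mathbb{Z}$, $\mathfrak{D}(\mathscr{A},\nu)=\{\theta\in\mathfrak{D}(\mathscr{A},-\infty)\mid\theta(\alpha_H)\in\alpha_H^{\nu(H)}S_{\langle\alpha_H\rangle}\text{ for all }H\in\mathscr{A}\}$. Integers are also used for constant multiplicity functions. Connection. $\nabla_\theta(\sum_i p_i\partial_{x_i})=\sum_i\theta(p_i)\partial_{x_i}$ for $\theta\in\mathrm{Der}_F$, $p_i\in F$. Invariants. $S^W$ is a polynomial algebra with homogeneous generators of degrees $d_1\le\dots\le d_\ell$; $e_i=d_i-1$ are the exponents; $e_1^*\le\dots\le e_\ell^*$ are the coexponents (the polynomial degrees of a homogeneous $S^W$-basis of $\mathrm{Der}_S^W$); $h=\frac1\ell\sum_H e_H=d_\ell>d_{\ell-1}$ is the Coxeter number, and $e_i+e_{\ell+1-i}^*=h$. Given homogeneous generators $t_1,\dots,t_\ell$ of $R=S^W$ with $\deg t_i=d_i$, $\partial_{t_j}\in\mathrm{Der}_F$ is the derivation with $\partial_{t_j}(t_i)=\delta_{ij}$, $\mathrm{Der}_R=\bigoplus_j R\,\partial_{t_j}\subset\mathrm{Der}_F$, and $D=\partial_{t_\ell}$ is the primitive vector field. $\Delta=\prod_H\alpha_H^{e_H}\in R$ is the discriminant and $\mathrm{Der}_R(-\log\Delta)=\{\theta\in\mathrm{Der}_R\mid\theta\Delta\in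 R\Delta\}$, which is identified with $\mathrm{Der}_S^W$. Flat systems (known results of Kato–Mano–Sekiguchi, Bessis, and Hoge–Mano–Röhrle–Stump). One fixes homogeneous generators $t_1,\dots,t_\ell$ of $R$ with $\deg t_i=d_i$ (the flat invariants) and a homogeneous $R$-basis $\eta_1,\dots,\eta_\ell$ of $\mathrm{Der}_R(-\log\Delta)$ with $\mathrm{pdeg}\,\eta_j=e_j^*$ (the flat derivations) such that: the matrix $M_\eta=(\eta_{\ell+1-i}(t_j))_{i,j}$ equals $t_\ell\mathbf{1}_\ell+M^{(0)}$ with $M^{(0)}$ having entries in $T$; $\eta_1=E:=\frac1h\sum_i x_i\partial_{x_i}$; and, with $B_\infty=\mathrm{diag}(e_1/h,\dots,e_\ell/h)-\mathbf{1}_\ell$ and $\partial_t=(\partial_{t_1},\dots,\partial_{t_\ell})^{\mathrm{tr}}$, the map $\nabla_D:\mathrm{Der}_R(-\log\Delta)\to\mathrm{Der}_R$ is a $T$-linear isomorphism with inverse $\nabla_D^{-1}$ satisfying $\nabla_D^{-1}\partial_t=-B_\infty^{-1}M_\eta\,\partial_t$, and $\nabla_D\partial_t=-M_\eta^{-1}(B_\infty+\mathbf{1}_\ell)\partial_t$ (entrywise). For $k\ge0$, $\nabla_D^k$ is the $k$-fold iterate of $\nabla_D$, and $\nabla_D^{-k}$ is the $k$-fold iterate of $\nabla_D^{-1}:\mathrm{Der}_R\to\mathrm{Der}_R(-\log\Delta)\subset\mathrm{Der}_R$. *)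

theory Defs
  imports
    "HOL-Analysis.Analysis"
    "HOL-Library.Poly_Mapping"
    "HOL-Computational_Algebra.Normalized_Fraction"
    "HOL-Algebra.Generated_Groups"
begin

text \<open>
  The space V is \<open>complex ^ 'n\<close>, so the rank is \<open>CARD('n)\<close>. The order on the index type \<open>'n\<close> is
  used only because the library derives the integral domain instance of polynomials from it.
  A linear form in the dual space is represented by its coefficient vector
  with respect to the coordinates \<open>x\<^sub>i\<close>.
\<close>

section \<open>Polynomials, rational functions and derivations\<close>

type_synonym 'n cvec = "complex ^ 'n"
type_synonym 'n cmat = "complex ^ 'n ^ 'n"
type_synonym 'i mpol = "('i \<Rightarrow>\<^sub>0 nat) \<Rightarrow>\<^sub>0 complex"
type_synonym 'n ratfun = "'n mpol fract"
type_synonym 'n der = "'n ratfun ^ 'n"   \<comment> \<open>coefficients with respect to the partial derivatives\<close>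

definition Cst :: "complex \<Rightarrow> 'i mpol" where
  "Cst c = Poly_Mapping.single 0 c"

definition Var :: "'i \<Rightarrow> 'i mpol" where
  "Var i = Poly_Mapping.single (Poly_Mapping.single i 1) 1"

definition vars :: "'i mpol \<Rightarrow> 'i set" where
  "vars p = (\<Union>m\<in>Poly_Mapping.keys p. Poly_Mapping.keys m)"

definition poly_eval :: "('i \<Rightarrow> 'n mpol) \<Rightarrow> 'i mpol \<Rightarrow> 'n::linorder mpol" where
  "poly_eval \<sigma> p = (\<Sum>m\<in>Poly_Mapping.keys p. Cst (Poly_Mapping.lookup p m) *
      (\<Prod>i\<in>Poly_Mapping.keys m. \<sigma> i ^ Poly_Mapping.lookup m i))"

definition homog :: "nat \<Rightarrow> 'n::finite mpol \<Rightarrow> bool" where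
  "homog d p \<longleftrightarrow> (\<forall>m\<in>Poly_Mapping.keys p. (\<Sum>i\<in>UNIV. Poly_Mapping.lookup m i) = d)"

definition poly_subalg :: "nat set \<Rightarrow> (nat \<Rightarrow> 'n mpol) \<Rightarrow> 'n::linorder mpol set" where
  "poly_subalg J t = {poly_eval t p | p. vars p \<subseteq> J}"

definition alg_independent :: "nat set \<Rightarrow> (nat \<Rightarrow> 'n::linorder mpol) \<Rightarrow> bool" where
  "alg_independent J t \<longleftrightarrow> (\<forall>p. vars p \<subseteq> J \<longrightarrow> poly_eval t p = 0 \<longrightarrow> p = 0)"

definition to_F :: "'n::linorder mpol \<Rightarrow> 'n ratfun" where
  "to_F p = Fract p 1"

definition pdiff :: "'n \<Rightarrow> 'n::linorder mpol \<Rightarrow> 'n mpol" where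
  "pdiff i p = (\<Sum>m\<in>Poly_Mapping.keys p.
      Poly_Mapping.single (m - Poly_Mapping.single i 1)
        (of_nat (Poly_Mapping.lookup m i) * Poly_Mapping.lookup p m))"

lemma Cst_0 [simp]: "Cst 0 = 0"
  and Cst_1 [simp]: "Cst 1 = 1"
  and Cst_add: "Cst (a + b) = Cst a + Cst b"
  and Cst_mult: "Cst (a * b) = Cst a * Cst b"
  by (simp_all add: Cst_def single_add mult_single)

lemma mpol_induct [case_names single add]:
  fixes p :: "'i mpol"
  assumes s: "\<And>m c. P (Poly_Mapping.single m c)"
    and a: "\<And>p q. P p \<Longrightarrow> P q \<Longrightarrow> P (p + q)"
  shows "P p"
proof (induction p rule: update_induct)
  case const
  show ?case using s[of 0 0] by simp
next
  case (update f m c)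
  have "Poly_Mapping.update m c f = f + Poly_Mapping.single m c"
    using update(1)
    by (intro poly_mapping_eqI) (auto simp: lookup_update lookup_add lookup_single when_def in_keys_iff)
  then show ?case using a[OF update(3) s] by simp
qed

lemma pdiff_superset:
  assumes "finite A" "Poly_Mapping.keys p \<subseteq> A"
  shows "pdiff i p = (\<Sum>m\<in>A. Poly_Mapping.single (m - Poly_Mapping.single i 1)
        (of_nat (Poly_Mapping.lookup m i) * Poly_Mapping.lookup p m))"
  unfolding pdiff_def by (rule sum.mono_neutral_left) (use assms in \<open>auto simp: in_keys_iff\<close>)

lemma pdiff_add: "pdiff i (p + q) = pdiff i p + pdiff i q"
proof -
  let ?A = "Poly_Mapping.keys p \<union> Poly_Mapping.keys q"
  have k: "Poly_Mapping.keys (p + q) \<subseteq> ?A" by (rule Poly_Mapping.keys_add)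
  show ?thesis
    using k by (simp add: pdiff_superset[of ?A] lookup_add distrib_left single_add sum.distrib)
qed

lemma pdiff_single:
  "pdiff i (Poly_Mapping.single m c) =
     Poly_Mapping.single (m - Poly_Mapping.single i 1) (of_nat (Poly_Mapping.lookup m i) * c)"
  using pdiff_superset[of "{m}" "Poly_Mapping.single m c"] by simp

lemma exponent_minus_add:
  fixes m n :: "'n \<Rightarrow>\<^sub>0 nat"
  assumes "Poly_Mapping.lookup m i \<noteq> 0"
  shows "m - Poly_Mapping.single i 1 + n = m + n - Poly_Mapping.single i 1"
  using assms by (intro poly_mapping_eqI) (auto simp: lookup_add lookup_minus lookup_single when_def)

lemma pdiff_mult: "pdiff i (p * q) = pdiff i p * q + p * pdiff i q"
proof (induction p rule: mpol_induct)
  case (single m c)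
  show ?case
  proof (induction q rule: mpol_induct)
    case (single n c')
    have 1: "Poly_Mapping.single (m - Poly_Mapping.single i 1) (of_nat (Poly_Mapping.lookup m i) * c)
          * Poly_Mapping.single n c'
        = Poly_Mapping.single (m + n - Poly_Mapping.single i 1) (of_nat (Poly_Mapping.lookup m i) * (c * c'))"
      using exponent_minus_add[of m i n]
      by (cases "Poly_Mapping.lookup m i = 0") (auto simp: mult_single ac_simps)
    have 2: "Poly_Mapping.single m c
          * Poly_Mapping.single (n - Poly_Mapping.single i 1) (of_nat (Poly_Mapping.lookup n i) * c')
        = Poly_Mapping.single (m + n - Poly_Mapping.single i 1) (of_nat (Poly_Mapping.lookup n i) * (c * c'))"
      using exponent_minus_add[of n i m]
      by (cases "Poly_Mapping.lookup n i = 0") (auto simp: mult_single ac_simps)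
    show ?case
      unfolding pdiff_single 1 2 unfolding mult_single pdiff_single
      by (simp add: lookup_add distrib_right single_add)
  next
    case (add q q')
    then show ?case by (simp add: pdiff_add algebra_simps)
  qed
next
  case (add p p')
  then show ?case by (simp add: pdiff_add algebra_simps)
qed

text \<open>The quotient rule; \<open>pdiff_F_Fract\<close> below shows that the value is well defined.\<close>

definition pdiff_F :: "'n \<Rightarrow> 'n::linorder ratfun \<Rightarrow> 'n ratfun" where
  "pdiff_F i f = (THE r. \<forall>p q. q \<noteq> 0 \<longrightarrow> f = Fract p q \<longrightarrow>
      r = Fract (pdiff i p * q - p * pdiff i q) (q * q))"

lemma pdiff_F_Fract:
  assumes "q \<noteq> 0"
  shows "pdiff_F i (Fract p q) = Fract (pdiff i p * q - p * pdiff i q) (q * q)"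
proof -
  have wd: "Fract (pdiff i a * b - a * pdiff i b) (b * b) = Fract (pdiff i c * d - c * pdiff i d) (d * d)"
    if nz: "b \<noteq> 0" "d \<noteq> 0" and eq: "Fract a b = Fract c d" for a b c d
  proof -
    have e: "a * d = c * b" using eq nz by (simp add: eq_fract)
    have e': "pdiff i a * d = pdiff i c * b + c * pdiff i b - a * pdiff i d"
      using arg_cong[OF e, of "pdiff i"] by (simp add: pdiff_mult algebra_simps)
    have "(pdiff i a * b - a * pdiff i b) * (d * d) =
        b * d * (pdiff i a * d) - (a * d) * (pdiff i b * d)"
      by (simp add: algebra_simps)
    also have "\<dots> = b * d * (pdiff i c * b) + b * d * (c * pdiff i b) - (a * d) * (b * pdiff i d)
        - (c * b) * (pdiff i b * d)"
      unfolding e' e[symmetric] by (simp add: algebra_simps)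
    also have "\<dots> = (pdiff i c * d - c * pdiff i d) * (b * b)"
      unfolding e by (simp add: algebra_simps)
    finally show ?thesis using nz by (simp add: eq_fract)
  qed
  show ?thesis
    unfolding pdiff_F_def using assms wd by (intro the_equality) blast+
qed

definition der_app :: "'n::{finite,linorder} der \<Rightarrow> 'n ratfun \<Rightarrow> 'n ratfun" where
  "der_app \<theta> f = (\<Sum>i\<in>UNIV. \<theta> $ i * pdiff_F i f)"

definition nabla :: "'n::{finite,linorder} der \<Rightarrow> 'n der \<Rightarrow> 'n der" where
  "nabla \<theta> \<eta> = (\<chi> i. der_app \<theta> (\<eta> $ i))"

text \<open>\<open>homog_der \<theta> d\<close>: homogeneous with pdeg \<open>d\<close>; the zero derivation has every degree.\<close>

definition homog_der :: "'n::{finite,linorder} der \<Rightarrow> int \<Rightarrow> bool" where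
  "homog_der \<theta> d \<longleftrightarrow> (\<exists>p q f g. (\<forall>i. \<theta> $ i = Fract (f i) (g i) \<and> homog p (f i) \<and>
      g i \<noteq> 0 \<and> homog q (g i)) \<and> d = int p - int q)"

definition Der_S :: "'n::{finite,linorder} der set" where
  "Der_S = {\<theta>. \<forall>i. \<theta> $ i \<in> range to_F}"


section \<open>Modules over subrings of F and bases\<close>

text \<open>Scalars come from a subring \<open>A\<close> of F. Coefficient functions are required to vanish
  outside \<open>B\<close>, which makes \<open>\<exists>!\<close> express unique representation.\<close>

definition submod :: "'n::{finite,linorder} ratfun set \<Rightarrow> 'n der set \<Rightarrow> bool" where
  "submod A M \<longleftrightarrow> 0 \<in> M \<and> (\<forall>x\<in>M. \<forall>y\<in>M. x + y \<in> M) \<and> (\<forall>a\<in>A. \<forall>x\<in>M. a *s x \<in> M)"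

definition free_with_basis ::
  "'n::{finite,linorder} ratfun set \<Rightarrow> 'n der set \<Rightarrow> 'n der set \<Rightarrow> bool" where
  "free_with_basis A M B \<longleftrightarrow> submod A M \<and> B \<subseteq> M \<and>
    (\<forall>x\<in>M. \<exists>!c. range c \<subseteq> A \<and> finite {b. c b \<noteq> 0} \<and> {b. c b \<noteq> 0} \<subseteq> B \<and>
      x = (\<Sum>b | c b \<noteq> 0. c b *s b))"

definition family_basis ::
  "'n::{finite,linorder} ratfun set \<Rightarrow> 'n der set \<Rightarrow> (nat \<Rightarrow> 'n der) \<Rightarrow> bool" where
  "family_basis A M b \<longleftrightarrow>
    inj_on b {1..CARD('n)} \<and> free_with_basis A M (b ` {1..CARD('n)})"

definition linear_iso ::
  "'n::{finite,linorder} ratfun set \<Rightarrow> 'n der set \<Rightarrow> 'n der set \<Rightarrow> ('n der \<Rightarrow> 'n der) \<Rightarrow> bool" where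
  "linear_iso A M N f \<longleftrightarrow> bij_betw f M N \<and>
    (\<forall>x\<in>M. \<forall>y\<in>M. f (x + y) = f x + f y) \<and> (\<forall>a\<in>A. \<forall>x\<in>M. f (a *s x) = a *s f x)"


section \<open>Reflection groups\<close>

definition GL :: "'n::finite cmat monoid" where
  "GL = \<lparr>carrier = {g. invertible g}, monoid.mult = (**), one = mat 1\<rparr>"

definition fix_space :: "'n::finite cmat \<Rightarrow> 'n cvec set" where
  "fix_space g = {v. g *v v = v}"

text \<open>For elements of a finite group, the finite order required of a complex reflection is automatic.\<close>

definition reflections :: "'n::finite cmat set \<Rightarrow> 'n cmat set" where
  "reflections W = {g \<in> W. vec.dim (fix_space g) + 1 = CARD('n)}"

definition reflection_group :: "'n::finite cmat set \<Rightarrow> bool" where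
  "reflection_group W \<longleftrightarrow> finite W \<and> subgroup W GL \<and> generate GL (reflections W) = W"

definition irreducible_group :: "'n::finite cmat set \<Rightarrow> bool" where
  "irreducible_group W \<longleftrightarrow>
    (\<forall>U. vec.subspace U \<and> (\<forall>g\<in>W. \<forall>u\<in>U. g *v u \<in> U) \<longrightarrow> U = {0} \<or> U = UNIV)"

definition well_generated :: "'n::finite cmat set \<Rightarrow> bool" where
  "well_generated W \<longleftrightarrow>
    (\<exists>B \<subseteq> reflections W. card B = CARD('n) \<and> generate GL B = W)"

definition pairing :: "'n::finite cvec \<Rightarrow> 'n cvec \<Rightarrow> complex" where
  "pairing a v = (\<Sum>i\<in>UNIV. a $ i * v $ i)"

definition hermitian_inner :: "('n::finite cvec \<Rightarrow> 'n cvec \<Rightarrow> complex) \<Rightarrow> bool" where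
  "hermitian_inner I \<longleftrightarrow> (\<forall>v. Vector_Spaces.linear (*s) (*) (\<lambda>u. I u v)) \<and>
    (\<forall>u v. I v u = cnj (I u v)) \<and> (\<forall>v. v \<noteq> 0 \<longrightarrow> Re (I v v) > 0)"

definition invariant_form ::
  "'n::finite cmat set \<Rightarrow> ('n cvec \<Rightarrow> 'n cvec \<Rightarrow> complex) \<Rightarrow> bool" where
  "invariant_form W I \<longleftrightarrow> (\<forall>g\<in>W. \<forall>u v. I (g *v u) (g *v v) = I u v)"

text \<open>The form induced on the dual along the antilinear bijection \<open>v \<mapsto> I \<sqdot> v\<close>;
  exchanging the arguments makes it linear in the first one.\<close>

definition riesz ::
  "('n::finite cvec \<Rightarrow> 'n cvec \<Rightarrow> complex) \<Rightarrow> 'n cvec \<Rightarrow> 'n cvec" where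
  "riesz I a = (THE v. \<forall>u. pairing a u = I u v)"

definition dual_form ::
  "('n::finite cvec \<Rightarrow> 'n cvec \<Rightarrow> complex) \<Rightarrow> 'n cvec \<Rightarrow> 'n cvec \<Rightarrow> complex" where
  "dual_form I a b = I (riesz I b) (riesz I a)"

definition arrangement :: "'n::finite cmat set \<Rightarrow> 'n cvec set set" where
  "arrangement W = fix_space ` reflections W"

definition order_mult :: "'n::finite cmat set \<Rightarrow> 'n cvec set \<Rightarrow> nat" where
  "order_mult W H = card {g \<in> W. \<forall>v\<in>H. g *v v = v}"

definition coxeter_number :: "'n::finite cmat set \<Rightarrow> complex" where
  "coxeter_number W = of_nat (\<Sum>H\<in>arrangement W. order_mult W H) / of_nat CARD('n)"

definition normalized_forms ::
  "'n::finite cmat set \<Rightarrow> ('n cvec \<Rightarrow> 'n cvec \<Rightarrow> complex) \<Rightarrow>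
    ('n cvec set \<Rightarrow> 'n cvec) \<Rightarrow> bool" where
  "normalized_forms W I \<alpha> \<longleftrightarrow>
    (\<forall>H\<in>arrangement W. H = {v. pairing (\<alpha> H) v = 0} \<and> dual_form I (\<alpha> H) (\<alpha> H) = 1)"

definition lin_form :: "'n cvec \<Rightarrow> 'n::{finite,linorder} mpol" where
  "lin_form a = (\<Sum>i\<in>UNIV. Cst (a $ i) * Var i)"


section \<open>Group action and invariants\<close>

text \<open>\<open>(g f)(v) = f (g\<inverse> v)\<close>, i.e. \<open>x\<^sub>i\<close> is replaced by the \<open>i\<close>-th coordinate of \<open>g\<inverse> x\<close>.\<close>

definition act :: "'n cmat \<Rightarrow> 'n mpol \<Rightarrow> 'n::{finite,linorder} mpol" where
  "act g = poly_eval (\<lambda>i. lin_form (matrix_inv g $ i))"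

text \<open>Well defined for invertible \<open>g\<close> only; see the lemma \<open>act_F_Fract\<close> below.\<close>

definition act_F :: "'n cmat \<Rightarrow> 'n ratfun \<Rightarrow> 'n::{finite,linorder} ratfun" where
  "act_F g f = (THE r. \<forall>p q. q \<noteq> 0 \<longrightarrow> f = Fract p q \<longrightarrow> r = Fract (act g p) (act g q))"

lemma poly_eval_superset:
  assumes "finite A" "Poly_Mapping.keys p \<subseteq> A"
  shows "poly_eval \<sigma> p = (\<Sum>m\<in>A. Cst (Poly_Mapping.lookup p m) *
      (\<Prod>i\<in>Poly_Mapping.keys m. \<sigma> i ^ Poly_Mapping.lookup m i))"
  unfolding poly_eval_def
  by (rule sum.mono_neutral_left) (use assms in \<open>auto simp: in_keys_iff\<close>)

lemma poly_eval_add: "poly_eval \<sigma> (p + q) = poly_eval \<sigma> p + poly_eval \<sigma> q"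
proof -
  let ?A = "Poly_Mapping.keys p \<union> Poly_Mapping.keys q"
  have k: "Poly_Mapping.keys (p + q) \<subseteq> ?A" by (rule Poly_Mapping.keys_add)
  show ?thesis
    using k by (simp add: poly_eval_superset[of ?A] lookup_add Cst_add distrib_right sum.distrib)
qed

lemma poly_eval_single:
  "poly_eval \<sigma> (Poly_Mapping.single m c) =
     Cst c * (\<Prod>i\<in>Poly_Mapping.keys m. \<sigma> i ^ Poly_Mapping.lookup m i)"
  using poly_eval_superset[of "{m}" "Poly_Mapping.single m c" \<sigma>] by simp

lemma monom_superset:
  fixes \<sigma> :: "'i \<Rightarrow> 'n::linorder mpol"
  assumes "finite A" "Poly_Mapping.keys m \<subseteq> A"
  shows "(\<Prod>i\<in>Poly_Mapping.keys m. \<sigma> i ^ Poly_Mapping.lookup m i) =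
    (\<Prod>i\<in>A. \<sigma> i ^ Poly_Mapping.lookup m i)"
  by (rule prod.mono_neutral_left) (use assms in \<open>auto simp: in_keys_iff\<close>)

lemma poly_eval_mult: "poly_eval \<sigma> (p * q) = poly_eval \<sigma> p * poly_eval \<sigma> q"
proof (induction p rule: mpol_induct)
  case (single m c)
  show ?case
  proof (induction q rule: mpol_induct)
    case (single n d)
    let ?A = "Poly_Mapping.keys m \<union> Poly_Mapping.keys n"
    have k: "Poly_Mapping.keys (m + n) \<subseteq> ?A" by (rule Poly_Mapping.keys_add)
    have "(\<Prod>i\<in>Poly_Mapping.keys (m + n). \<sigma> i ^ Poly_Mapping.lookup (m + n) i) =
        (\<Prod>i\<in>Poly_Mapping.keys m. \<sigma> i ^ Poly_Mapping.lookup m i) *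
        (\<Prod>i\<in>Poly_Mapping.keys n. \<sigma> i ^ Poly_Mapping.lookup n i)"
      unfolding monom_superset[OF _ k, of \<sigma>, simplified]
        monom_superset[of ?A m \<sigma>, simplified] monom_superset[of ?A n \<sigma>, simplified]
      by (simp add: lookup_add power_add prod.distrib)
    then show ?case
      by (simp add: mult_single poly_eval_single Cst_mult ac_simps)
  next
    case (add q q')
    then show ?case by (simp add: poly_eval_add algebra_simps)
  qed
next
  case (add p p')
  then show ?case by (simp add: poly_eval_add algebra_simps)
qed

lemma poly_eval_0 [simp]: "poly_eval \<sigma> 0 = 0"
  by (simp add: poly_eval_def)

lemma poly_eval_Cst [simp]: "poly_eval \<sigma> (Cst c) = Cst c"
  unfolding Cst_def poly_eval_single by (simp flip: Cst_def)

lemma poly_eval_1 [simp]: "poly_eval \<sigma> 1 = 1"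
  using poly_eval_Cst[of \<sigma> 1] by simp

lemma poly_eval_Var [simp]: "poly_eval \<sigma> (Var i) = \<sigma> i"
  by (simp add: Var_def poly_eval_single)

lemma poly_eval_sum: "poly_eval \<sigma> (sum f A) = (\<Sum>a\<in>A. poly_eval \<sigma> (f a))"
  by (induction A rule: infinite_finite_induct) (simp_all add: poly_eval_add)

lemma poly_eval_power: "poly_eval \<sigma> (p ^ k) = poly_eval \<sigma> p ^ k"
  by (induction k) (simp_all add: poly_eval_mult)

lemma poly_eval_prod: "poly_eval \<sigma> (prod f A) = (\<Prod>a\<in>A. poly_eval \<sigma> (f a))"
  by (induction A rule: infinite_finite_induct) (simp_all add: poly_eval_mult)

lemma poly_eval_poly_eval: "poly_eval \<sigma> (poly_eval \<tau> p) = poly_eval (\<lambda>i. poly_eval \<sigma> (\<tau> i)) p"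
  by (induction p rule: mpol_induct)
    (simp_all add: poly_eval_single poly_eval_add poly_eval_mult poly_eval_prod poly_eval_power)

lemma monom_Var:
  assumes "finite A"
  shows "(\<Prod>i\<in>A. Var i ^ Poly_Mapping.lookup m i) =
    Poly_Mapping.single (\<Sum>i\<in>A. Poly_Mapping.single i (Poly_Mapping.lookup m i)) 1"
  using assms
proof (induction A rule: finite_induct)
  case (insert a A)
  have "Var a ^ k = Poly_Mapping.single (Poly_Mapping.single a k) 1" for k
    by (induction k) (simp_all add: Var_def mult_single flip: single_add)
  with insert show ?case by (simp add: mult_single)
qed simp

lemma poly_eval_id: "poly_eval Var p = p"
proof (induction p rule: mpol_induct)
  case (single m c)
  have "(\<Sum>i\<in>Poly_Mapping.keys m. Poly_Mapping.single i (Poly_Mapping.lookup m i)) = m"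
    by (intro poly_mapping_eqI) (auto simp: lookup_sum lookup_single when_def in_keys_iff)
  then show ?case
    by (simp add: poly_eval_single monom_Var Cst_def mult_single)
qed (simp add: poly_eval_add)

lemma Cst_sum: "Cst (sum f A) = (\<Sum>a\<in>A. Cst (f a))"
  by (induction A rule: infinite_finite_induct) (simp_all add: Cst_add)

lemma lin_form_sum:
  "(\<Sum>j\<in>UNIV. Cst (a $ j) * lin_form (B $ j)) = lin_form (a v* B)"
proof -
  have "(\<Sum>j\<in>UNIV. Cst (a $ j) * lin_form (B $ j)) =
      (\<Sum>i\<in>UNIV. \<Sum>j\<in>UNIV. Cst (a $ j) * (Cst (B $ j $ i) * Var i))"
    unfolding lin_form_def sum_distrib_left by (rule sum.swap)
  also have "\<dots> = (\<Sum>i\<in>UNIV. Cst (\<Sum>j\<in>UNIV. a $ j * B $ j $ i) * Var i)"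
    unfolding Cst_sum sum_distrib_right Cst_mult by (simp add: ac_simps)
  finally show ?thesis
    by (simp add: lin_form_def vector_matrix_mult_def)
qed

lemma matrix_inv_both:
  assumes "invertible g"
  shows "g ** matrix_inv g = mat 1" and "matrix_inv g ** g = mat 1"
  using someI_ex[OF assms[unfolded invertible_def]] by (simp_all add: matrix_inv_def)

lemma act_matrix_inv:
  fixes g :: "'n::{finite,linorder} cmat"
  assumes "invertible g"
  shows "act (matrix_inv g) (act g p) = p"
proof -
  let ?h = "matrix_inv g"
  note gh = matrix_inv_both[OF assms]
  have "invertible ?h" using gh by (auto simp: invertible_def)
  then have "matrix_inv ?h = matrix_inv ?h ** (?h ** g)"
    using gh by simp
  also have "\<dots> = g"
    using matrix_inv_both(2)[OF \<open>invertible ?h\<close>] by (simp add: matrix_mul_assoc)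
  finally have inv: "matrix_inv ?h = g" .
  have row: "lin_form (mat 1 $ i) = Var i" for i :: 'n
    by (simp add: lin_form_def mat_def if_distrib[of Cst] if_distrib[of "\<lambda>x. x * _"] cong: if_cong)
  have "(?h $ i) v* g = mat 1 $ i" for i
    unfolding gh(2)[symmetric]
    by (simp add: vec_eq_iff vector_matrix_mult_def matrix_matrix_mult_def mult.commute)
  then have "act ?h (lin_form (?h $ i)) = Var i" for i
    unfolding act_def inv lin_form_def[of "?h $ i"]
    by (simp add: poly_eval_sum poly_eval_mult lin_form_sum row)
  then show ?thesis
    unfolding act_def[of g] by (simp add: act_def poly_eval_poly_eval poly_eval_id)
qed

lemma act_F_Fract:
  assumes "invertible g" "q \<noteq> 0"
  shows "act_F g (Fract p q) = Fract (act g p) (act g q)"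
proof -
  have nz: "act g r \<noteq> 0" if "r \<noteq> 0" for r
    using act_matrix_inv[OF assms(1), of r] that by (auto simp: act_def)
  have "Fract (act g p) (act g q) = Fract (act g p') (act g q')"
    if "q' \<noteq> 0" "Fract p q = Fract p' q'" for p' q'
  proof -
    have "p * q' = p' * q" using that assms(2) by (simp add: eq_fract)
    then have "act g p * act g q' = act g p' * act g q"
      unfolding act_def by (simp only: poly_eval_mult[symmetric])
    then show ?thesis using that assms(2) nz by (simp add: eq_fract)
  qed
  then show ?thesis
    unfolding act_F_def using assms(2) by (intro the_equality) blast+
qed

definition invariant_polys :: "'n cmat set \<Rightarrow> 'n::{finite,linorder} mpol set" where
  "invariant_polys W = {p. \<forall>g\<in>W. act g p = p}"

definition invariant_ders ::
  "'n cmat set \<Rightarrow> 'n::{finite,linorder} der set \<Rightarrow> 'n der set" where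
  "invariant_ders W M =
    {\<theta>\<in>M. \<forall>g\<in>W. \<forall>f. act_F g (der_app \<theta> (act_F (matrix_inv g) f)) = der_app \<theta> f}"

text \<open>Families such as \<open>t\<close>, \<open>d\<close>, \<open>es\<close>, \<open>\<eta>\<close> are indexed by \<open>1, \<dots>, CARD('n)\<close>;
  their values elsewhere play no role.\<close>

definition basic_invariants ::
  "'n cmat set \<Rightarrow> (nat \<Rightarrow> nat) \<Rightarrow> (nat \<Rightarrow> 'n::{finite,linorder} mpol) \<Rightarrow> bool" where
  "basic_invariants W d t \<longleftrightarrow>
    mono_on {1..CARD('n)} d \<and> (\<forall>i\<in>{1..CARD('n)}. homog (d i) (t i)) \<and>
    alg_independent {1..CARD('n)} t \<and> poly_subalg {1..CARD('n)} t = invariant_polys W"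

definition coexponents ::
  "'n::{finite,linorder} cmat set \<Rightarrow> (nat \<Rightarrow> nat) \<Rightarrow> bool" where
  "coexponents W es \<longleftrightarrow> mono_on {1..CARD('n)} es \<and>
    (\<exists>\<theta> :: nat \<Rightarrow> 'n der. family_basis (to_F ` invariant_polys W) (invariant_ders W Der_S) \<theta> \<and>
      (\<forall>j\<in>{1..CARD('n)}. homog_der (\<theta> j) (int (es j))))"


section \<open>Logarithmic vector fields\<close>

definition loc_at :: "'n cvec \<Rightarrow> 'n::{finite,linorder} ratfun set" where
  "loc_at a = {Fract p q | p q. \<not> lin_form a dvd q}"

definition defining_poly ::
  "'n cmat set \<Rightarrow> ('n cvec set \<Rightarrow> 'n cvec) \<Rightarrow>
    'n::{finite,linorder} mpol" where
  "defining_poly W \<alpha> = (\<Prod>H\<in>arrangement W. lin_form (\<alpha> H))"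

definition Der_S' ::
  "'n cmat set \<Rightarrow> ('n cvec set \<Rightarrow> 'n cvec) \<Rightarrow>
    'n::{finite,linorder} der set" where
  "Der_S' W \<alpha> = {\<theta>. \<forall>i. \<exists>p n. \<theta> $ i = Fract p (defining_poly W \<alpha> ^ n)}"

definition log_ders_inf ::
  "'n cmat set \<Rightarrow> ('n cvec \<Rightarrow> 'n cvec \<Rightarrow> complex) \<Rightarrow>
    ('n cvec set \<Rightarrow> 'n cvec) \<Rightarrow> 'n::{finite,linorder} der set" where
  "log_ders_inf W I \<alpha> = {\<theta> \<in> Der_S' W \<alpha>. \<forall>H\<in>arrangement W. \<forall>\<beta>.
    dual_form I (\<alpha> H) \<beta> = 0 \<longrightarrow> der_app \<theta> (to_F (lin_form \<beta>)) \<in> loc_at (\<alpha> H)}"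

definition log_ders ::
  "'n cmat set \<Rightarrow> ('n cvec \<Rightarrow> 'n cvec \<Rightarrow> complex) \<Rightarrow>
    ('n cvec set \<Rightarrow> 'n cvec) \<Rightarrow> ('n cvec set \<Rightarrow> int) \<Rightarrow>
    'n::{finite,linorder} der set" where
  "log_ders W I \<alpha> \<nu> = {\<theta> \<in> log_ders_inf W I \<alpha>. \<forall>H\<in>arrangement W.
    der_app \<theta> (to_F (lin_form (\<alpha> H))) \<in>
      (\<lambda>s. to_F (lin_form (\<alpha> H)) powi \<nu> H * s) ` loc_at (\<alpha> H)}"


section \<open>Flat systems\<close>

definition partial_t :: "(nat \<Rightarrow> 'n mpol) \<Rightarrow> nat \<Rightarrow> 'n::{finite,linorder} der" where
  "partial_t t j =
    (THE \<theta>. \<forall>i\<in>{1..CARD('n)}. der_app \<theta> (to_F (t i)) = (if i = j then 1 else 0))"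

definition Der_R ::
  "'n cmat set \<Rightarrow> (nat \<Rightarrow> 'n mpol) \<Rightarrow> 'n::{finite,linorder} der set" where
  "Der_R W t = {\<Sum>j=1..CARD('n). to_F (r j) *s partial_t t j | r.
    \<forall>j\<in>{1..CARD('n)}. r j \<in> invariant_polys W}"

definition discriminant ::
  "'n cmat set \<Rightarrow> ('n cvec set \<Rightarrow> 'n cvec) \<Rightarrow>
    'n::{finite,linorder} mpol" where
  "discriminant W \<alpha> = (\<Prod>H\<in>arrangement W. lin_form (\<alpha> H) ^ order_mult W H)"

definition Der_R_log ::
  "'n cmat set \<Rightarrow> ('n cvec set \<Rightarrow> 'n cvec) \<Rightarrow> (nat \<Rightarrow> 'n mpol) \<Rightarrow>
    'n::{finite,linorder} der set" where
  "Der_R_log W \<alpha> t = {\<theta> \<in> Der_R W t. \<exists>r\<in>invariant_polys W.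
    der_app \<theta> (to_F (discriminant W \<alpha>)) = to_F (r * discriminant W \<alpha>)}"

definition primitive_der :: "(nat \<Rightarrow> 'n mpol) \<Rightarrow> 'n::{finite,linorder} der" where
  "primitive_der t = partial_t t CARD('n)"

definition T_ring :: "(nat \<Rightarrow> 'n mpol) \<Rightarrow> 'n::{finite,linorder} ratfun set" where
  "T_ring t = to_F ` poly_subalg {1..CARD('n) - 1} t"

definition euler_der :: "'n cmat set \<Rightarrow> 'n::{finite,linorder} der" where
  "euler_der W = (\<chi> i. to_F (Cst (1 / coxeter_number W) * Var i))"

definition nabla_D_inv ::
  "'n cmat set \<Rightarrow> ('n cvec set \<Rightarrow> 'n cvec) \<Rightarrow> (nat \<Rightarrow> 'n mpol) \<Rightarrow>
    'n der \<Rightarrow> 'n::{finite,linorder} der" where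
  "nabla_D_inv W \<alpha> t = inv_into (Der_R_log W \<alpha> t) (nabla (primitive_der t))"

definition M_eta ::
  "(nat \<Rightarrow> 'n mpol) \<Rightarrow> (nat \<Rightarrow> 'n der) \<Rightarrow> nat \<Rightarrow> nat \<Rightarrow> 'n::{finite,linorder} ratfun" where
  "M_eta t \<eta> i j = der_app (\<eta> (CARD('n) + 1 - i)) (to_F (t j))"

definition B_inf :: "'n::finite cmat set \<Rightarrow> (nat \<Rightarrow> nat) \<Rightarrow> nat \<Rightarrow> complex" where
  "B_inf W d i = (of_nat (d i) - 1) / coxeter_number W - 1"

definition inverse_matrices :: "nat \<Rightarrow> (nat \<Rightarrow> nat \<Rightarrow> 'a::field) \<Rightarrow> (nat \<Rightarrow> nat \<Rightarrow> 'a) \<Rightarrow> bool" where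
  "inverse_matrices l M N \<longleftrightarrow> (\<forall>i\<in>{1..l}. \<forall>j\<in>{1..l}.
    (\<Sum>k=1..l. M i k * N k j) = (if i = j then 1 else 0) \<and>
    (\<Sum>k=1..l. N i k * M k j) = (if i = j then 1 else 0))"

text \<open>The identities for the column \<open>\<partial>\<^sub>t\<close> are stated row by row; \<open>N\<close> is the inverse of \<open>M_eta\<close> over F.
  The data \<open>(t, \<eta>)\<close> with these properties are what is meant by flat invariants and flat derivations.\<close>

definition flat_system ::
  "'n cmat set \<Rightarrow> ('n cvec set \<Rightarrow> 'n cvec) \<Rightarrow> (nat \<Rightarrow> nat) \<Rightarrow>
    (nat \<Rightarrow> nat) \<Rightarrow> (nat \<Rightarrow> 'n mpol) \<Rightarrow> (nat \<Rightarrow> 'n::{finite,linorder} der) \<Rightarrow> bool" where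
  "flat_system W \<alpha> d es t \<eta> \<longleftrightarrow>
    basic_invariants W d t \<and>
    family_basis (to_F ` invariant_polys W) (Der_R_log W \<alpha> t) \<eta> \<and>
    (\<forall>j\<in>{1..CARD('n)}. homog_der (\<eta> j) (int (es j))) \<and>
    (\<forall>i\<in>{1..CARD('n)}. \<forall>j\<in>{1..CARD('n)}.
      M_eta t \<eta> i j - (if i = j then to_F (t CARD('n)) else 0) \<in> T_ring t) \<and>
    \<eta> 1 = euler_der W \<and>
    linear_iso (T_ring t) (Der_R_log W \<alpha> t) (Der_R W t) (nabla (primitive_der t)) \<and>
    (\<forall>i\<in>{1..CARD('n)}. nabla_D_inv W \<alpha> t (partial_t t i) =
      - (to_F (Cst (inverse (B_inf W d i))) *s
          (\<Sum>j=1..CARD('n). M_eta t \<eta> i j *s partial_t t j))) \<and>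
    (\<exists>N. inverse_matrices CARD('n) (M_eta t \<eta>) N \<and>
      (\<forall>i\<in>{1..CARD('n)}. nabla (primitive_der t) (partial_t t i) =
        - (\<Sum>j=1..CARD('n). (N i j * to_F (Cst (B_inf W d j + 1))) *s partial_t t j)))"

text \<open>\<open>nabla_D_inv\<close> is meaningful on \<open>Der_R\<close> only, where it inverts the isomorphism
  from \<open>Der_R_log\<close> to \<open>Der_R\<close> required in \<open>flat_system\<close>.\<close>

definition xi ::
  "'n cmat set \<Rightarrow> ('n cvec set \<Rightarrow> 'n cvec) \<Rightarrow> (nat \<Rightarrow> 'n mpol) \<Rightarrow>
    (nat \<Rightarrow> 'n der) \<Rightarrow> int \<Rightarrow> nat \<Rightarrow> 'n::{finite,linorder} der" where
  "xi W \<alpha> t \<eta> k j =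
    (if k \<ge> 0 then (nabla (primitive_der t) ^^ nat k) (\<eta> j)
     else (nabla_D_inv W \<alpha> t ^^ nat (- k)) (\<eta> j))"

definition Xi ::
  "'n cmat set \<Rightarrow> ('n cvec set \<Rightarrow> 'n cvec) \<Rightarrow> (nat \<Rightarrow> 'n mpol) \<Rightarrow>
    (nat \<Rightarrow> 'n der) \<Rightarrow> int \<Rightarrow> 'n::{finite,linorder} der set" where
  "Xi W \<alpha> t \<eta> k = xi W \<alpha> t \<eta> k ` {1..CARD('n)}"

end

theory Submission
  imports Defs
begin

text \<open>
  Write \<open>u\<^sup>(\<^sup>k\<^sup>)\<close> for the column of the \<open>\<nabla>\<^sub>D\<^sup>k \<partial>\<^sub>t\<^sub>i\<close> (\<open>U k\<close> below). As \<open>D M = 1\<close>, applying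
  \<open>\<nabla>\<^sub>D\<close> and its inverse to \<open>M \<partial>\<^sub>t = - B \<nabla>\<^sub>D\<^sup>-\<^sup>1 \<partial>\<^sub>t\<close> gives \<open>M u\<^sup>(\<^sup>k\<^sup>) = - (B + k) u\<^sup>(\<^sup>k\<^sup>-\<^sup>1\<^sup>)\<close> for all integers \<open>k\<close>,
  and \<open>B + k\<close> is invertible because \<open>0 < d\<^sub>i - 1 < h\<close>. Up to scalars, \<open>\<xi>\<^sup>(\<^sup>k\<^sup>)\<close> is \<open>u\<^sup>(\<^sup>k\<^sup>-\<^sup>1\<^sup>)\<close>.

  A degree count shows that the Jacobian of the \<open>t\<^sub>i\<close> is \<open>\<Prod> \<alpha>\<^sub>H ^ (e\<^sub>H - 1)\<close>, that a basis of the
  invariant polynomial derivations has determinant \<open>\<Prod> \<alpha>\<^sub>H\<close>, and hence that \<open>det M\<close> is the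
  discriminant; the recursion then yields the determinants of all \<open>\<xi>\<^sup>(\<^sup>k\<^sup>)\<close>. At a hyperplane \<open>H\<close>,
  \<open>\<nabla>\<^sub>D\<close> shifts the order along \<open>\<alpha>\<^sub>H\<close> of an invariant derivation by exactly \<open>e\<^sub>H\<close>: if \<open>D(\<alpha>\<^sub>H ^ e\<^sub>H)\<close>
  vanished on \<open>H\<close>, the determinant of \<open>u\<^sup>(\<^sup>1\<^sup>)\<close> would have too small a pole. So \<open>\<xi>\<^sup>(\<^sup>k\<^sup>)\<close> lies in the
  logarithmic module, and Cramer's rule together with its determinant gives a basis over \<open>S\<close>, and
  over \<open>R\<close> after taking invariants. Finally \<open>M = t\<^sub>\<ell> + M\<^sub>0\<close> with \<open>M\<^sub>0\<close> over \<open>T\<close>, so the recursion turns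
  multiplication by \<open>t\<^sub>\<ell>\<close> into a shift of \<open>k\<close>, which gives the bases over \<open>T\<close>.
\<close>

section \<open>Polynomials and rational functions\<close>

text \<open>The primitive derivation \<open>D\<close> has poles along the hyperplanes, so
  differentiating along it need not preserve regularity. The cyclic stabilizer of \<open>H\<close>
  repairs this: a regular invariant function has a normal derivative of order at least
  \<open>e_H - 1\<close>, which cancels the pole of \<open>D\<close> of the same order. Local
  estimates therefore first divide out a power of the form so as to reach an invariant function; the
  exponents \<open>1 + m e_H\<close> are those for which an invariant derivation allows this. Going
  up in \<open>k\<close> needs only upper bounds for poles. Going down means integrating along
  \<open>D\<close>, and for this the pole of \<open>D\<close> must have its full order; hence the
  determinants come before the local analysis. The degrees in the count are read off from the flat
  system: \<open>\<eta> 1\<close> being the Euler field makes \<open>h\<close> the top degree, and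
  the diagonal of \<open>M_eta\<close> shows that \<open>es\<close> and \<open>d - 1\<close>, taken
  in opposite order, add up to \<open>h\<close>. That the span of \<open>\<eta>\<close> is the
  module of invariant polynomial derivations is also a matter of degrees, since both bases carry the
  degrees \<open>es\<close>.\<close>

lemma poly_eval_induct [consumes 1, case_names Cst gen add mult]:
  fixes \<sigma> :: "'i \<Rightarrow> 'n::linorder mpol"
  assumes "vars p \<subseteq> J"
    and c: "\<And>c. P (Cst c)" and g: "\<And>i. i \<in> J \<Longrightarrow> P (\<sigma> i)"
    and a: "\<And>x y. P x \<Longrightarrow> P y \<Longrightarrow> P (x + y)" and m: "\<And>x y. P x \<Longrightarrow> P y \<Longrightarrow> P (x * y)"
  shows "P (poly_eval \<sigma> p)"
proof -
  have 0: "P 0" and 1: "P 1" using c[of 0] c[of 1] by simp_all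
  have pow: "P (x ^ n)" if "P x" for x n using that by (induction n) (auto intro: 1 m)
  have prod: "P (prod f A)" if "\<And>a. a \<in> A \<Longrightarrow> P (f a)" for f :: "'i \<Rightarrow> 'n mpol" and A
    using that by (induction A rule: infinite_finite_induct) (auto intro: 1 m)
  have sum: "P (sum f A)" if "\<And>a. a \<in> A \<Longrightarrow> P (f a)" for f :: "('i \<Rightarrow>\<^sub>0 nat) \<Rightarrow> 'n mpol" and A
    using that by (induction A rule: infinite_finite_induct) (auto intro: 0 a)
  show ?thesis
    unfolding poly_eval_def using assms(1)
    by (intro sum m c prod pow g) (auto simp: vars_def)
qed

lemma mpol_ring_induct [case_names Cst Var add mult]:
  fixes p :: "'n::linorder mpol"
  assumes "\<And>c. P (Cst c)" "\<And>i. P (Var i)" "\<And>x y. P x \<Longrightarrow> P y \<Longrightarrow> P (x + y)"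
    "\<And>x y. P x \<Longrightarrow> P y \<Longrightarrow> P (x * y)"
  shows "P p"
  using poly_eval_induct[of p UNIV P Var] assms by (simp add: poly_eval_id)

lemma vars_add: "vars (p + q) \<subseteq> vars p \<union> vars q"
  using Poly_Mapping.keys_add[of p q] by (auto simp: vars_def)

lemma vars_mult: "vars (p * q) \<subseteq> vars p \<union> vars q"
proof
  fix i assume "i \<in> vars (p * q)"
  then obtain m where m: "m \<in> Poly_Mapping.keys (p * q)" "i \<in> Poly_Mapping.keys m" by (auto simp: vars_def)
  then obtain a b where "a \<in> Poly_Mapping.keys p" "b \<in> Poly_Mapping.keys q" "m = a + b"
    using Poly_Mapping.keys_mult[of p q] by auto
  with m(2) show "i \<in> vars p \<union> vars q"
    using Poly_Mapping.keys_add[of a b] by (auto simp: vars_def)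
qed

lemma poly_subalg_Cst: "Cst c \<in> poly_subalg J t"
proof -
  have "poly_eval t (Cst c) = Cst c" "vars (Cst c :: nat mpol) \<subseteq> J" by simp (auto simp: vars_def Cst_def)
  then show ?thesis unfolding poly_subalg_def by (metis (mono_tags, lifting) mem_Collect_eq)
qed

lemma poly_subalg_gen: "i \<in> J \<Longrightarrow> t i \<in> poly_subalg J t"
proof -
  assume "i \<in> J"
  then have "poly_eval t (Var i) = t i" "vars (Var i) \<subseteq> J" by (simp_all, auto simp: vars_def Var_def)
  then show ?thesis unfolding poly_subalg_def by (metis (mono_tags, lifting) mem_Collect_eq)
qed

lemma poly_subalg_add: "x \<in> poly_subalg J t \<Longrightarrow> y \<in> poly_subalg J t \<Longrightarrow> x + y \<in> poly_subalg J t"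
  unfolding poly_subalg_def using vars_add by (fastforce simp flip: poly_eval_add)

lemma poly_subalg_mult: "x \<in> poly_subalg J t \<Longrightarrow> y \<in> poly_subalg J t \<Longrightarrow> x * y \<in> poly_subalg J t"
  unfolding poly_subalg_def using vars_mult by (fastforce simp flip: poly_eval_mult)

lemma poly_subalg_induct [consumes 1, case_names Cst gen add mult]:
  assumes "x \<in> poly_subalg J t"
    and "\<And>c. P (Cst c)" and "\<And>i. i \<in> J \<Longrightarrow> P (t i)"
    and "\<And>x y. P x \<Longrightarrow> P y \<Longrightarrow> P (x + y)" and "\<And>x y. P x \<Longrightarrow> P y \<Longrightarrow> P (x * y)"
  shows "P x"
  using assms(1) poly_eval_induct[of _ J P t, OF _ assms(2-5)] by (auto simp: poly_subalg_def)

lemma to_F_0 [simp]: "to_F 0 = 0" and to_F_1 [simp]: "to_F 1 = 1"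
  by (simp_all add: to_F_def Zero_fract_def One_fract_def)

lemma to_F_add: "to_F (p + q) = to_F p + to_F q" and to_F_mult: "to_F (p * q) = to_F p * to_F q"
  and to_F_minus: "to_F (- p) = - to_F p" and to_F_diff: "to_F (p - q) = to_F p - to_F q"
  by (simp_all add: to_F_def)

lemma to_F_sum: "to_F (sum f A) = (\<Sum>a\<in>A. to_F (f a))"
  by (induction A rule: infinite_finite_induct) (simp_all add: to_F_add)

lemma to_F_prod: "to_F (prod f A) = (\<Prod>a\<in>A. to_F (f a))"
  by (induction A rule: infinite_finite_induct) (simp_all add: to_F_mult)

lemma to_F_power: "to_F (p ^ k) = to_F p ^ k"
  by (induction k) (simp_all add: to_F_mult)

lemma to_F_eq_iff [simp]: "to_F p = to_F q \<longleftrightarrow> p = q"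
  by (simp add: to_F_def eq_fract)

lemma to_F_eq_0_iff [simp]: "to_F p = 0 \<longleftrightarrow> p = 0"
  using to_F_eq_iff[of p 0] by simp

lemma Fract_to_F: "Fract p q = to_F p / to_F q"
  by (simp add: to_F_def)

lemma ratfun_cases:
  fixes f :: "'n::linorder ratfun"
  obtains p q where "q \<noteq> 0" "f = to_F p / to_F q"
  by (cases f) (auto simp: Fract_to_F)

lemma Cst_eq_iff [simp]: "Cst a = Cst b \<longleftrightarrow> a = b"
  unfolding Cst_def by (metis lookup_single_eq)

lemma Cst_eq_0_iff [simp]: "Cst a = 0 \<longleftrightarrow> a = 0"
  using Cst_eq_iff[of a 0] by simp

lemma Cst_minus: "Cst (- a) = - Cst a"
  using Cst_add[of a "- a"] by (simp add: eq_neg_iff_add_eq_0 add.commute)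

lemma Cst_diff: "Cst (a - b) = Cst a - Cst b"
  using Cst_add[of a "- b"] by (simp add: Cst_minus)

lemma Cst_of_nat: "Cst (of_nat n) = of_nat n"
  by (induction n) (simp_all add: Cst_add)

lemma Cst_prod: "Cst (prod f A) = (\<Prod>a\<in>A. Cst (f a))"
  by (induction A rule: infinite_finite_induct) (simp_all add: Cst_mult)

abbreviation const_F :: "complex \<Rightarrow> 'n::linorder ratfun" where
  "const_F c \<equiv> to_F (Cst c)"

lemma const_F_simps:
  "const_F (a + b) = const_F a + const_F b" "const_F (a * b) = const_F a * const_F b"
  "const_F (- a) = - const_F a" "const_F (a - b) = const_F a - const_F b"
  "const_F (of_nat n) = of_nat n"
  by (simp_all add: Cst_add Cst_mult Cst_minus Cst_diff to_F_add to_F_mult to_F_minus to_F_diff Cst_of_nat)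
    (induction n; simp add: to_F_add)

lemma const_F_inverse: "const_F (inverse a) = inverse (const_F a)"
proof (cases "a = 0")
  case False
  then have "const_F (inverse a) * const_F a = 1" by (simp flip: const_F_simps(2))
  then show ?thesis by (metis inverse_unique mult.commute)
qed simp

lemma const_F_of_int: "const_F (of_int n) = of_int n"
proof (cases n)
  case (neg k)
  have "const_F (of_int n) = const_F (- of_nat (Suc k))" by (simp add: neg)
  then show ?thesis unfolding neg const_F_simps by simp
qed (simp flip: const_F_simps(5))

lemma of_nat_ratfun_eq_0_iff [simp]: "(of_nat n :: 'n::linorder ratfun) = 0 \<longleftrightarrow> n = 0"
  unfolding const_F_simps(5)[symmetric] by (simp del: const_F_simps)

section \<open>Derivations\<close>

text \<open>Derivations along a homomorphism \<open>\<phi>\<close>: with \<open>\<phi>\<close> the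
  identity they are ordinary derivations, and with \<open>\<phi>\<close> a group element they
  include the defect of a derivation from commuting with that element. Invariance of a derivation is
  thereby reduced to finitely many test functions.\<close>

definition twisted_derivation ::
  "('n::linorder ratfun \<Rightarrow> 'n ratfun) \<Rightarrow> ('n ratfun \<Rightarrow> 'n ratfun) \<Rightarrow> bool" where
  "twisted_derivation \<phi> \<delta> \<longleftrightarrow> (\<forall>a b. \<delta> (a + b) = \<delta> a + \<delta> b) \<and>
    (\<forall>a b. \<delta> (a * b) = \<delta> a * \<phi> b + \<phi> a * \<delta> b) \<and> (\<forall>c. \<delta> (const_F c) = 0)"

definition field_hom :: "('n::linorder ratfun \<Rightarrow> 'n ratfun) \<Rightarrow> bool" where
  "field_hom \<phi> \<longleftrightarrow> (\<forall>a b. \<phi> (a + b) = \<phi> a + \<phi> b) \<and> (\<forall>a b. \<phi> (a * b) = \<phi> a * \<phi> b) \<and> \<phi> 1 = 1"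

lemma field_hom_nz: "field_hom \<phi> \<Longrightarrow> a \<noteq> 0 \<Longrightarrow> \<phi> a \<noteq> 0"
  unfolding field_hom_def by (metis mult_zero_left right_inverse zero_neq_one)

lemma field_hom_0: "field_hom \<phi> \<Longrightarrow> \<phi> 0 = 0"
  unfolding field_hom_def by (metis add_cancel_right_right add.right_neutral)

lemma field_hom_sum: "field_hom \<phi> \<Longrightarrow> \<phi> (sum f A) = (\<Sum>a\<in>A. \<phi> (f a))"
  by (induction A rule: infinite_finite_induct) (auto simp: field_hom_0 field_hom_def)

lemma pdiff_Cst [simp]: "pdiff i (Cst c) = 0"
  unfolding Cst_def pdiff_single by simp

lemma pdiff_Var: "pdiff i (Var j) = (if i = j then 1 else 0)"
  unfolding Var_def pdiff_single by (auto simp: lookup_single when_def)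

lemma pdiff_F_to_F [simp]: "pdiff_F i (to_F p) = to_F (pdiff i p)"
  using pdiff_F_Fract[of 1 i p] pdiff_Cst[of i 1] by (simp add: to_F_def)

lemma twisted_derivation_pdiff_F:
  "twisted_derivation (\<lambda>x. x) (pdiff_F i :: 'n::linorder ratfun \<Rightarrow> _)"
proof -
  have "pdiff_F i (a + b) = pdiff_F i a + pdiff_F i b \<and> pdiff_F i (a * b) = pdiff_F i a * b + a * pdiff_F i b"
    for a b :: "'n ratfun"
  proof -
    obtain p q where a: "q \<noteq> 0" "a = Fract p q" by (cases a)
    obtain r s where b: "s \<noteq> 0" "b = Fract r s" by (cases b)
    show ?thesis
      using a b by (simp add: pdiff_F_Fract eq_fract pdiff_add pdiff_mult) (simp add: algebra_simps)
  qed
  then show ?thesis by (auto simp: twisted_derivation_def)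
qed

lemma twisted_derivation_der_app: "twisted_derivation (\<lambda>x. x) (der_app \<theta>)"
proof -
  have "twisted_derivation (\<lambda>x. x) (pdiff_F i :: 'a ratfun \<Rightarrow> _)" for i by (rule twisted_derivation_pdiff_F)
  then have p: "pdiff_F i (a + b) = pdiff_F i a + pdiff_F i b"
    "pdiff_F i (a * b) = pdiff_F i a * b + a * pdiff_F i b" "pdiff_F i (const_F c) = 0" for i and a b :: "'a ratfun" and c
    by (auto simp: twisted_derivation_def)
  show ?thesis unfolding twisted_derivation_def der_app_def p
    by (auto simp: algebra_simps sum.distrib sum_distrib_left)
qed

lemma der_app_add: "der_app \<theta> (a + b) = der_app \<theta> a + der_app \<theta> b"
  and der_app_mult: "der_app \<theta> (a * b) = der_app \<theta> a * b + a * der_app \<theta> b"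
  and der_app_const [simp]: "der_app \<theta> (const_F c) = 0"
  using twisted_derivation_der_app[of \<theta>] by (auto simp: twisted_derivation_def)

lemma der_app_0 [simp]: "der_app \<theta> 0 = 0" and der_app_1 [simp]: "der_app \<theta> 1 = 0"
  using der_app_const[of \<theta> 0] der_app_const[of \<theta> 1] by simp_all

lemma der_app_sum: "der_app \<theta> (sum f A) = (\<Sum>a\<in>A. der_app \<theta> (f a))"
  by (induction A rule: infinite_finite_induct) (simp_all add: der_app_add)

lemma der_app_minus: "der_app \<theta> (- a) = - der_app \<theta> a"
  using der_app_add[of \<theta> a "- a"] by (simp add: eq_neg_iff_add_eq_0 add.commute)

lemma der_app_prod:
  "finite A \<Longrightarrow> der_app \<theta> (prod f A) = (\<Sum>a\<in>A. der_app \<theta> (f a) * prod f (A - {a}))"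
proof (induction A rule: finite_induct)
  case (insert x A)
  have "prod f (insert x A - {a}) = f x * prod f (A - {a})" if "a \<in> A" for a
    using insert that by (auto simp: insert_Diff_if)
  with insert show ?case
    by (simp add: der_app_mult sum_distrib_left algebra_simps)
qed simp

lemma der_app_vec_add: "der_app (\<theta> + \<eta>) f = der_app \<theta> f + der_app \<eta> f"
  and der_app_smult: "der_app (a *s \<theta>) f = a * der_app \<theta> f"
  and der_app_0_vec [simp]: "der_app 0 f = 0"
  by (simp_all add: der_app_def algebra_simps sum.distrib sum_distrib_left)

lemma der_app_vec_sum: "der_app (sum \<theta> A) f = (\<Sum>a\<in>A. der_app (\<theta> a) f)"
  by (induction A rule: infinite_finite_induct) (simp_all add: der_app_vec_add)

lemma der_app_Var [simp]: "der_app \<theta> (to_F (Var i)) = \<theta> $ i"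
  by (simp add: der_app_def pdiff_Var if_distrib[of to_F] if_distrib[of "\<lambda>x. _ * x"] cong: if_cong)

lemma der_app_lin_form: "der_app \<theta> (to_F (lin_form a)) = (\<Sum>i\<in>UNIV. const_F (a $ i) * \<theta> $ i)"
  by (simp add: lin_form_def to_F_sum to_F_mult der_app_sum der_app_mult)

lemma der_app_power: "der_app \<theta> (x ^ n) = of_nat n * x ^ (n - 1) * der_app \<theta> x"
proof (induction n)
  case (Suc n)
  then show ?case by (cases n) (simp_all add: der_app_mult algebra_simps)
qed simp

lemma der_app_inverse:
  assumes "x \<noteq> 0" shows "der_app \<theta> (inverse x) = - der_app \<theta> x / x ^ 2"
proof -
  have "der_app \<theta> (x * inverse x) = 0" using assms by simp
  then have "x * der_app \<theta> (inverse x) = - (der_app \<theta> x * inverse x)"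
    by (simp add: der_app_mult eq_neg_iff_add_eq_0 add.commute)
  then show ?thesis using assms by (simp add: field_simps power2_eq_square)
qed

lemma der_app_powi:
  assumes "x \<noteq> 0" shows "der_app \<theta> (x powi n) = of_int n * x powi (n - 1) * der_app \<theta> x"
proof (cases "n \<ge> 0")
  case True
  then obtain k where "n = int k" using nonneg_int_cases by blast
  moreover have "x powi (int (Suc m) - 1) = x ^ m" for m by simp
  ultimately show ?thesis
    using der_app_power[of \<theta> x k] by (cases k) (simp_all del: of_nat_Suc power_Suc)
next
  case False
  define k where "k = nat (- n)"
  have k: "n = - int k" "k > 0" using False by (auto simp: k_def)
  have "x powi n = inverse (x ^ k)" by (simp add: k power_int_minus)
  then have "der_app \<theta> (x powi n) = - (of_nat k * x ^ (k - 1) * der_app \<theta> x) / (x ^ k) ^ 2"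
    using assms by (simp add: der_app_inverse der_app_power)
  also have "x ^ (k - 1) = x ^ k / x" using assms k(2) by (simp add: power_diff)
  also have "- (of_nat k * (x ^ k / x) * der_app \<theta> x) / (x ^ k) ^ 2 = - of_nat k * (inverse (x ^ k) / x) * der_app \<theta> x"
    using assms by (simp add: field_simps power2_eq_square)
  also have "inverse (x ^ k) / x = x powi (n - 1)"
    using assms by (simp add: power_int_diff k power_int_minus)
  finally show ?thesis by (simp add: k)
qed

text \<open>Both sides are derivations along \<open>\<phi>\<close>, so agreement on the variables
  extends to polynomials. A fraction is reached by applying the product rule to
  \<open>f * q = p\<close> and cancelling \<open>\<phi> q\<close>, which is nonzero because
  \<open>\<phi>\<close> is injective.\<close>

lemma twisted_derivation_chain:
  fixes \<delta> :: "'n::{finite,linorder} ratfun \<Rightarrow> 'n ratfun"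
  assumes \<phi>: "field_hom \<phi>" and \<delta>: "twisted_derivation \<phi> \<delta>"
  shows "\<delta> f = (\<Sum>i\<in>UNIV. \<phi> (pdiff_F i f) * \<delta> (to_F (Var i)))"
proof -
  have add: "\<And>a b. \<delta> (a + b) = \<delta> a + \<delta> b" and mult: "\<And>a b. \<delta> (a * b) = \<delta> a * \<phi> b + \<phi> a * \<delta> b"
    and const: "\<And>c. \<delta> (const_F c) = 0"
    using \<delta> by (auto simp: twisted_derivation_def)
  have padd: "\<And>a b. \<phi> (a + b) = \<phi> a + \<phi> b" and pmult: "\<And>a b. \<phi> (a * b) = \<phi> a * \<phi> b"
    and p0: "\<phi> 0 = 0" and p1: "\<phi> 1 = 1"
    using \<phi> field_hom_0 by (auto simp: field_hom_def)
  define \<delta>' where "\<delta>' f = (\<Sum>i\<in>UNIV. \<phi> (pdiff_F i f) * \<delta> (to_F (Var i)))" for f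
  have d: "twisted_derivation (\<lambda>x. x) (pdiff_F i :: 'n ratfun \<Rightarrow> _)" for i
    by (rule twisted_derivation_pdiff_F)
  have add': "\<delta>' (a + b) = \<delta>' a + \<delta>' b" and mult': "\<delta>' (a * b) = \<delta>' a * \<phi> b + \<phi> a * \<delta>' b" for a b
    using d by (auto simp: twisted_derivation_def \<delta>'_def padd pmult algebra_simps sum.distrib sum_distrib_left)
  have poly: "\<delta> (to_F p) = \<delta>' (to_F p)" for p
  proof (induction p rule: mpol_ring_induct)
    case (Cst c)
    show ?case by (simp add: const \<delta>'_def p0)
  next
    case (Var i)
    have "\<phi> (pdiff_F j (to_F (Var i))) = (if j = i then 1 else 0)" for j
      by (simp add: pdiff_Var p0 p1)
    then show ?case
      by (simp add: \<delta>'_def if_distrib[of "\<lambda>x. x * _"] cong: if_cong)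
  qed (simp_all add: to_F_add to_F_mult add add' mult mult')
  obtain p q where q: "q \<noteq> 0" "f = to_F p / to_F q" by (rule ratfun_cases)
  then have f: "f * to_F q = to_F p" by simp
  have "\<delta> f * \<phi> (to_F q) = \<delta>' f * \<phi> (to_F q)"
    using poly[of p] poly[of q] unfolding f[symmetric] mult mult' by simp
  with field_hom_nz[OF \<phi>, of "to_F q"] q show ?thesis by (simp add: \<delta>'_def)
qed

lemma field_hom_id: "field_hom (\<lambda>x. x)"
  by (simp add: field_hom_def)

type_synonym 'n fmat = "'n der ^ 'n"

section \<open>Subrings and determinants\<close>

definition is_subring :: "'a::comm_ring_1 set \<Rightarrow> bool" where
  "is_subring A \<longleftrightarrow> 1 \<in> A \<and> (\<forall>x\<in>A. \<forall>y\<in>A. x - y \<in> A \<and> x * y \<in> A)"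

lemma is_subringD:
  assumes "is_subring A"
  shows "1 \<in> A" "0 \<in> A" "x \<in> A \<Longrightarrow> y \<in> A \<Longrightarrow> x - y \<in> A" "x \<in> A \<Longrightarrow> y \<in> A \<Longrightarrow> x * y \<in> A"
    "x \<in> A \<Longrightarrow> - x \<in> A" "x \<in> A \<Longrightarrow> y \<in> A \<Longrightarrow> x + y \<in> A"
proof -
  show 1: "1 \<in> A" and d: "x \<in> A \<Longrightarrow> y \<in> A \<Longrightarrow> x - y \<in> A" and "x \<in> A \<Longrightarrow> y \<in> A \<Longrightarrow> x * y \<in> A" for x y
    using assms by (auto simp: is_subring_def)
  from d[OF 1 1] show 0: "0 \<in> A" by simp
  from d[OF 0] show m: "x \<in> A \<Longrightarrow> - x \<in> A" for x by simp
  from d[OF _ m] show "x \<in> A \<Longrightarrow> y \<in> A \<Longrightarrow> x + y \<in> A" for x y by fastforce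
qed

lemma is_subring_sum: "is_subring A \<Longrightarrow> (\<And>i. i \<in> I \<Longrightarrow> f i \<in> A) \<Longrightarrow> sum f I \<in> A"
  by (induction I rule: infinite_finite_induct) (auto intro: is_subringD)

lemma is_subring_prod: "is_subring A \<Longrightarrow> (\<And>i. i \<in> I \<Longrightarrow> f i \<in> A) \<Longrightarrow> prod f I \<in> A"
  by (induction I rule: infinite_finite_induct) (auto intro: is_subringD)

lemma is_subring_power: "is_subring A \<Longrightarrow> x \<in> A \<Longrightarrow> x ^ n \<in> A"
  by (induction n) (auto intro: is_subringD)

lemma is_subring_det:
  assumes "is_subring A" "\<And>i j. M $ i $ j \<in> A"
  shows "det M \<in> A"
proof -
  have "(of_int (sign p) :: 'a) \<in> A" for p :: "'b \<Rightarrow> 'b"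
    using assms(1) by (cases rule: sign_cases[of p]) (auto intro: is_subringD)
  then show ?thesis
    unfolding det_def using assms by (auto intro!: is_subring_sum is_subringD(4) is_subring_prod)
qed

text \<open>By Cramer's rule a coordinate times the determinant is itself a determinant over
  \<open>A\<close>, so the only division is by \<open>det M\<close>.\<close>

lemma is_subring_cramer:
  fixes M :: "'a::field ^ 'n ^ 'n"
  assumes A: "is_subring A" and M: "\<And>i j. M $ i $ j \<in> A" and d: "inverse (det M) \<in> A" "det M \<noteq> 0"
    and x: "\<And>i. (M *v x) $ i \<in> A"
  shows "x $ k \<in> A"
proof -
  have "x $ k * det M = det (\<chi> i j. if j = k then (M *v x) $ i else M $ i $ j)"
    by (simp add: cramer_lemma)
  moreover have "\<dots> \<in> A" using A M x by (intro is_subring_det) auto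
  ultimately have "x $ k * det M * inverse (det M) \<in> A" using d A by (auto intro: is_subringD)
  then show ?thesis using d by (simp add: mult.assoc)
qed

lemma det_map:
  fixes h :: "'a::comm_ring_1 \<Rightarrow> 'b::comm_ring_1" and A :: "'a ^ 'n ^ 'n"
  assumes "\<And>x y. h (x + y) = h x + h y" "\<And>x y. h (x * y) = h x * h y" "h 1 = 1"
  shows "det (\<chi> i j. h (A $ i $ j)) = h (det A)"
proof -
  have h0: "h 0 = 0" using assms(1)[of 0 0] by simp
  have hm: "h (- x) = - h x" for x using assms(1)[of x "- x"] by (simp add: h0 eq_neg_iff_add_eq_0 add.commute)
  have hs: "h (sum f I) = (\<Sum>i\<in>I. h (f i))" for f :: "('n \<Rightarrow> 'n) \<Rightarrow> 'a" and I
    by (induction I rule: infinite_finite_induct) (auto simp: h0 assms)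
  have hp: "h (prod f I) = (\<Prod>i\<in>I. h (f i))" for f :: "'n \<Rightarrow> 'a" and I
    by (induction I rule: infinite_finite_induct) (auto simp: assms)
  have hsgn: "h (of_int (sign p)) = of_int (sign p)" for p :: "'n \<Rightarrow> 'n"
    by (cases rule: sign_cases[of p]) (auto simp: assms hm)
  show ?thesis unfolding det_def by (simp add: hs hp hsgn assms)
qed

text \<open>Every product in the permutation expansion has the same weight, because a permutation
  merely reorders the \<open>b j\<close>. With the Euler derivation this yields degrees of
  determinants from row and column degrees.\<close>

lemma der_app_det:
  fixes A :: "'n::{finite,linorder} fmat"
  assumes "\<And>i j. der_app \<theta> (A $ i $ j) = (a i + b j) * A $ i $ j"
  shows "der_app \<theta> (det A) = (sum a UNIV + sum b UNIV) * det A"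
proof -
  have p: "der_app \<theta> (\<Prod>i\<in>UNIV. A $ i $ p i) = (sum a UNIV + sum b UNIV) * (\<Prod>i\<in>UNIV. A $ i $ p i)"
    if "p permutes UNIV" for p :: "'n \<Rightarrow> 'n"
  proof -
    have "der_app \<theta> (\<Prod>i\<in>UNIV. A $ i $ p i) = (\<Sum>i\<in>UNIV. (a i + b (p i)) * (\<Prod>i\<in>UNIV. A $ i $ p i))"
      unfolding der_app_prod[OF finite_class.finite_UNIV]
    proof (rule sum.cong[OF refl])
      fix i
      show "der_app \<theta> (A $ i $ p i) * (\<Prod>j\<in>UNIV - {i}. A $ j $ p j) =
          (a i + b (p i)) * (\<Prod>j\<in>UNIV. A $ j $ p j)"
        using prod.remove[of UNIV i "\<lambda>j. A $ j $ p j"] by (simp add: assms mult.assoc)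
    qed
    also have "\<dots> = (sum a UNIV + (\<Sum>i\<in>UNIV. b (p i))) * (\<Prod>i\<in>UNIV. A $ i $ p i)"
      by (simp add: sum_distrib_right[symmetric] sum.distrib)
    also have "(\<Sum>i\<in>UNIV. b (p i)) = sum b UNIV"
      using sum.permute[OF that, of b] by (simp add: o_def)
    finally show ?thesis .
  qed
  have s: "der_app \<theta> (of_int (sign p)) = 0" for p :: "'n \<Rightarrow> 'n"
    by (cases rule: sign_cases[of p]) (auto simp: der_app_minus)
  show ?thesis
    unfolding det_def der_app_sum sum_distrib_left
    by (intro sum.cong) (auto simp: der_app_mult s p)
qed

section \<open>The local ring of a hyperplane\<close>

lemma pairing_add: "pairing (a + b) v = pairing a v + pairing b v"
  "pairing a (v + w) = pairing a v + pairing a w"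
  "pairing (x *s a) v = x * pairing a v" "pairing a (x *s v) = x * pairing a v"
  "pairing (a - b) v = pairing a v - pairing b v" "pairing a (v - w) = pairing a v - pairing a w"
  by (simp_all add: pairing_def algebra_simps sum.distrib sum_subtractf sum_distrib_left)

text \<open>Restriction to a hyperplane and a reflection both move every variable by a multiple of
  one linear form; here the congruence is carried over to all polynomials.\<close>

lemma poly_eval_cong_dvd:
  fixes p :: "'i::linorder mpol"
  assumes "\<And>i. d dvd \<sigma> i - \<tau> i"
  shows "d dvd poly_eval \<sigma> p - poly_eval \<tau> p"
proof (induction p rule: mpol_ring_induct)
  case (mult x y)
  have "poly_eval \<sigma> (x * y) - poly_eval \<tau> (x * y) =
      (poly_eval \<sigma> x - poly_eval \<tau> x) * poly_eval \<sigma> y + poly_eval \<tau> x * (poly_eval \<sigma> y - poly_eval \<tau> y)"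
    by (simp add: poly_eval_mult algebra_simps)
  then show ?case using mult by (simp add: dvd_add)
next
  case (add x y)
  have "poly_eval \<sigma> (x + y) - poly_eval \<tau> (x + y) =
      (poly_eval \<sigma> x - poly_eval \<tau> x) + (poly_eval \<sigma> y - poly_eval \<tau> y)"
    by (simp add: poly_eval_add)
  then show ?case using add by (simp add: dvd_add)
qed (use assms in auto)

lemma poly_eval_lin_form: "poly_eval \<sigma> (lin_form a) = (\<Sum>i\<in>UNIV. Cst (a $ i) * \<sigma> i)"
  by (simp add: lin_form_def poly_eval_sum poly_eval_mult)

lemma lin_form_add: "lin_form (a + b) = lin_form a + lin_form b"
  and lin_form_smult: "lin_form (x *s a) = Cst x * lin_form a"
  by (simp_all add: lin_form_def Cst_add Cst_mult algebra_simps sum.distrib sum_distrib_left)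

lemma lin_form_axis: "lin_form (axis i 1) = Var i"
  by (simp add: lin_form_def axis_def if_distrib[of Cst] if_distrib[of "\<lambda>x. x * _"] cong: if_cong)

lemma pairing_axis: "pairing (axis i 1) v = v $ i" "pairing v (axis i 1) = v $ i"
  by (simp_all add: pairing_def axis_def if_distrib[of "\<lambda>x. x * _"] if_distrib[of "\<lambda>x. _ * x"] cong: if_cong)

lemma pairing_vector_matrix: "pairing (b v* g) v = pairing b (g *v v)"
  unfolding pairing_def vector_matrix_mult_def matrix_vector_mult_def
  by (simp add: sum_distrib_left sum_distrib_right mult.assoc mult.left_commute) (rule sum.swap)

lemma lin_form_eval:
  fixes v :: "'n::{finite,linorder} cvec"
  shows "poly_eval (\<lambda>i. Cst (v $ i)) (lin_form a) = (Cst (pairing a v) :: 'n mpol)"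
  by (simp add: poly_eval_lin_form pairing_def Cst_sum Cst_mult)

lemma lin_form_eq_iff: "lin_form a = lin_form b \<longleftrightarrow> a = (b :: 'n::{finite,linorder} cvec)"
proof
  assume eq: "lin_form a = lin_form b"
  have "a $ i = b $ i" for i
    using lin_form_eval[of "axis i 1" a] lin_form_eval[of "axis i 1" b] eq by (simp add: pairing_axis)
  then show "a = b" by (simp add: vec_eq_iff)
qed simp

lemma act_lin_form: "act g (lin_form a) = lin_form (a v* matrix_inv g)"
  by (simp add: act_def poly_eval_lin_form lin_form_sum)

lemma act_hom:
  "act g (p + q) = act g p + act g q" "act g (p * q) = act g p * act g q" "act g (Cst c) = Cst c"
  "act g 0 = 0" "act g 1 = 1"
  by (simp_all add: act_def poly_eval_add poly_eval_mult)

lemma act_prod: "act g (prod f A) = (\<Prod>a\<in>A. act g (f a))"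
  by (simp add: act_def poly_eval_prod)

lemma act_nz: "invertible g \<Longrightarrow> p \<noteq> 0 \<Longrightarrow> act g p \<noteq> 0"
  by (metis act_hom(4) act_matrix_inv)

lemma act_F_to_F: "invertible g \<Longrightarrow> act_F g (to_F p) = to_F (act g p)"
  by (simp add: to_F_def act_F_Fract act_hom)

lemma act_F_divide:
  "invertible g \<Longrightarrow> q \<noteq> 0 \<Longrightarrow> act_F g (to_F p / to_F q) = to_F (act g p) / to_F (act g q)"
  using act_F_Fract[of g q p] by (simp add: Fract_to_F)

lemma field_hom_act_F:
  fixes g :: "'n::{finite,linorder} cmat"
  assumes g: "invertible g"
  shows "field_hom (act_F g)"
proof -
  have "act_F g (a + b) = act_F g a + act_F g b \<and> act_F g (a * b) = act_F g a * act_F g b" for a b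
  proof -
    obtain p q where a: "q \<noteq> 0" "a = to_F p / to_F q" by (rule ratfun_cases)
    obtain r s where b: "s \<noteq> 0" "b = to_F r / to_F s" by (rule ratfun_cases)
    note nz = act_nz[OF g a(1)] act_nz[OF g b(1)]
    have "a + b = to_F (p * s + r * q) / to_F (q * s)" "a * b = to_F (p * r) / to_F (q * s)"
      using a b by (simp_all add: to_F_mult to_F_add field_simps)
    then have "act_F g (a + b) = to_F (act g (p * s + r * q)) / to_F (act g (q * s))"
      "act_F g (a * b) = to_F (act g (p * r)) / to_F (act g (q * s))"
      using a b act_F_divide[OF g] by simp_all
    moreover have "act_F g a = to_F (act g p) / to_F (act g q)" "act_F g b = to_F (act g r) / to_F (act g s)"
      using a b act_F_divide[OF g] by simp_all
    moreover have "to_F (act g q) \<noteq> 0" "to_F (act g s) \<noteq> 0" using nz by simp_all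
    from add_frac_eq[OF this, of "to_F (act g p)" "to_F (act g r)"]
    have "to_F (act g (p * s + r * q)) / to_F (act g (q * s)) =
        to_F (act g p) / to_F (act g q) + to_F (act g r) / to_F (act g s)"
      by (simp add: act_hom to_F_mult to_F_add)
    ultimately show ?thesis by (simp add: act_hom to_F_mult)
  qed
  moreover have "act_F g 1 = 1" using act_F_to_F[OF g, of 1] by (simp add: act_hom)
  ultimately show ?thesis by (auto simp: field_hom_def)
qed

lemma act_F_const: "invertible g \<Longrightarrow> act_F g (const_F c) = const_F c"
  by (simp add: act_F_to_F act_hom)

text \<open>\<open>\<theta>\<close> commutes with \<open>g\<close> exactly when this map vanishes,
  and by the chain rule its vanishing only has to be checked on the variables.\<close>

lemma twisted_derivation_commutator:
  assumes "invertible g"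
  shows "twisted_derivation (act_F g) (\<lambda>f. act_F g (der_app \<theta> f) - der_app \<theta> (act_F g f))"
proof -
  have fh: "field_hom (act_F g)" by (rule field_hom_act_F[OF assms])
  then have "act_F g (x + y) = act_F g x + act_F g y" "act_F g (x * y) = act_F g x * act_F g y" for x y
    by (auto simp: field_hom_def)
  then show ?thesis
    by (simp add: twisted_derivation_def field_hom_0[OF fh] act_F_const[OF assms] der_app_add der_app_mult algebra_simps)
qed

section \<open>Orders along a single hyperplane\<close>

locale linear_form =
  fixes a c :: "'n::{finite,linorder} cvec"
  assumes pairing_ac: "pairing a c = 1"
begin

abbreviation L :: "'n mpol" where "L \<equiv> lin_form a"
abbreviation \<pi> :: "'n ratfun" where "\<pi> \<equiv> to_F L"

text \<open>Restriction to the hyperplane along the projection \<open>x \<mapsto> x - a(x) c\<close>; its kernel is the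
  ideal of the hyperplane, which is therefore prime.\<close>

definition restrict :: "'n mpol \<Rightarrow> 'n mpol" where
  "restrict = poly_eval (\<lambda>i. Var i - Cst (c $ i) * L)"

lemma dvd_iff_restrict: "L dvd p \<longleftrightarrow> restrict p = 0"
proof -
  have "restrict L = (\<Sum>i\<in>UNIV. Cst (a $ i) * Var i) - (\<Sum>i\<in>UNIV. Cst (a $ i * c $ i)) * L"
    unfolding restrict_def poly_eval_lin_form
    by (simp add: algebra_simps sum_subtractf sum_distrib_left Cst_mult)
  also have "\<dots> = 0"
    using pairing_ac by (simp flip: Cst_sum lin_form_def add: pairing_def)
  finally have L: "restrict L = 0" .
  have "L dvd poly_eval Var p - restrict p"
    unfolding restrict_def by (rule poly_eval_cong_dvd) simp
  then have "L dvd p - restrict p" by (simp add: poly_eval_id)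
  then show ?thesis
    using L by (auto simp: restrict_def poly_eval_mult dvd_def)
qed

lemma L_nz: "L \<noteq> 0"
  using lin_form_eval[of c a] pairing_ac by auto

lemma \<pi>_nz: "\<pi> \<noteq> 0" using L_nz by simp

lemma not_dvd_1: "\<not> L dvd 1"
  unfolding dvd_iff_restrict by (simp add: restrict_def)

lemma dvd_mult_iff: "L dvd p * q \<longleftrightarrow> L dvd p \<or> L dvd q"
  unfolding dvd_iff_restrict by (simp add: restrict_def poly_eval_mult)

abbreviation loc :: "'n ratfun set" where "loc \<equiv> loc_at a"

lemma locI: "\<not> L dvd q \<Longrightarrow> to_F p / to_F q \<in> loc"
  unfolding loc_at_def by (auto simp flip: Fract_to_F)

lemma locE:
  assumes "f \<in> loc"
  obtains p q where "\<not> L dvd q" "q \<noteq> 0" "f = to_F p / to_F q"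
  using assms unfolding loc_at_def by (force simp: Fract_to_F)

lemma loc_to_F [simp]: "to_F p \<in> loc"
  using locI[of 1 p] not_dvd_1 by simp

lemma loc_subring: "is_subring loc"
proof -
  have "x - y \<in> loc \<and> x * y \<in> loc" if xy: "x \<in> loc" "y \<in> loc" for x y
  proof -
    obtain p q where x: "\<not> L dvd q" "q \<noteq> 0" "x = to_F p / to_F q" using xy(1) by (rule locE)
    obtain r s where y: "\<not> L dvd s" "s \<noteq> 0" "y = to_F r / to_F s" using xy(2) by (rule locE)
    have "x - y = to_F (p * s - r * q) / to_F (q * s)" "x * y = to_F (p * r) / to_F (q * s)"
      unfolding x(3) y(3) to_F_mult to_F_diff using x(2) y(2) by (simp_all add: diff_frac_eq)
    moreover have "\<not> L dvd q * s" using x(1) y(1) by (simp add: dvd_mult_iff)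
    ultimately show ?thesis by (simp add: locI)
  qed
  then show ?thesis using loc_to_F[of 1] by (auto simp: is_subring_def)
qed

lemmas loc_ring = is_subringD[OF loc_subring]

lemma loc_of_int: "of_int n \<in> loc"
  using loc_to_F[of "Cst (of_int n)"] by (simp only: const_F_of_int)

lemma loc_pdiff:
  assumes "f \<in> loc" shows "pdiff_F i f \<in> loc"
proof -
  obtain p q where f: "\<not> L dvd q" "q \<noteq> 0" "f = to_F p / to_F q" using assms by (rule locE)
  then have "pdiff_F i f = to_F (pdiff i p * q - p * pdiff i q) / to_F (q * q)"
    using pdiff_F_Fract[of q i p] by (simp add: Fract_to_F)
  moreover have "\<not> L dvd q * q" using f(1) by (simp add: dvd_mult_iff)
  ultimately show ?thesis by (simp add: locI)
qed

text \<open>The fractional ideal of functions of order at least \<open>m\<close>. Multiplying by the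
  opposite power, instead of using a valuation, treats poles and zeros alike and lets 0 belong to
  every \<open>lo m\<close>.\<close>

definition lo :: "int \<Rightarrow> 'n ratfun set" where
  "lo m = {f. \<pi> powi (- m) * f \<in> loc}"

lemma powi_add: "\<pi> powi m * \<pi> powi n = \<pi> powi (m + n)"
  using power_int_add[of \<pi> m n] \<pi>_nz by simp

lemma powi_cancel [simp]: "\<pi> powi m * (\<pi> powi n * f) = \<pi> powi (m + n) * f"
  unfolding powi_add[symmetric] by (simp add: mult.assoc)

lemma lo_eq_image: "(\<lambda>s. \<pi> powi m * s) ` loc = lo m"
proof (rule equalityI; rule subsetI)
  fix f assume "f \<in> lo m"
  moreover have "f = \<pi> powi m * (\<pi> powi (- m) * f)" by simp
  ultimately show "f \<in> (\<lambda>s. \<pi> powi m * s) ` loc" unfolding lo_def by blast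
qed (auto simp: lo_def)

lemma lo_0: "lo 0 = loc" by (simp add: lo_def)

lemma lo_mult: "f \<in> lo m \<Longrightarrow> g \<in> lo n \<Longrightarrow> f * g \<in> lo (m + n)"
proof -
  assume "f \<in> lo m" "g \<in> lo n"
  then have "(\<pi> powi (- m) * f) * (\<pi> powi (- n) * g) \<in> loc" by (auto simp: lo_def intro: loc_ring)
  also have "(\<pi> powi (- m) * f) * (\<pi> powi (- n) * g) = \<pi> powi (- (m + n)) * (f * g)"
    unfolding minus_add_distrib powi_add[symmetric] by (simp only: ac_simps)
  finally show ?thesis by (simp add: lo_def)
qed

lemma lo_mult_loc: "f \<in> loc \<Longrightarrow> g \<in> lo n \<Longrightarrow> f * g \<in> lo n"
  using lo_mult[of f 0 g n] by (simp add: lo_0)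

lemma lo_add: "f \<in> lo m \<Longrightarrow> g \<in> lo m \<Longrightarrow> f + g \<in> lo m"
  and lo_diff: "f \<in> lo m \<Longrightarrow> g \<in> lo m \<Longrightarrow> f - g \<in> lo m"
  and lo_zero: "0 \<in> lo m"
  unfolding lo_def using loc_ring(2,3,5,6) by (auto simp: distrib_left right_diff_distrib)

lemma lo_powi: "\<pi> powi m \<in> lo m"
  using loc_ring(1) by (simp add: lo_def powi_add)

lemma lo_powi_iff: "\<pi> powi n * f \<in> lo m \<longleftrightarrow> f \<in> lo (m - n)"
  by (simp add: lo_def add.commute)

lemma lo_mono: "m \<le> n \<Longrightarrow> f \<in> lo n \<Longrightarrow> f \<in> lo m"
proof -
  assume mn: "m \<le> n" and f: "f \<in> lo n"
  have "\<pi> powi (n - m) = to_F (L ^ nat (n - m))" using mn by (simp add: power_int_def to_F_power)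
  then have "\<pi> powi (n - m) * (\<pi> powi (- n) * f) \<in> loc"
    using f by (auto simp: lo_def intro: loc_ring)
  also have "\<pi> powi (n - m) * (\<pi> powi (- n) * f) = \<pi> powi (- m) * f"
    by simp
  finally show ?thesis by (simp add: lo_def)
qed

lemma to_F_in_lo_1_iff: "to_F p \<in> lo 1 \<longleftrightarrow> L dvd p"
proof
  assume "to_F p \<in> lo 1"
  then have "inverse \<pi> * to_F p \<in> loc" by (simp add: lo_def power_int_minus)
  then obtain r q where q: "\<not> L dvd q" "q \<noteq> 0" "inverse \<pi> * to_F p = to_F r / to_F q" by (rule locE)
  then have "to_F (p * q) = to_F (L * r)" using \<pi>_nz by (simp add: to_F_mult field_simps)
  then have "p * q = L * r" by (simp only: to_F_eq_iff)
  then show "L dvd p" using q dvd_mult_iff by (metis dvd_triv_left)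
next
  assume "L dvd p"
  then obtain r where "p = L * r" by (auto simp: dvd_def)
  then show "to_F p \<in> lo 1" using \<pi>_nz by (simp add: lo_def to_F_mult power_int_minus flip: mult.assoc)
qed

text \<open>\<open>lo 1\<close> is the maximal ideal: a fraction outside it has a numerator not
  divisible by \<open>L\<close> and may be turned over.\<close>

lemma loc_unit:
  assumes "f \<in> loc" "f \<notin> lo 1" shows "inverse f \<in> loc" "f \<noteq> 0"
proof -
  obtain p q where q: "\<not> L dvd q" "q \<noteq> 0" "f = to_F p / to_F q" using assms(1) by (rule locE)
  have "\<not> L dvd p"
  proof
    assume "L dvd p"
    then have "inverse (to_F q) * to_F p \<in> lo 1"
      using lo_mult_loc[of "inverse (to_F q)" "to_F p"] locI[of q 1] q to_F_in_lo_1_iff by (auto simp: field_simps)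
    with assms q show False by (simp add: field_simps)
  qed
  then show "inverse f \<in> loc" using locI[of p q] by (simp add: q(3))
  show "f \<noteq> 0" using assms lo_zero by auto
qed

lemma powi_in_lo_iff: "\<pi> powi n \<in> lo m \<longleftrightarrow> m \<le> n"
proof
  assume a: "\<pi> powi n \<in> lo m"
  show "m \<le> n"
  proof (rule ccontr)
    assume "\<not> m \<le> n"
    then have "\<pi> powi n \<in> lo (n + 1)" using a lo_mono[of "n + 1" m] by simp
    then have "to_F 1 \<in> lo 1" using lo_powi_iff[of n 1 "n + 1"] by simp
    then show False using to_F_in_lo_1_iff[of 1] not_dvd_1 by simp
  qed
qed (rule lo_mono[OF _ lo_powi])

end

section \<open>Coordinates adapted to a hyperplane\<close>

context linear_form begin

lemma det_row_lo:
  assumes "\<And>i. X $ k $ i \<in> lo m" "\<And>j i. j \<noteq> k \<Longrightarrow> X $ j $ i \<in> loc"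
  shows "det X \<in> lo m"
proof -
  have "det (\<chi> j. if j = k then \<pi> powi (- m) *s X $ k else X $ j) \<in> loc"
    using assms by (intro is_subring_det[OF loc_subring]) (auto simp: lo_def)
  also have "det (\<chi> j. if j = k then \<pi> powi (- m) *s X $ k else X $ j) =
      \<pi> powi (- m) * det (\<chi> j. if j = k then X $ k else X $ j)"
    by (rule det_row_mul)
  also have "(\<chi> j. if j = k then X $ k else X $ j) = X" by (simp add: vec_eq_iff)
  finally show ?thesis by (simp add: lo_def)
qed

text \<open>The logarithmic condition treats \<open>a\<close> and the forms vanishing at
  \<open>c\<close> differently, so a basis made of \<open>a\<close> and such forms is wanted. For
  \<open>a $ k\<close> nonzero, \<open>a\<close> can take the place of the \<open>k\<close>-th
  coordinate while each other coordinate is corrected by a multiple of \<open>a\<close>; column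
  \<open>k\<close> of the inverse is then \<open>c\<close>.\<close>

lemma frame:
  obtains P :: "'n cmat" and k and Q :: "'n cmat" where "P $ k = a" "\<forall>j. j \<noteq> k \<longrightarrow> pairing (P $ j) c = 0"
    "P ** Q = mat 1" "Q ** P = mat 1" "\<forall>i. Q $ i $ k = c $ i"
proof -
  obtain k where k: "a $ k \<noteq> 0"
    using pairing_ac by (force simp: pairing_def)
  define P :: "'n cmat" where "P = (\<chi> j. if j = k then a else axis j 1 - c $ j *s a)"
  have Pv: "(P *v v) $ j = pairing (P $ j) v" for v j
    by (simp add: matrix_vector_mult_def pairing_def)
  have perp: "pairing (P $ j) c = 0" if "j \<noteq> k" for j
    using that by (simp add: P_def pairing_add pairing_axis pairing_ac)
  have "v = 0" if "P *v v = 0" for v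
  proof -
    have 0: "pairing (P $ j) v = 0" for j using that Pv[of v j] by simp
    have av: "pairing a v = 0" using 0[of k] by (simp add: P_def)
    have v: "v $ j = 0" if "j \<noteq> k" for j using 0[of j] that by (simp add: P_def pairing_add pairing_axis av)
    have "pairing a v = (\<Sum>i\<in>UNIV. if i = k then a $ k * v $ k else 0)"
      unfolding pairing_def by (rule sum.cong) (auto simp: v)
    then have "v $ k = 0" using av k by simp
    with v show "v = 0" by (metis vec_eq_iff zero_index)
  qed
  then obtain Q where Q: "Q ** P = mat 1"
    using matrix_left_invertible_ker[of P] by blast
  then have PQ: "P ** Q = mat 1" using matrix_left_right_inverse by blast
  have "P *v c = axis k 1"
    using pairing_ac by (auto simp: vec_eq_iff Pv axis_def perp) (simp add: P_def)
  then have "Q *v axis k 1 = c" using Q by (metis matrix_vector_mul_assoc matrix_vector_mul_lid)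
  then have "Q $ i $ k = c $ i" for i
    by (auto simp: vec_eq_iff matrix_vector_mult_def axis_def if_distrib[of "\<lambda>x. _ * x"] cong: if_cong)
  then show thesis using that[of P k Q] perp Q PQ by (simp add: P_def)
qed

end

definition mat_F :: "'n cmat \<Rightarrow> 'n::{finite,linorder} fmat" where
  "mat_F P = (\<chi> i j. const_F (P $ i $ j))"

lemma mat_F_nth [simp]: "mat_F P $ i $ j = const_F (P $ i $ j)"
  by (simp add: mat_F_def)

lemma mat_F_mult: "mat_F (P ** Q) = mat_F P ** mat_F Q"
  by (simp add: vec_eq_iff matrix_matrix_mult_def Cst_sum to_F_sum Cst_mult to_F_mult)

lemma mat_F_1: "mat_F (mat 1) = mat 1"
  by (simp add: vec_eq_iff mat_def)

lemma det_mat_F: "det (mat_F P) = const_F (det P)"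
  unfolding mat_F_def by (rule det_map) (simp_all add: const_F_simps)

definition columns_mat :: "('n \<Rightarrow> 'n der) \<Rightarrow> 'n::{finite,linorder} fmat" where
  "columns_mat V = (\<chi> j i. V i $ j)"

lemma columns_mat_nth [simp]: "columns_mat V $ j $ i = V i $ j"
  by (simp add: columns_mat_def)

definition jacobian :: "('n \<Rightarrow> 'n ratfun) \<Rightarrow> 'n::{finite,linorder} fmat" where
  "jacobian f = (\<chi> m i. pdiff_F i (f m))"

lemma jacobian_nth [simp]: "jacobian f $ m $ i = pdiff_F i (f m)"
  by (simp add: jacobian_def)

lemma jacobian_mult_vec: "(jacobian f *v \<theta>) $ m = der_app \<theta> (f m)"
  by (simp add: matrix_vector_mult_def der_app_def mult.commute)

lemma jacobian_mult_columns: "(jacobian f ** columns_mat V) $ m $ i = der_app (V i) (f m)"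
  by (simp add: matrix_matrix_mult_def der_app_def mult.commute)

lemma mat_F_mult_vec: "(mat_F P *v \<theta>) $ j = der_app \<theta> (to_F (lin_form (P $ j)))"
  by (simp add: matrix_vector_mult_def der_app_lin_form)

lemma mat_F_mult_columns: "(mat_F P ** columns_mat V) $ j $ i = der_app (V i) (to_F (lin_form (P $ j)))"
  by (simp add: matrix_matrix_mult_def der_app_lin_form)

lemma der_app_nabla_lin_form:
  "der_app (nabla \<theta> \<eta>) (to_F (lin_form b)) = der_app \<theta> (der_app \<eta> (to_F (lin_form b)))"
  by (simp add: der_app_lin_form nabla_def der_app_sum der_app_mult)

context linear_form begin

text \<open>The condition for membership in a logarithmic module at one hyperplane. Later
  \<open>c\<close> is the Riesz vector of \<open>a\<close>, so the forms vanishing at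
  \<open>c\<close> are those orthogonal to \<open>a\<close>, and the Hermitian form no longer
  appears in local computations.\<close>

definition locl :: "'n der \<Rightarrow> int \<Rightarrow> bool" where
  "locl \<theta> m \<longleftrightarrow> (\<forall>b. pairing b c = 0 \<longrightarrow> der_app \<theta> (to_F (lin_form b)) \<in> loc) \<and> der_app \<theta> \<pi> \<in> lo m"

text \<open>A form vanishing at \<open>c\<close> has coefficient \<open>pairing b c = 0\<close> at
  \<open>a\<close> when expanded in the frame, so the possibly singular value on \<open>a\<close>
  never enters.\<close>

lemma locl_frameI:
  assumes P: "P $ k = a" "P ** Q = mat 1" "Q ** P = mat 1" "\<And>i. Q $ i $ k = c $ i"
    and l: "\<And>j. j \<noteq> k \<Longrightarrow> der_app \<theta> (to_F (lin_form (P $ j))) \<in> loc" "der_app \<theta> \<pi> \<in> lo m"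
  shows "locl \<theta> m"
proof -
  have "der_app \<theta> (to_F (lin_form b)) \<in> loc" if b: "pairing b c = 0" for b
  proof -
    define x where "x = b v* Q"
    have "x $ k = 0" using b P(4) by (simp add: x_def vector_matrix_mult_def pairing_def mult.commute)
    have "x v* P = b"
      unfolding x_def vector_matrix_mul_assoc P(3) by simp
    then have "lin_form b = (\<Sum>j\<in>UNIV. Cst (x $ j) * lin_form (P $ j))" by (simp add: lin_form_sum)
    then have "der_app \<theta> (to_F (lin_form b)) =
        (\<Sum>j\<in>UNIV. const_F (x $ j) * der_app \<theta> (to_F (lin_form (P $ j))))"
      by (simp add: to_F_sum to_F_mult der_app_sum der_app_mult)
    also have "\<dots> \<in> loc"
    proof (intro is_subring_sum[OF loc_subring])
      fix j
      show "const_F (x $ j) * der_app \<theta> (to_F (lin_form (P $ j))) \<in> loc"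
        using l(1)[of j] \<open>x $ k = 0\<close> by (cases "j = k") (auto intro: loc_ring)
    qed
    finally show ?thesis .
  qed
  then show ?thesis using l(2) by (simp add: locl_def)
qed

text \<open>In an adapted frame one row of the matrix has order at least \<open>m\<close> and the
  others are regular; passing back to standard coordinates costs only a constant
  determinant.\<close>

lemma det_locl:
  assumes "\<And>i. locl (V i) m" shows "det (columns_mat V) \<in> lo m"
proof -
  obtain P Q :: "'n cmat" and k where P: "P $ k = a" "\<forall>j. j \<noteq> k \<longrightarrow> pairing (P $ j) c = 0"
    "P ** Q = mat 1" "Q ** P = mat 1" "\<forall>i. Q $ i $ k = c $ i" by (rule frame)
  have "det (mat_F P ** columns_mat V) \<in> lo m"
    by (rule det_row_lo[of _ k]) (use assms P in \<open>auto simp: mat_F_mult_columns locl_def\<close>)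
  then have "const_F (det Q) * det (mat_F P ** columns_mat V) \<in> lo m" by (intro lo_mult_loc) simp_all
  also have "const_F (det Q) * det (mat_F P ** columns_mat V) = det (mat_F (Q ** P) ** columns_mat V)"
    by (simp add: det_mul det_mat_F mat_F_mult mult.assoc)
  finally show ?thesis using P(4) by (simp add: mat_F_1)
qed

definition dir_c :: "'n der" where
  "dir_c = (\<chi> i. const_F (c $ i))"

lemma der_app_dir_c_lin_form: "der_app dir_c (to_F (lin_form b)) = const_F (pairing b c)"
  by (simp add: der_app_lin_form dir_c_def pairing_def Cst_sum to_F_sum Cst_mult to_F_mult)

text \<open>Substituting \<open>x_i = (x_i - c_i a) + c_i a\<close> separates
  \<open>\<theta>\<close> into a part that is regular under \<open>locl\<close> and a normal part.
  Only the derivative along \<open>c\<close> is multiplied by the possibly singular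
  \<open>der_app \<theta> \<pi>\<close>.\<close>

lemma der_app_split:
  "der_app \<theta> f = (\<Sum>i\<in>UNIV. der_app \<theta> (to_F (lin_form (axis i 1 - c $ i *s a))) * pdiff_F i f) +
    der_app \<theta> \<pi> * der_app dir_c f"
proof -
  have "\<theta> $ i = der_app \<theta> (to_F (lin_form (axis i 1 - c $ i *s a))) + const_F (c $ i) * der_app \<theta> \<pi>" for i
  proof -
    have "lin_form (axis i 1 - c $ i *s a) + Cst (c $ i) * L = lin_form (axis i 1)"
      by (simp flip: lin_form_smult lin_form_add)
    then have "to_F (Var i) = to_F (lin_form (axis i 1 - c $ i *s a)) + const_F (c $ i) * \<pi>"
      by (simp add: lin_form_axis flip: to_F_add to_F_mult)
    then have "der_app \<theta> (to_F (Var i)) = der_app \<theta> \<dots>" by simp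
    then show ?thesis by (simp add: der_app_add der_app_mult)
  qed
  then have "der_app \<theta> f = (\<Sum>i\<in>UNIV. (der_app \<theta> (to_F (lin_form (axis i 1 - c $ i *s a))) +
      const_F (c $ i) * der_app \<theta> \<pi>) * pdiff_F i f)"
    unfolding der_app_def[of \<theta> f] by simp
  moreover have "der_app dir_c f = (\<Sum>i\<in>UNIV. const_F (c $ i) * pdiff_F i f)"
    by (simp add: der_app_def dir_c_def)
  ultimately show ?thesis by (simp add: algebra_simps sum.distrib sum_distrib_left)
qed

lemma pairing_axis_perp: "pairing (axis i 1 - c $ i *s a) c = 0"
  using pairing_ac by (simp add: pairing_add pairing_axis)

end

section \<open>A reflection of order \<open>e\<close> near its hyperplane\<close>

locale local_reflection = linear_form a c for a c :: "'n::{finite,linorder} cvec" +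
  fixes s :: "'n cmat" and \<zeta> :: complex and e :: nat
  assumes invertible_s: "invertible s"
    and inv_s: "\<And>v. matrix_inv s *v v = v + ((\<zeta> - 1) * pairing a v) *s c"
    and e_ge_2: "e \<ge> 2" and root: "\<zeta> ^ e = 1"
    and primitive: "\<And>n. 0 < n \<Longrightarrow> n < e \<Longrightarrow> \<zeta> ^ n \<noteq> 1"
begin

abbreviation act_s :: "'n ratfun \<Rightarrow> 'n ratfun" where "act_s \<equiv> act_F s"

lemma act_s_hom: "field_hom act_s" by (rule field_hom_act_F[OF invertible_s])

lemma act_s_simps:
  "act_s (f + g) = act_s f + act_s g" "act_s (f * g) = act_s f * act_s g" "act_s 1 = 1" "act_s 0 = 0"
  "act_s (to_F p) = to_F (act s p)"
  using act_s_hom field_hom_0[OF act_s_hom] act_F_to_F[OF invertible_s] by (auto simp: field_hom_def)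

lemma \<zeta>_nz: "\<zeta> \<noteq> 0"
  using root e_ge_2 by (auto simp: power_0_left)

text \<open>\<open>act\<close> substitutes the inverse matrix, which is why the locale fixes the
  inverse of \<open>s\<close>: the form \<open>a\<close> is then multiplied by
  \<open>\<zeta>\<close> and not by its inverse.\<close>

lemma act_s_lin_form: "act s (lin_form b) = lin_form (b + ((\<zeta> - 1) * pairing b c) *s a)"
proof -
  have "b v* matrix_inv s = b + ((\<zeta> - 1) * pairing b c) *s a" (is "?l = ?r")
  proof -
    have p: "pairing ?l v = pairing ?r v" for v
      unfolding pairing_vector_matrix by (simp add: inv_s pairing_add)
    show ?thesis using p[of "axis _ 1"] by (simp add: vec_eq_iff pairing_axis)
  qed
  then show ?thesis by (simp add: act_lin_form)
qed

lemma act_s_L: "act_s \<pi> = const_F \<zeta> * \<pi>"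
proof -
  have "act s L = Cst \<zeta> * L"
    unfolding act_s_lin_form lin_form_smult[symmetric] by (simp add: pairing_ac vec_eq_iff algebra_simps lin_form_eq_iff)
  then show ?thesis by (simp add: act_s_simps to_F_mult)
qed

lemma act_s_perp: "pairing b c = 0 \<Longrightarrow> act_s (to_F (lin_form b)) = to_F (lin_form b)"
  by (simp add: act_s_simps act_s_lin_form)

lemma dvd_act_s_diff: "L dvd act s p - p"
proof -
  have "L dvd lin_form (matrix_inv s $ i) - Var i" for i
  proof -
    have "lin_form (matrix_inv s $ i) = act s (Var i)" by (simp add: act_def)
    also have "\<dots> = Var i + Cst ((\<zeta> - 1) * pairing (axis i 1) c) * L"
      unfolding lin_form_axis[symmetric] act_s_lin_form by (simp add: lin_form_add lin_form_smult)
    finally show ?thesis by simp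
  qed
  then have "L dvd poly_eval (\<lambda>i. lin_form (matrix_inv s $ i)) p - poly_eval Var p"
    by (rule poly_eval_cong_dvd)
  then show ?thesis by (simp add: act_def poly_eval_id)
qed

text \<open>\<open>s\<close> fixes the hyperplane pointwise, so numerator and denominator each
  change by a multiple of \<open>L\<close>, and the denominator stays nonzero on the
  hyperplane.\<close>

lemma act_s_diff_lo: assumes "f \<in> loc" shows "act_s f - f \<in> lo 1"
proof -
  obtain p q where f: "\<not> L dvd q" "q \<noteq> 0" "f = to_F p / to_F q" using assms by (rule locE)
  have nz: "act s q \<noteq> 0" by (rule act_nz[OF invertible_s f(2)])
  have "\<not> L dvd act s q"
  proof
    assume "L dvd act s q"
    then have "L dvd act s q - (act s q - q)" using dvd_act_s_diff by (rule dvd_diff)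
    with f(1) show False by simp
  qed
  then have nd: "\<not> L dvd act s q * q" using f(1) by (simp add: dvd_mult_iff)
  have "act_s f - f = to_F (act s p) / to_F (act s q) - to_F p / to_F q"
    by (simp add: f(3) act_F_divide invertible_s f(2))
  also have "\<dots> = to_F (act s p * q - p * act s q) / to_F (act s q * q)"
    using nz f(2) by (simp add: diff_frac_eq to_F_mult to_F_diff)
  finally have eq: "act_s f - f = to_F 1 / to_F (act s q * q) * to_F (act s p * q - p * act s q)" by simp
  have "act s p * q - p * act s q = (act s p - p) * q - p * (act s q - q)" by (simp add: algebra_simps)
  then have "L dvd act s p * q - p * act s q"
    using dvd_act_s_diff[of p] dvd_act_s_diff[of q] by (metis dvd_diff dvd_mult dvd_mult2)
  then show ?thesis unfolding eq using nd by (intro lo_mult_loc locI) (simp_all add: to_F_in_lo_1_iff)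
qed

text \<open>On the hyperplane \<open>s\<close> acts trivially, so there \<open>f\<close> equals
  \<open>x\<close> times itself.\<close>

lemma semi_invariant_lo_1:
  assumes "f \<in> loc" "act_s f = const_F x * f" "x \<noteq> 1" shows "f \<in> lo 1"
proof -
  have "act_s f - f = const_F (x - 1) * f" by (simp add: assms(2) Cst_diff to_F_diff algebra_simps)
  then have "const_F (x - 1) * f \<in> lo 1" using act_s_diff_lo[OF assms(1)] by simp
  then have "const_F (inverse (x - 1)) * (const_F (x - 1) * f) \<in> lo 1" by (rule lo_mult_loc[OF loc_to_F])
  moreover have "const_F (inverse (x - 1)) * const_F (x - 1) = (1 :: 'n ratfun)"
    using assms(3) by (simp flip: to_F_mult Cst_mult)
  ultimately show ?thesis by (simp only: mult.assoc[symmetric] mult_1)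
qed

text \<open>A nontrivial character forces vanishing on the hyperplane, and dividing by
  \<open>\<pi>\<close> lowers the exponent by one. Since \<open>n < e\<close>, all exponents met
  before 0 are nontrivial, so \<open>n\<close> divisions go through.\<close>

lemma semi_invariant_lo:
  assumes "f \<in> loc" "act_s f = const_F (\<zeta> ^ n) * f" "n < e" shows "f \<in> lo (int n)"
  using assms
proof (induction n arbitrary: f)
  case 0
  then show ?case by (simp add: lo_0)
next
  case (Suc n)
  have "f \<in> lo 1" using Suc.prems primitive[of "Suc n"] by (intro semi_invariant_lo_1[of f "\<zeta> ^ Suc n"]) auto
  define g where "g = f / \<pi>"
  have f: "f = \<pi> * g" using \<pi>_nz by (simp add: g_def)
  have g: "g \<in> loc" using \<open>f \<in> lo 1\<close> by (simp add: lo_def g_def power_int_minus field_simps)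
  have "const_F \<zeta> * \<pi> * act_s g = const_F (\<zeta> ^ Suc n) * (\<pi> * g)"
    using Suc.prems(2) unfolding f act_s_simps(2) act_s_L .
  then have "(const_F \<zeta> * \<pi>) * act_s g = (const_F \<zeta> * \<pi>) * (const_F (\<zeta> ^ n) * g)"
    by (simp add: Cst_mult to_F_mult mult_ac)
  moreover have "const_F \<zeta> * \<pi> \<noteq> 0" using \<zeta>_nz \<pi>_nz by simp
  ultimately have "act_s g = const_F (\<zeta> ^ n) * g" by (metis mult_left_cancel)
  then have "g \<in> lo (int n)" using Suc g by simp
  then have "\<pi> powi 1 * g \<in> lo (int (Suc n))" unfolding lo_powi_iff by simp
  then show ?case by (simp add: f)
qed

text \<open>Dividing once by \<open>\<pi>\<close> leaves the inverse of \<open>\<zeta>\<close> as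
  character, that is the exponent \<open>e - 1\<close>, and the previous lemma supplies the
  remaining \<open>e - 1\<close> zeros.\<close>

lemma invariant_lo:
  assumes "f \<in> lo 1" "act_s f = f" shows "f \<in> lo (int e)"
proof -
  define g where "g = f / \<pi>"
  have f: "f = \<pi> * g" using \<pi>_nz by (simp add: g_def)
  have g: "g \<in> loc" using \<open>f \<in> lo 1\<close> by (simp add: lo_def g_def power_int_minus field_simps)
  have "const_F \<zeta> * \<pi> * act_s g = \<pi> * g" using assms(2) unfolding f act_s_simps(2) act_s_L .
  then have "const_F \<zeta> * act_s g = g" using \<pi>_nz by simp
  then have "const_F (\<zeta> ^ (e - 1)) * g = const_F (\<zeta> ^ (e - 1) * \<zeta>) * act_s g"
    by (simp add: Cst_mult to_F_mult mult.assoc)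
  also have "\<zeta> ^ (e - 1) * \<zeta> = 1" using root e_ge_2 by (metis One_nat_def Suc_pred less_le_trans mult.commute pos2 power_Suc)
  finally have "g \<in> lo (int (e - 1))" using g e_ge_2 by (intro semi_invariant_lo) simp_all
  then have "\<pi> powi 1 * g \<in> lo (int e)" unfolding lo_powi_iff using e_ge_2 by (simp add: of_nat_diff)
  then show ?thesis by (simp add: f)
qed

text \<open>Differentiation along \<open>c\<close> twists the character by the inverse of
  \<open>\<zeta>\<close>, so an invariant function turns into one with exponent
  \<open>e - 1\<close>. This gain absorbs the pole of the primitive derivation.\<close>

lemma dir_c_invariant_lo:
  assumes "f \<in> loc" "act_s f = f" shows "der_app dir_c f \<in> lo (int e - 1)"
proof -
  let ?\<delta> = "\<lambda>f. der_app dir_c (act_s f)" and ?\<epsilon> = "\<lambda>f. const_F \<zeta> * act_s (der_app dir_c f)"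
  have t: "twisted_derivation act_s ?\<delta>" "twisted_derivation act_s ?\<epsilon>"
    by (simp_all add: twisted_derivation_def act_s_simps act_hom der_app_add der_app_mult algebra_simps)
  \<comment> \<open>Both maps are derivations along \<open>s\<close>; on a linear form
    \<open>b\<close> each takes the value \<open>\<zeta>\<close> times
    \<open>pairing b c\<close>.\<close>
  have "?\<delta> (to_F (Var i)) = ?\<epsilon> (to_F (Var i))" for i
  proof -
    show ?thesis
      unfolding lin_form_axis[symmetric] by (simp add: act_s_simps(5) act_s_lin_form der_app_dir_c_lin_form act_hom
        pairing_add pairing_ac algebra_simps flip: to_F_mult Cst_mult)
  qed
  then have "?\<delta> f = ?\<epsilon> f"
    using twisted_derivation_chain[OF act_s_hom t(1), of f] twisted_derivation_chain[OF act_s_hom t(2), of f] by simp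
  then have eq: "der_app dir_c f = const_F \<zeta> * act_s (der_app dir_c f)" using assms(2) by simp
  have "const_F (\<zeta> ^ (e - 1)) * der_app dir_c f = const_F (\<zeta> ^ (e - 1) * \<zeta>) * act_s (der_app dir_c f)"
    by (subst eq) (simp add: Cst_mult to_F_mult mult.assoc)
  also have "\<zeta> ^ (e - 1) * \<zeta> = 1" using root e_ge_2 by (metis One_nat_def Suc_pred less_le_trans mult.commute pos2 power_Suc)
  finally have sinv: "act_s (der_app dir_c f) = const_F (\<zeta> ^ (e - 1)) * der_app dir_c f" by simp
  have "der_app dir_c f \<in> loc"
    unfolding der_app_def dir_c_def using assms(1) by (auto intro!: is_subring_sum loc_subring loc_ring loc_pdiff)
  then have "der_app dir_c f \<in> lo (int (e - 1))" using sinv e_ge_2 by (intro semi_invariant_lo) simp_all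
  then show ?thesis using e_ge_2 by (simp add: of_nat_diff)
qed

text \<open>The tangential part is regular anyway; in the normal part the order \<open>r\<close> of
  the coefficient, at least \<open>1 - e\<close>, is balanced by the order \<open>e - 1\<close> of
  the derivative of an invariant function.\<close>

lemma locl_loc_invariant:
  assumes "locl \<theta> r" "1 - int e \<le> r" "f \<in> loc" "act_s f = f" shows "der_app \<theta> f \<in> loc"
proof -
  have "(\<Sum>i\<in>UNIV. der_app \<theta> (to_F (lin_form (axis i 1 - c $ i *s a))) * pdiff_F i f) \<in> loc"
    using assms(1) by (auto intro!: is_subring_sum loc_subring loc_ring(4) loc_pdiff assms(3) simp: locl_def pairing_axis_perp)
  moreover have "der_app \<theta> \<pi> * der_app dir_c f \<in> loc"
  proof -
    have "der_app \<theta> \<pi> * der_app dir_c f \<in> lo (r + (int e - 1))"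
      using assms dir_c_invariant_lo by (intro lo_mult) (auto simp: locl_def)
    from lo_mono[OF _ this, of 0] show ?thesis using assms(2) by (simp add: lo_0)
  qed
  ultimately show ?thesis unfolding der_app_split[of \<theta> f] by (rule loc_ring(6))
qed

definition s_inv :: "'n der \<Rightarrow> bool" where
  "s_inv \<theta> \<longleftrightarrow> (\<forall>f. act_s (der_app \<theta> f) = der_app \<theta> (act_s f))"

lemma s_inv_perp:
  "s_inv \<theta> \<Longrightarrow> pairing b c = 0 \<Longrightarrow> act_s (der_app \<theta> (to_F (lin_form b))) = der_app \<theta> (to_F (lin_form b))"
  by (simp add: s_inv_def act_s_perp)

lemma s_inv_\<pi>: "s_inv \<theta> \<Longrightarrow> act_s (der_app \<theta> \<pi>) = const_F \<zeta> * der_app \<theta> \<pi>"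
  by (simp add: s_inv_def act_s_L der_app_mult)

lemma act_s_\<pi>_powi: "act_s (\<pi> powi m) = const_F (\<zeta> powi m) * \<pi> powi m"
proof -
  have p: "act_s (\<pi> ^ n) = const_F (\<zeta> ^ n) * \<pi> ^ n" for n
    by (induction n) (simp_all add: act_s_simps(2,3) act_s_L Cst_mult to_F_mult mult_ac)
  have i: "act_s (inverse x) = inverse (act_s x)" for x
    by (metis act_s_simps(2,3,4) inverse_unique inverse_zero right_inverse)
  show ?thesis
    by (simp add: power_int_def power_inverse i p const_F_inverse)
qed

text \<open>\<open>der_app \<theta> \<pi>\<close> has character \<open>\<zeta>\<close>, and so has
  \<open>\<pi>\<close> to any exponent congruent to 1 modulo \<open>e\<close>. This singles out the
  multiplicities of the form \<open>1 + m * e\<close>.\<close>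

lemma s_inv_quotient:
  assumes "s_inv \<theta>"
  shows "act_s (\<pi> powi (- (1 + m * int e)) * der_app \<theta> \<pi>) = \<pi> powi (- (1 + m * int e)) * der_app \<theta> \<pi>"
proof -
  have "\<zeta> powi (m * int e) = (\<zeta> powi int e) powi m" by (simp only: mult.commute[of m] power_int_mult)
  then have "\<zeta> powi (m * int e) = 1" using root by simp
  then have "\<zeta> powi (1 + m * int e) = \<zeta>" using \<zeta>_nz by (simp add: power_int_add)
  then have "\<zeta> powi (- (1 + m * int e)) = inverse \<zeta>" by (simp only: power_int_minus)
  moreover have "const_F (inverse \<zeta>) * const_F \<zeta> = (1 :: 'n ratfun)" using \<zeta>_nz by (simp flip: to_F_mult Cst_mult)
  ultimately show ?thesis
    unfolding act_s_simps(2) act_s_\<pi>_powi s_inv_\<pi>[OF assms]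
    by (metis (no_types, opaque_lifting) mult.assoc mult.commute mult_1)
qed

text \<open>The second summand carries the leading term: differentiating the power lowers its
  exponent by one at the price of the factor \<open>n\<close>, whereas the first summand keeps the
  full power.\<close>

lemma der_app_powi_decompose:
  fixes n :: int and \<theta> \<delta> :: "'n der"
  defines "g \<equiv> \<pi> powi (- n) * der_app \<theta> \<pi>"
  shows "der_app \<delta> (der_app \<theta> \<pi>) =
    \<pi> powi n * der_app \<delta> g + of_int n * (\<pi> powi (n - 1) * (g * der_app \<delta> \<pi>))"
proof -
  have "der_app \<theta> \<pi> = \<pi> powi n * g" by (simp add: g_def)
  then have "der_app \<delta> (der_app \<theta> \<pi>) = der_app \<delta> (\<pi> powi n * g)" by simp
  then show ?thesis by (simp add: der_app_mult der_app_powi[OF \<pi>_nz] algebra_simps)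
qed

text \<open>With \<open>der_app \<theta> \<pi>\<close> written as a power times an invariant regular
  \<open>g\<close>, \<open>\<delta>\<close> keeps \<open>g\<close> regular, so only differentiating
  the power costs order. The value \<open>r = 1 - int e\<close> is the true situation for
  \<open>D\<close>; \<open>r = 1\<close> serves to refute the alternative.\<close>

lemma nabla_locl:
  assumes \<theta>: "locl \<theta> (1 + m * int e)" "s_inv \<theta>" and \<delta>: "locl \<delta> r" "1 - int e \<le> r" "r \<le> 1"
  shows "locl (nabla \<delta> \<theta>) (r + m * int e)"
proof -
  have "der_app \<delta> (der_app \<theta> \<pi>) \<in> lo (r + m * int e)"
  proof -
    define g where "g = \<pi> powi (- (1 + m * int e)) * der_app \<theta> \<pi>"
    have g: "g \<in> loc" using \<theta>(1) by (simp add: g_def locl_def lo_def)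
    have gi: "act_s g = g" unfolding g_def by (rule s_inv_quotient[OF \<theta>(2)])
    have "der_app \<delta> g \<in> loc" by (rule locl_loc_invariant[OF \<delta>(1,2) g gi])
    then have "\<pi> powi (1 + m * int e) * der_app \<delta> g \<in> lo (1 + m * int e)"
      unfolding lo_powi_iff by (simp add: lo_0)
    then have 1: "\<pi> powi (1 + m * int e) * der_app \<delta> g \<in> lo (r + m * int e)"
      using lo_mono[of "r + m * int e" "1 + m * int e"] \<delta>(3) by simp
    have "g * der_app \<delta> \<pi> \<in> lo r" using g \<delta>(1) by (intro lo_mult_loc) (auto simp: locl_def)
    then have "\<pi> powi ((1 + m * int e) - 1) * (g * der_app \<delta> \<pi>) \<in> lo (r + m * int e)"
      unfolding lo_powi_iff by simp
    then have 2: "of_int (1 + m * int e) * (\<pi> powi ((1 + m * int e) - 1) * (g * der_app \<delta> \<pi>)) \<in> lo (r + m * int e)"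
      by (rule lo_mult_loc[OF loc_of_int])
    show ?thesis
      unfolding der_app_powi_decompose[of \<delta> \<theta> "1 + m * int e"] g_def[symmetric] using 1 2 by (rule lo_add)
  qed
  moreover have "der_app \<delta> (der_app \<theta> (to_F (lin_form b))) \<in> loc" if "pairing b c = 0" for b
    using that \<theta> by (intro locl_loc_invariant[OF \<delta>(1,2)] s_inv_perp) (auto simp: locl_def)
  ultimately show ?thesis by (simp add: locl_def der_app_nabla_lin_form)
qed

text \<open>The product in the last hypothesis is invariant, so if it vanishes at all it vanishes to
  order \<open>e\<close>: the order of the normal coefficient jumps from \<open>1 - e\<close> to
  1.\<close>

lemma locl_1_if_not_unit:
  assumes "s_inv \<delta>" "locl \<delta> (1 - int e)" "\<pi> powi (int e - 1) * der_app \<delta> \<pi> \<in> lo 1"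
  shows "locl \<delta> 1"
proof -
  have "\<pi> powi (int e - 1) * der_app \<delta> \<pi> \<in> lo (int e)"
    using s_inv_quotient[OF assms(1), of "- 1"] by (intro invariant_lo[OF assms(3)]) simp
  then have "der_app \<delta> \<pi> \<in> lo 1" unfolding lo_powi_iff by simp
  then show ?thesis using assms(2) by (simp add: locl_def)
qed

text \<open>The converse of \<open>nabla_locl\<close>, integrating along \<open>\<delta>\<close> in
  steps of \<open>e\<close>. If the normal coefficient of \<open>\<delta>\<close> has order exactly
  \<open>1 - e\<close>, the leading term of the product rule cannot be lost, and comparing it with
  the order of the derivative gives the quotient \<open>g\<close> order \<open>e\<close>.\<close>

lemma lower_pole:
  assumes \<delta>: "s_inv \<delta>" "locl \<delta> (1 - int e)" "\<pi> powi (int e - 1) * der_app \<delta> \<pi> \<notin> lo 1"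
    and \<theta>: "s_inv \<theta>" "der_app \<theta> \<pi> \<in> lo 1" "der_app \<delta> (der_app \<theta> \<pi>) \<in> lo (1 + int m * int e)"
  shows "der_app \<theta> \<pi> \<in> lo (1 + (int m + 1) * int e)"
proof -
  have "der_app \<theta> \<pi> \<in> lo (1 + int n * int e)" if "n \<le> m + 1" for n
    using that
  proof (induction n)
    case 0
    show ?case using \<theta>(2) by simp
  next
    case (Suc n)
    define w where "w = \<pi> powi (int e - 1) * der_app \<delta> \<pi>"
    define q where "q = 1 + int n * int e"
    define g where "g = \<pi> powi (- q) * der_app \<theta> \<pi>"
    have g: "g \<in> loc" using Suc by (simp add: g_def q_def lo_def)
    have gi: "act_s g = g" unfolding g_def q_def by (rule s_inv_quotient[OF \<theta>(1)])
    have "w \<in> loc" using \<delta>(2) by (simp add: w_def locl_def lo_def)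
    moreover have "w \<notin> lo 1" using \<delta>(3) by (simp only: w_def not_False_eq_True)
    ultimately have w: "inverse w \<in> loc" "w \<noteq> 0" by (rule loc_unit)+
    have "der_app \<delta> g \<in> loc" using locl_loc_invariant[OF \<delta>(2) _ g gi] by simp
    then have "\<pi> powi q * der_app \<delta> g \<in> lo q" unfolding lo_powi_iff by (simp add: lo_0)
    moreover have "der_app \<delta> (der_app \<theta> \<pi>) \<in> lo q"
      using lo_mono[OF _ \<theta>(3), of q] Suc.prems by (simp add: q_def mult_right_mono)
    ultimately have "der_app \<delta> (der_app \<theta> \<pi>) - \<pi> powi q * der_app \<delta> g \<in> lo q" by (rule lo_diff[rotated])
    then have 1: "of_int q * (\<pi> powi (q - 1) * (g * der_app \<delta> \<pi>)) \<in> lo q"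
      unfolding der_app_powi_decompose[of \<delta> \<theta> q] g_def[symmetric] by simp
    \<comment> \<open>The factor from differentiating the power must be nonzero; positivity comes
      from starting the induction at order 1, where \<open>der_app \<theta> \<pi>\<close> has no
      pole.\<close>
    have q0: "q > 0" by (simp add: q_def add_pos_nonneg)
    then have "const_F (inverse (of_int q)) * of_int q = (1 :: 'n ratfun)"
      unfolding const_F_of_int[symmetric] by (simp del: const_F_of_int flip: to_F_mult Cst_mult)
    moreover have "const_F (inverse (of_int q)) * (of_int q * (\<pi> powi (q - 1) * (g * der_app \<delta> \<pi>))) \<in> lo q"
      by (rule lo_mult_loc[OF loc_to_F 1])
    ultimately have "\<pi> powi (q - 1) * (g * der_app \<delta> \<pi>) \<in> lo q" by (simp flip: mult.assoc)
    moreover have "der_app \<delta> \<pi> = \<pi> powi (1 - int e) * w" by (simp add: w_def)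
    ultimately have "\<pi> powi (q - 1) * (\<pi> powi (1 - int e) * (w * g)) \<in> lo q" by (simp add: mult_ac)
    then have "w * g \<in> lo (int e)" unfolding lo_powi_iff by simp
    then have "inverse w * (w * g) \<in> lo (int e)" by (rule lo_mult_loc[OF w(1)])
    then have "g \<in> lo (int e)" using w by (simp flip: mult.assoc)
    then have "\<pi> powi q * g \<in> lo (1 + int (Suc n) * int e)"
      unfolding lo_powi_iff by (simp add: q_def algebra_simps)
    then show ?case by (simp add: g_def)
  qed
  from this[of "m + 1"] show ?thesis by (simp add: add.commute)
qed

text \<open>The derivatives of invariant functions along \<open>c\<close> form one row of order
  \<open>e - 1\<close> in an adapted frame. If the determinant has no higher order than this forces,
  dividing that row by the power of \<open>\<pi>\<close> gives a matrix invertible over the local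
  ring, and Cramer's rule bounds the pole of \<open>\<theta>\<close>.\<close>

lemma jacobian_lo:
  assumes "\<And>m. f m \<in> loc" "\<And>m. act_s (f m) = f m"
  shows "det (jacobian f) \<in> lo (int e - 1)"
    and "\<lbrakk>inverse (\<pi> powi (1 - int e) * det (jacobian f)) \<in> loc; det (jacobian f) \<noteq> 0;
      \<And>m. der_app \<theta> (f m) \<in> loc\<rbrakk> \<Longrightarrow> locl \<theta> (1 - int e)"
proof -
  obtain P Q :: "'n cmat" and k where P: "P $ k = a" "\<forall>j. j \<noteq> k \<longrightarrow> pairing (P $ j) c = 0"
    "P ** Q = mat 1" "Q ** P = mat 1" "\<forall>i. Q $ i $ k = c $ i" by (rule frame)
  define X where "X = transpose (jacobian f ** mat_F Q)"
  have X_nth: "X $ j $ m = (\<Sum>i\<in>UNIV. pdiff_F i (f m) * const_F (Q $ i $ j))" for j m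
    by (simp add: X_def transpose_def matrix_matrix_mult_def)
  have "X $ k $ m = der_app dir_c (f m)" for m
    unfolding X_nth der_app_def dir_c_def using P(5) by (simp add: mult.commute)
  then have Xk: "X $ k $ m \<in> lo (int e - 1)" for m using assms by (simp add: dir_c_invariant_lo)
  have Xl: "X $ j $ m \<in> loc" for j m
    unfolding X_nth by (intro is_subring_sum[OF loc_subring] loc_ring(4) loc_pdiff assms(1) loc_to_F)
  have dX: "det X = det (jacobian f) * const_F (det Q)"
    by (simp add: X_def det_transpose det_mul det_mat_F)
  have "det P * det Q = 1" using P(3) by (metis det_I det_mul)
  then have dQ: "const_F (det Q) * const_F (det P) = (1 :: 'n ratfun)"
    by (simp add: mult.commute flip: to_F_mult Cst_mult)
  have "const_F (det P) * det X \<in> lo (int e - 1)"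
    using Xk Xl by (intro lo_mult_loc det_row_lo[of _ k]) simp_all
  then show "det (jacobian f) \<in> lo (int e - 1)"
    using dQ by (simp add: dX mult_ac)
  show "locl \<theta> (1 - int e)" if u: "inverse (\<pi> powi (1 - int e) * det (jacobian f)) \<in> loc" "det (jacobian f) \<noteq> 0"
    and \<theta>: "\<And>m. der_app \<theta> (f m) \<in> loc"
  proof -
    \<comment> \<open>\<open>K\<close> is the Jacobian in adapted coordinates with its normal column
      divided by \<open>\<pi> powi (int e - 1)\<close>; \<open>y\<close> lists the coordinates of
      \<open>\<theta>\<close> with the normal one multiplied by the same power, so \<open>K\<close>
      applied to \<open>y\<close> still gives the values on the \<open>f m\<close>.\<close>
    define K where "K = transpose (\<chi> j. if j = k then \<pi> powi (1 - int e) *s X $ k else X $ j)"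
    define y where "y = (\<chi> j. if j = k then \<pi> powi (int e - 1) * der_app \<theta> \<pi> else der_app \<theta> (to_F (lin_form (P $ j))))"
    have "det (\<chi> j. if j = k then \<pi> powi (1 - int e) *s X $ k else X $ j) =
        \<pi> powi (1 - int e) * det (\<chi> j. if j = k then X $ k else X $ j)"
      by (rule det_row_mul)
    also have "(\<chi> j. if j = k then X $ k else X $ j) = X" by (simp add: vec_eq_iff)
    finally have dK: "det K = \<pi> powi (1 - int e) * det (jacobian f) * const_F (det Q)"
      unfolding K_def det_transpose dX by simp
    have "inverse (const_F (det Q)) = (const_F (det P) :: 'n ratfun)" using dQ by (rule inverse_unique)
    then have iK: "inverse (det K) \<in> loc" unfolding dK inverse_mult_distrib[of _ "const_F (det Q)"] using u by (auto intro: loc_ring)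
    have K0: "det K \<noteq> 0" using u dQ \<pi>_nz unfolding dK by (auto simp: power_int_eq_0_iff)
    have Kl: "K $ m $ j \<in> loc" for m j
      using Xk[of m] Xl[of j m] by (auto simp: K_def transpose_def lo_def)
    have "(K *v y) $ m = der_app \<theta> (f m)" for m
    proof -
      have "K $ m $ j * y $ j = X $ j $ m * (mat_F P *v \<theta>) $ j" for j
        unfolding mat_F_mult_vec by (simp add: K_def y_def transpose_def P(1) mult.assoc mult.left_commute[of _ "\<pi> powi (int e - 1)"])
      then have "(K *v y) $ m = (transpose X *v (mat_F P *v \<theta>)) $ m"
        by (simp add: matrix_vector_mult_def transpose_def)
      also have "transpose X *v (mat_F P *v \<theta>) = jacobian f *v (mat_F (Q ** P) *v \<theta>)"
        by (simp add: X_def mat_F_mult matrix_vector_mul_assoc matrix_mul_assoc)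
      finally show ?thesis by (simp add: P(4) mat_F_1 jacobian_mult_vec)
    qed
    then have y: "y $ j \<in> loc" for j
      using is_subring_cramer[OF loc_subring Kl iK K0] \<theta> by simp
    show ?thesis
    proof (rule locl_frameI[OF P(1,3,4) P(5)[rule_format]])
      show "der_app \<theta> (to_F (lin_form (P $ j))) \<in> loc" if "j \<noteq> k" for j using y[of j] that by (simp add: y_def)
      show "der_app \<theta> \<pi> \<in> lo (1 - int e)" using y[of k] by (simp add: y_def lo_def)
    qed
  qed
qed

end

section \<open>Bases of modules\<close>

text \<open>The weights \<open>w\<close> are there because the \<open>xi\<close> differ from the
  \<open>U\<close> by nonzero constants. Relations are indexed by \<open>K\<close>, while a basis is
  a set of vectors; injectivity of the family is therefore drawn from independence before
  coefficients are transported.\<close>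

lemma free_with_basis_familyI:
  fixes b :: "'j \<Rightarrow> 'n::{finite,linorder} der" and w :: "'j \<Rightarrow> 'n ratfun"
  assumes A: "is_subring A" and sub: "submod A M"
    and w: "\<And>j. j \<in> K \<Longrightarrow> w j \<in> A" "\<And>j. j \<in> K \<Longrightarrow> inverse (w j) \<in> A" "\<And>j. j \<in> K \<Longrightarrow> w j \<noteq> 0"
    and mem: "\<And>j. j \<in> K \<Longrightarrow> w j *s b j \<in> M"
    and span: "\<And>x. x \<in> M \<Longrightarrow> \<exists>J c. finite J \<and> J \<subseteq> K \<and> (\<forall>j\<in>J. c j \<in> A) \<and> x = (\<Sum>j\<in>J. c j *s b j)"
    and indep: "\<And>J c. finite J \<Longrightarrow> J \<subseteq> K \<Longrightarrow> \<forall>j\<in>J. c j \<in> A \<Longrightarrow> (\<Sum>j\<in>J. c j *s b j) = 0 \<Longrightarrow> \<forall>j\<in>J. c j = 0"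
  shows "free_with_basis A M ((\<lambda>j. w j *s b j) ` K)"
proof -
  define v where "v j = w j *s b j" for j
  note A_ring = is_subringD[OF A]
  have indep_v: "\<forall>j\<in>J. c j = 0"
    if "finite J" "J \<subseteq> K" "\<forall>j\<in>J. c j \<in> A" "(\<Sum>j\<in>J. c j *s v j) = 0" for J c
  proof -
    have "\<forall>j\<in>J. c j * w j = 0"
      using that w by (intro indep) (auto simp: v_def vector_smult_assoc intro: A_ring)
    with w(3) that(2) show ?thesis by (metis mult_eq_0_iff subsetD)
  qed
  have inj: "inj_on v K"
  proof (rule inj_onI, rule ccontr)
    fix j j' assume j: "j \<in> K" "j' \<in> K" "v j = v j'" "j \<noteq> j'"
    have "\<forall>i\<in>{j, j'}. (if i = j then 1 else - 1 :: 'n ratfun) = 0"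
      by (rule indep_v) (use j A_ring in auto)
    then show False by simp
  qed
  have ex: "\<exists>c. range c \<subseteq> A \<and> finite {b. c b \<noteq> 0} \<and> {b. c b \<noteq> 0} \<subseteq> v ` K \<and> x = (\<Sum>b | c b \<noteq> 0. c b *s b)"
    if x: "x \<in> M" for x
  proof -
    obtain J c where J: "finite J" "J \<subseteq> K" "\<forall>j\<in>J. c j \<in> A" "x = (\<Sum>j\<in>J. c j *s b j)"
      using span[OF x] by blast
    define C where "C y = (if y \<in> v ` J then c (inv_into K v y) * inverse (w (inv_into K v y)) else 0)" for y
    have C: "C (v j) = c j * inverse (w j)" if "j \<in> J" for j
      using that J inj by (auto simp: C_def inv_into_f_f subset_iff)
    have sub: "{y. C y \<noteq> 0} \<subseteq> v ` J" by (auto simp: C_def)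
    have "(\<Sum>y | C y \<noteq> 0. C y *s y) = (\<Sum>y\<in>v ` J. C y *s y)"
      using sub J(1) by (intro sum.mono_neutral_left) auto
    also have "\<dots> = (\<Sum>j\<in>J. C (v j) *s v j)"
      using inj J(2) by (intro sum.reindex_cong[of v]) (auto intro: inj_on_subset)
    also have "\<dots> = x"
      unfolding J(4)
    proof (rule sum.cong[OF refl])
      fix j assume j: "j \<in> J"
      then have "w j \<noteq> 0" using w(3) J(2) by blast
      then show "C (v j) *s v j = c j *s b j"
        unfolding C[OF j] by (simp add: v_def vector_smult_assoc mult.assoc)
    qed
    finally have "x = (\<Sum>y | C y \<noteq> 0. C y *s y)" by simp
    moreover have "C y \<in> A" for y
    proof (cases "y \<in> v ` J")
      case True
      then obtain j where "j \<in> J" "y = v j" by blast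
      then show ?thesis using C[of j] J w(2)[of j] A_ring by auto
    qed (simp add: C_def A_ring)
    moreover have "finite {y. C y \<noteq> 0}" using sub J(1) finite_subset by blast
    moreover have "{y. C y \<noteq> 0} \<subseteq> v ` K" using sub J(2) by blast
    ultimately show ?thesis by (intro exI[of _ C]) auto
  qed
  have uniq: "c1 = c2"
    if 1: "range c1 \<subseteq> A" "finite {b. c1 b \<noteq> 0}" "{b. c1 b \<noteq> 0} \<subseteq> v ` K" "x = (\<Sum>b | c1 b \<noteq> 0. c1 b *s b)"
      and 2: "range c2 \<subseteq> A" "finite {b. c2 b \<noteq> 0}" "{b. c2 b \<noteq> 0} \<subseteq> v ` K" "x = (\<Sum>b | c2 b \<noteq> 0. c2 b *s b)"
    for c1 c2 x
  proof -
    define Y where "Y = {b. c1 b \<noteq> 0} \<union> {b. c2 b \<noteq> 0}"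
    define J where "J = {j \<in> K. v j \<in> Y}"
    have "Y \<subseteq> v ` K" using 1(3) 2(3) by (simp add: Y_def)
    then have J: "J \<subseteq> K" "Y = v ` J" by (auto simp: J_def)
    have injJ: "inj_on v J" using inj J(1) inj_on_subset by blast
    have "finite Y" using 1(2) 2(2) by (simp add: Y_def)
    then have fJ: "finite J" using J(2) injJ finite_image_iff by blast
    have "(\<Sum>b | c1 b \<noteq> 0. c1 b *s b) = (\<Sum>b\<in>Y. c1 b *s b)" "(\<Sum>b | c2 b \<noteq> 0. c2 b *s b) = (\<Sum>b\<in>Y. c2 b *s b)"
      using \<open>finite Y\<close> by (auto intro!: sum.mono_neutral_left simp: Y_def)
    then have "(\<Sum>b\<in>Y. c1 b *s b) - (\<Sum>b\<in>Y. c2 b *s b) = 0" using 1(4) 2(4) by simp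
    then have "(\<Sum>b\<in>Y. (c1 b - c2 b) *s b) = 0" by (simp add: sum_subtractf vector_sub_rdistrib)
    then have "(\<Sum>j\<in>J. (c1 (v j) - c2 (v j)) *s v j) = 0"
      unfolding J(2) using sum.reindex[OF injJ, of "\<lambda>b. (c1 b - c2 b) *s b"] by (simp add: o_def)
    moreover have "\<forall>j\<in>J. c1 (v j) - c2 (v j) \<in> A" using 1(1) 2(1) A_ring(3) by (simp add: image_subset_iff)
    ultimately have "\<forall>j\<in>J. c1 (v j) - c2 (v j) = 0" using indep_v[OF fJ J(1), of "\<lambda>j. c1 (v j) - c2 (v j)"] by blast
    then have "c1 b = c2 b" if "b \<in> Y" for b using that J(2) by auto
    moreover have "c1 b = c2 b" if "b \<notin> Y" for b using that by (simp add: Y_def)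
    ultimately show ?thesis by blast
  qed
  show ?thesis
    unfolding free_with_basis_def v_def[symmetric]
  proof (intro conjI ballI sub)
    show "v ` K \<subseteq> M" using mem by (auto simp: v_def)
    fix x assume "x \<in> M"
    from ex[OF this] uniq show "\<exists>!c. range c \<subseteq> A \<and> finite {b. c b \<noteq> 0} \<and> {b. c b \<noteq> 0} \<subseteq> v ` K \<and>
        x = (\<Sum>b | c b \<noteq> 0. c b *s b)"
      by (intro ex_ex1I) blast+
  qed
qed

lemma free_with_basisD:
  assumes "free_with_basis A M B" "x \<in> M" "finite B"
  obtains c where "\<And>b. c b \<in> A" "x = (\<Sum>b\<in>B. c b *s b)"
proof -
  obtain c where c: "range c \<subseteq> A" "{b. c b \<noteq> 0} \<subseteq> B" "x = (\<Sum>b | c b \<noteq> 0. c b *s b)"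
    using assms(1,2) unfolding free_with_basis_def by blast
  have "(\<Sum>b | c b \<noteq> 0. c b *s b) = (\<Sum>b\<in>B. c b *s b)"
    using c(2) assms(3) by (intro sum.mono_neutral_left) auto
  with c(3) have "x = (\<Sum>b\<in>B. c b *s b)" by simp
  moreover have "c b \<in> A" for b using c(1) by (simp add: image_subset_iff)
  ultimately show thesis using that by blast
qed

section \<open>The Euler derivation\<close>

definition euler :: "'n::{finite,linorder} der" where
  "euler = (\<chi> i. to_F (Var i))"

lemma lookup_euler:
  fixes p :: "'n::{finite,linorder} mpol"
  shows "Poly_Mapping.lookup (\<Sum>i\<in>UNIV. Var i * pdiff i p) m =
    of_nat (\<Sum>i\<in>UNIV. Poly_Mapping.lookup m i) * Poly_Mapping.lookup p m"
proof (induction p rule: mpol_induct)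
  case (single n c)
  have "Var i * pdiff i (Poly_Mapping.single n c) = Poly_Mapping.single n (of_nat (Poly_Mapping.lookup n i) * c)"
    for i :: 'n
  proof (cases "Poly_Mapping.lookup n i = 0")
    case False
    then have "Poly_Mapping.single i 1 + (n - Poly_Mapping.single i 1) = n"
      by (intro poly_mapping_eqI) (auto simp: lookup_add lookup_minus lookup_single when_def)
    then show ?thesis unfolding pdiff_single Var_def mult_single by simp
  qed (simp add: pdiff_single)
  then show ?case
    by (simp add: lookup_sum lookup_single when_def sum_distrib_right)
next
  case (add p q)
  then show ?case by (simp add: pdiff_add lookup_add algebra_simps sum.distrib)
qed

lemma der_app_euler: "der_app euler (to_F p) = to_F (\<Sum>i\<in>UNIV. Var i * pdiff i p)"
  by (simp add: der_app_def euler_def to_F_sum to_F_mult)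

lemma lookup_Cst_mult: "Poly_Mapping.lookup (Cst z * p) m = z * Poly_Mapping.lookup p m"
proof (induction p rule: mpol_induct)
  case (single n c)
  show ?case by (simp add: Cst_def mult_single lookup_single when_def)
next
  case (add p q)
  then show ?case by (simp add: lookup_add algebra_simps)
qed

lemma euler_homog: "homog n p \<Longrightarrow> der_app euler (to_F p) = of_nat n * to_F p"
proof -
  assume h: "homog n p"
  have "(\<Sum>i\<in>UNIV. Var i * pdiff i p) = Cst (of_nat n) * p"
    using h by (intro poly_mapping_eqI) (auto simp: lookup_euler lookup_Cst_mult homog_def in_keys_iff)
  then show ?thesis by (simp add: der_app_euler to_F_mult const_F_simps(5))
qed

text \<open>Degrees are carried as complex eigenvalues of the Euler derivation, which also make
  sense for fractions and determinants. On a polynomial the eigenvalue is the total degree of every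
  monomial present; that it is a natural number closes the degree counts.\<close>

lemma euler_eigenvalue:
  fixes p :: "'n::{finite,linorder} mpol"
  assumes "der_app euler (to_F p) = const_F z * to_F p" "p \<noteq> 0"
  obtains n :: nat where "z = of_nat n" "n = 0 \<Longrightarrow> \<exists>c. p = Cst c"
proof -
  have "(\<Sum>i\<in>UNIV. Var i * pdiff i p) = Cst z * p"
    using assms(1) by (simp add: der_app_euler flip: to_F_mult)
  then have "Poly_Mapping.lookup (\<Sum>i\<in>UNIV. Var i * pdiff i p) m = Poly_Mapping.lookup (Cst z * p) m" for m by simp
  then have deg: "of_nat (\<Sum>i\<in>UNIV. Poly_Mapping.lookup m i) = z" if "m \<in> Poly_Mapping.keys p" for m
    using that by (auto simp: lookup_euler lookup_Cst_mult in_keys_iff)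
  obtain m where m: "m \<in> Poly_Mapping.keys p" using assms(2) by (metis keys_eq_empty ex_in_conv)
  show thesis
  proof (rule that[OF deg[OF m, symmetric]])
    assume "(\<Sum>i\<in>UNIV. Poly_Mapping.lookup m i) = 0"
    then have z: "z = 0" using deg[OF m] by simp
    have "n = 0" if "n \<in> Poly_Mapping.keys p" for n
    proof -
      have "(\<Sum>i\<in>UNIV. Poly_Mapping.lookup n i) = 0" using deg[OF that] unfolding z of_nat_eq_0_iff .
      then show ?thesis by (intro poly_mapping_eqI) simp
    qed
    then have "p = Cst (Poly_Mapping.lookup p 0)"
      unfolding Cst_def by (intro poly_mapping_eqI) (auto simp: lookup_single when_def in_keys_iff)
    then show "\<exists>c. p = Cst c" by blast
  qed
qed

text \<open>If \<open>\<pi> * g\<close> is a polynomial and \<open>g\<close> is regular along the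
  hyperplane, then \<open>L\<close> divides that polynomial; the powers of \<open>L\<close> are
  removed one at a time in this way.\<close>

lemma (in linear_form) cancel_L:
  assumes "f \<in> loc" "to_F (L ^ n * q) * f \<in> range to_F" shows "to_F q * f \<in> range to_F"
  using assms(2)
proof (induction n)
  case (Suc n)
  define g where "g = to_F (L ^ n * q) * f"
  obtain p where p: "\<pi> * g = to_F p" using Suc.prems by (auto simp: g_def to_F_mult mult.assoc)
  have "g \<in> loc" unfolding g_def using assms(1) by (intro loc_ring(4) loc_to_F)
  then have "\<pi> powi 1 * g \<in> lo 1" unfolding lo_powi_iff by (simp add: lo_0)
  then have "L dvd p" using p to_F_in_lo_1_iff by simp
  then obtain r where "p = L * r" by (auto simp: dvd_def)
  then have "g = to_F r" using p \<pi>_nz by (simp add: to_F_mult)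
  then show ?case using Suc.IH by (simp add: g_def)
qed simp

section \<open>Reflection groups\<close>

lemma matrix_inv_eqI:
  fixes A :: "'n::finite cmat"
  assumes "A ** B = mat 1" "B ** A = mat 1" shows "matrix_inv A = B"
proof -
  have "invertible A" using assms by (auto simp: invertible_def)
  then have "matrix_inv A ** (A ** B) = B" by (simp add: matrix_mul_assoc matrix_inv_both)
  then show ?thesis by (simp add: assms)
qed

lemma act_act:
  fixes g h :: "'n::{finite,linorder} cmat"
  assumes "invertible g" "invertible h"
  shows "act g (act h p) = act (g ** h) p"
proof -
  have "(matrix_inv h ** matrix_inv g) ** (g ** h) = matrix_inv h ** (matrix_inv g ** g) ** h"
    by (simp add: matrix_mul_assoc)
  also have "\<dots> = mat 1" using matrix_inv_both[OF assms(1)] matrix_inv_both[OF assms(2)] by simp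
  finally have 1: "(matrix_inv h ** matrix_inv g) ** (g ** h) = mat 1" .
  then have "(g ** h) ** (matrix_inv h ** matrix_inv g) = mat 1" using matrix_left_right_inverse by blast
  then have inv: "matrix_inv (g ** h) = matrix_inv h ** matrix_inv g" using 1 by (rule matrix_inv_eqI)
  have "lin_form ((matrix_inv h $ i) v* matrix_inv g) = (lin_form (matrix_inv (g ** h) $ i) :: 'n mpol)" for i
    unfolding inv by (simp add: lin_form_eq_iff vec_eq_iff vector_matrix_mult_def matrix_matrix_mult_def mult.commute)
  moreover have "act g (act h p) = poly_eval (\<lambda>i. act g (lin_form (matrix_inv h $ i))) p"
    by (simp add: act_def poly_eval_poly_eval)
  ultimately show ?thesis by (simp add: act_lin_form act_def[of "g ** h"])
qed

lemma matrix_inv_involutive: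
  fixes g :: "'n::finite cmat" assumes "invertible g" shows "matrix_inv (matrix_inv g) = g"
  using matrix_inv_both[OF assms] by (intro matrix_inv_eqI)

locale reflection_setup =
  fixes W :: "'n::{finite,linorder} cmat set"
    and I :: "'n cvec \<Rightarrow> 'n cvec \<Rightarrow> complex"
    and \<alpha> :: "'n cvec set \<Rightarrow> 'n cvec"
  assumes W: "reflection_group W" and irred: "irreducible_group W" and well_gen: "well_generated W"
    and herm: "hermitian_inner I" and I_inv: "invariant_form W I" and forms: "normalized_forms W I \<alpha>"
begin

lemma I_linear: "I (u + u') v = I u v + I u' v" "I (x *s u) v = x * I u v" "I (sum f A) v = (\<Sum>a\<in>A. I (f a) v)"
proof -
  have "Vector_Spaces.linear (*s) (*) (\<lambda>u. I u v)" using herm unfolding hermitian_inner_def by blast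
  then have hom: "module_hom (*s) (*) (\<lambda>u. I u v)" by (rule Vector_Spaces.linear.axioms(3))
  show add: "I (u + u') v = I u v + I u' v" for u u' by (rule module_hom.add[OF hom])
  show "I (x *s u) v = x * I u v" by (rule module_hom.scale[OF hom])
  have "I 0 v = 0" using add[of 0 0] by simp
  then show "I (sum f A) v = (\<Sum>a\<in>A. I (f a) v)"
    by (induction A rule: infinite_finite_induct) (simp_all add: add)
qed

lemma I_cnj: "I v u = cnj (I u v)" and I_pos: "v \<noteq> 0 \<Longrightarrow> Re (I v v) > 0"
  using herm unfolding hermitian_inner_def by blast+

lemma I_antilinear: "I u (v - w) = I u v - I u w"
proof -
  have "I (v - w) u = I v u - I w u" using I_linear(1)[of "v - w" w u] by simp
  then show ?thesis using I_cnj by (metis complex_cnj_diff)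
qed

lemma I_expand: "I u v = (\<Sum>i\<in>UNIV. u $ i * I (axis i 1) v)"
proof -
  have "u = (\<Sum>i\<in>UNIV. u $ i *s axis i 1)"
    by (simp add: vec_eq_iff axis_def if_distrib[of "\<lambda>x. _ * x"] cong: if_cong)
  then have "I u v = I (\<Sum>i\<in>UNIV. u $ i *s axis i 1) v" by simp
  then show ?thesis by (simp add: I_linear)
qed

text \<open>Positivity makes the Gram matrix injective, hence invertible; conjugates enter because
  \<open>I\<close> is antilinear in its second argument. Positivity also gives the uniqueness that
  the definite description requires.\<close>

lemma riesz: "pairing a u = I u (riesz I a)"
proof -
  define G where "G = (\<chi> i j. I (axis i 1) (axis j 1))"
  have expand: "I (axis i 1) v = (\<Sum>j\<in>UNIV. G $ i $ j * cnj (v $ j))" for i v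
  proof -
    have "I (axis i 1) v = cnj (\<Sum>j\<in>UNIV. v $ j * I (axis j 1) (axis i 1))" by (metis I_cnj I_expand)
    also have "\<dots> = (\<Sum>j\<in>UNIV. cnj (v $ j) * cnj (I (axis j 1) (axis i 1)))" by simp
    also have "\<dots> = (\<Sum>j\<in>UNIV. G $ i $ j * cnj (v $ j))"
      by (simp add: G_def mult.commute I_cnj[symmetric])
    finally show ?thesis .
  qed
  have "x = 0" if "G *v x = 0" for x
  proof -
    define v where "v = (\<chi> j. cnj (x $ j))"
    have "I (axis i 1) v = (G *v x) $ i" for i by (simp add: expand matrix_vector_mult_def v_def)
    then have "I v v = 0" using that by (subst I_expand) simp
    then have "v = 0" using I_pos[of v] by force
    then show ?thesis by (simp add: v_def vec_eq_iff)
  qed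
  then obtain B where "B ** G = mat 1" using matrix_left_invertible_ker[of G] by blast
  then have "G ** B = mat 1" using matrix_left_right_inverse by blast
  then have G: "G *v (B *v a) = a" by (simp add: matrix_vector_mul_assoc)
  define v where "v = (\<chi> j. cnj ((B *v a) $ j))"
  have "I (axis i 1) v = (G *v (B *v a)) $ i" for i
    by (simp add: expand v_def) (simp add: matrix_vector_mult_def)
  then have v: "\<forall>u. pairing a u = I u v"
    unfolding G by (subst I_expand) (simp add: pairing_def mult.commute)
  have "v' = v" if v': "\<forall>u. pairing a u = I u v'" for v'
  proof (rule ccontr)
    assume "v' \<noteq> v"
    then have "Re (I (v' - v) (v' - v)) > 0" using I_pos by simp
    moreover have "I (v' - v) (v' - v) = 0" using v[rule_format, of "v' - v"] v'[rule_format, of "v' - v"] by (simp add: I_antilinear)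
    ultimately show False by simp
  qed
  then have "riesz I a = v" unfolding riesz_def using v by (intro the_equality)
  with v show ?thesis by simp
qed

text \<open>This replaces orthogonality in the logarithmic modules by vanishing at the normal
  vector, the form used in \<open>locl\<close>.\<close>

lemma dual_form_eq_0_iff: "dual_form I a b = 0 \<longleftrightarrow> pairing b (riesz I a) = 0"
  unfolding dual_form_def riesz[of b] by (metis I_cnj complex_cnj_zero)

abbreviation \<A> :: "'n cvec set set" where "\<A> \<equiv> arrangement W"
abbreviation normal :: "'n cvec set \<Rightarrow> 'n cvec" where "normal H \<equiv> riesz I (\<alpha> H)"
abbreviation ord :: "'n cvec set \<Rightarrow> nat" where "ord H \<equiv> order_mult W H"

lemma mem_H_iff: "H \<in> \<A> \<Longrightarrow> v \<in> H \<longleftrightarrow> pairing (\<alpha> H) v = 0"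
  using forms by (auto simp: normalized_forms_def)

lemma linear_form_H: "H \<in> \<A> \<Longrightarrow> linear_form (\<alpha> H) (normal H)"
  using forms unfolding linear_form_def riesz normalized_forms_def dual_form_def by blast

lemma finite_W: "finite W" and subgroup_W: "subgroup W GL"
  using W by (auto simp: reflection_group_def)

lemma finite_arrangement: "finite \<A>"
  using finite_W by (simp add: arrangement_def reflections_def)

lemma W_invertible: "g \<in> W \<Longrightarrow> invertible g"
  using subgroup.mem_carrier[OF subgroup_W] by (simp add: GL_def)

lemma W_mult: "g \<in> W \<Longrightarrow> h \<in> W \<Longrightarrow> g ** h \<in> W"
  using subgroup.m_closed[OF subgroup_W] by (simp add: GL_def)

lemma W_one: "mat 1 \<in> W"
  using subgroup.one_closed[OF subgroup_W] by (simp add: GL_def)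

lemma W_inv: assumes "g \<in> W" shows "matrix_inv g \<in> W"
proof -
  note gi = matrix_inv_both[OF W_invertible[OF assms]]
  have "inv\<^bsub>GL\<^esub> g = matrix_inv g"
    unfolding m_inv_def
  proof (rule the_equality)
    show "matrix_inv g \<in> carrier GL \<and> g \<otimes>\<^bsub>GL\<^esub> matrix_inv g = \<one>\<^bsub>GL\<^esub> \<and> matrix_inv g \<otimes>\<^bsub>GL\<^esub> g = \<one>\<^bsub>GL\<^esub>"
      using gi by (auto simp: GL_def invertible_def intro!: exI[of _ g])
  next
    fix y assume "y \<in> carrier GL \<and> g \<otimes>\<^bsub>GL\<^esub> y = \<one>\<^bsub>GL\<^esub> \<and> y \<otimes>\<^bsub>GL\<^esub> g = \<one>\<^bsub>GL\<^esub>"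
    then have "g ** y = mat 1" "y ** g = mat 1" by (auto simp: GL_def)
    then show "y = matrix_inv g" by (simp add: matrix_inv_eqI)
  qed
  then show ?thesis using subgroup.m_inv_closed[OF subgroup_W assms] by simp
qed

lemma arrangement_nonempty: "\<A> \<noteq> {}"
proof -
  have "reflections W \<noteq> {}"
    using well_gen by (auto simp: well_generated_def)
  then show ?thesis by (simp add: arrangement_def)
qed

definition stab :: "'n cvec set \<Rightarrow> 'n cmat set" where
  "stab H = {g \<in> W. \<forall>v\<in>H. g *v v = v}"

text \<open>\<open>g\<close> is unitary and fixes \<open>H\<close> pointwise, so it maps the
  orthogonal line to itself and is determined by its eigenvalue there.\<close>

lemma stab_formula:
  assumes H: "H \<in> \<A>" and g: "g \<in> stab H"
  shows "g *v v = v + ((pairing (\<alpha> H) (g *v normal H) - 1) * pairing (\<alpha> H) v) *s normal H"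
proof -
  interpret linear_form "\<alpha> H" "normal H" by (rule linear_form_H[OF H])
  let ?a = "\<alpha> H" and ?c = "normal H"
  define x where "x = pairing ?a (g *v ?c)"
  have gW: "g \<in> W" and fixH: "\<And>v. v \<in> H \<Longrightarrow> g *v v = v" using g by (auto simp: stab_def)
  have I_g: "I (g *v u) (g *v w) = I u w" for u w using I_inv gW by (auto simp: invariant_form_def)
  have gc: "g *v ?c = x *s ?c"
  proof -
    \<comment> \<open>\<open>y\<close> is the component in \<open>H\<close> of the image of the
      normal. It is orthogonal to the normal and, since \<open>g\<close> is unitary and fixes
      \<open>y\<close>, also to the image, hence to itself.\<close>
    define y where "y = g *v ?c - x *s ?c"
    have "pairing ?a y = 0" by (simp add: y_def pairing_add x_def pairing_ac)
    then have yH: "y \<in> H" by (simp add: mem_H_iff[OF H])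
    have 1: "I y ?c = 0" using \<open>pairing ?a y = 0\<close> by (simp add: riesz)
    have "I y (g *v ?c) = I (g *v y) (g *v ?c)" using fixH[OF yH] by simp
    also have "\<dots> = 0" using 1 I_g by simp
    finally have 2: "I (g *v ?c) y = 0" using I_cnj[of "g *v ?c" y] by simp
    have "I ?c y = 0" using 1 I_cnj[of ?c y] by simp
    then have "I (x *s ?c) y = 0" by (simp add: I_linear)
    then have "I y y = 0" using 2 I_linear(1)[of y "x *s ?c" y] by (simp add: y_def)
    then show ?thesis using I_pos[of y] by (force simp: y_def)
  qed
  have "v - pairing ?a v *s ?c \<in> H" by (simp add: mem_H_iff[OF H] pairing_add pairing_ac)
  then have "g *v (v - pairing ?a v *s ?c) = v - pairing ?a v *s ?c" by (rule fixH)
  then have "g *v v - pairing ?a v *s (g *v ?c) = v - pairing ?a v *s ?c"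
    by (simp add: matrix_vector_mult_diff_distrib vector_scalar_commute)
  then have "g *v v = v - pairing ?a v *s ?c + pairing ?a v *s (x *s ?c)"
    unfolding gc by (simp add: algebra_simps)
  then show ?thesis by (simp add: x_def[symmetric] vec_eq_iff algebra_simps)
qed

lemma normal_pairing: "H \<in> \<A> \<Longrightarrow> pairing (\<alpha> H) (normal H) = 1"
  using linear_form_H linear_form.pairing_ac by blast

lemma ord_ge_2: assumes H: "H \<in> \<A>" shows "ord H \<ge> 2"
proof -
  obtain g where g: "g \<in> reflections W" "H = fix_space g" using H by (auto simp: arrangement_def)
  have "g \<in> W" using g by (simp add: reflections_def)
  have "normal H \<notin> H" by (simp add: mem_H_iff[OF H] normal_pairing[OF H])
  then have "g \<noteq> mat 1" by (auto simp: g fix_space_def)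
  then have "card {mat 1, g} = 2" by simp
  moreover have sub: "{mat 1, g} \<subseteq> {g \<in> W. \<forall>v\<in>H. g *v v = v}" using \<open>g \<in> W\<close> W_one by (auto simp: g fix_space_def)
  moreover have "finite {g \<in> W. \<forall>v\<in>H. g *v v = v}" using finite_W by simp
  then have "card {mat 1, g} \<le> card {g \<in> W. \<forall>v\<in>H. g *v v = v}" using sub by (rule card_mono)
  ultimately show ?thesis unfolding order_mult_def by simp
qed

text \<open>The pointwise stabilizer of a hyperplane acts on the normal line through all \<open>e\<^sub>H\<close>-th roots
  of unity; the element acting on \<open>\<alpha>\<^sub>H\<close> by a primitive root is the one used locally.\<close>

lemma local_reflection_exists:
  assumes H: "H \<in> \<A>"
  obtains s \<zeta> where "s \<in> W" "local_reflection (\<alpha> H) (normal H) s \<zeta> (ord H)"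
proof -
  interpret linear_form "\<alpha> H" "normal H" by (rule linear_form_H[OF H])
  define ev where "ev g = pairing (\<alpha> H) (g *v normal H)" for g
  note formula = stab_formula[OF H, folded ev_def]
  have fin: "finite (stab H)" using finite_W by (simp add: stab_def)
  have card: "card (stab H) = ord H" by (simp add: stab_def order_mult_def)
  have inj: "inj_on ev (stab H)"
  proof (rule inj_onI)
    fix g h assume "g \<in> stab H" "h \<in> stab H" "ev g = ev h"
    then have "g *v v = h *v v" for v using formula[of g v] formula[of h v] by simp
    then show "g = h" by (simp add: matrix_eq)
  qed
  have mult: "g ** h \<in> stab H \<and> ev (g ** h) = ev g * ev h" if "g \<in> stab H" "h \<in> stab H" for g h
  proof
    show "g ** h \<in> stab H" using that W_mult by (auto simp: stab_def simp flip: matrix_vector_mul_assoc)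
    have h: "h *v normal H = ev h *s normal H"
      using formula[OF that(2), of "normal H"] by (simp add: pairing_ac vec_eq_iff algebra_simps)
    have "(g ** h) *v normal H = ev h *s (g *v normal H)"
      by (simp add: h vector_scalar_commute flip: matrix_vector_mul_assoc)
    then show "ev (g ** h) = ev g * ev h" by (simp add: ev_def pairing_add)
  qed
  define X where "X = ev ` stab H"
  have finX: "finite X" and cardX: "card X = ord H" using fin inj card by (simp_all add: X_def card_image)
  have nz: "x \<noteq> 0" if x: "x \<in> X" for x
  proof
    assume "x = 0"
    then obtain g where g: "g \<in> stab H" "ev g = 0" using x by (auto simp: X_def)
    then have "g *v normal H = 0" using formula[OF g(1), of "normal H"] by (simp add: pairing_ac vec_eq_iff)
    moreover have "matrix_inv g ** g = mat 1" using matrix_inv_both(2) W_invertible g by (auto simp: stab_def)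
    moreover from calculation(1) have "(matrix_inv g ** g) *v normal H = 0" by (simp flip: matrix_vector_mul_assoc)
    ultimately have "normal H = 0" by simp
    then show False using pairing_ac by (simp add: pairing_def)
  qed
  have "z ^ ord H = 1" if z: "z \<in> X" for z
  proof -
    obtain g where g: "g \<in> stab H" "z = ev g" using z by (auto simp: X_def)
    have sub: "(*) z ` X \<subseteq> X"
    proof
      fix y assume "y \<in> (*) z ` X"
      then obtain h where h: "h \<in> stab H" "y = z * ev h" by (auto simp: X_def)
      then have "y = ev (g ** h)" "g ** h \<in> stab H" using mult[OF g(1) h(1)] g(2) by simp_all
      then show "y \<in> X" by (simp add: X_def)
    qed
    have injz: "inj_on ((*) z) X" using nz[OF z] by (auto intro: inj_onI)
    have "(*) z ` X = X" using endo_inj_surj[OF finX sub injz] .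
    \<comment> \<open>Multiplication by \<open>z\<close> permutes the finite set of eigenvalues;
      comparing the products over it makes \<open>z\<close> a root of unity.\<close>
    then have "\<Prod>X = (\<Prod>x\<in>X. z * x)" using prod.reindex[OF injz, of "\<lambda>x. x"] by (simp add: o_def)
    also have "\<dots> = z ^ ord H * \<Prod>X" using cardX by (simp add: prod.distrib)
    finally show ?thesis using nz finX by simp
  qed
  then have "X \<subseteq> {z. z ^ ord H = 1}" by blast
  moreover have ge2: "ord H \<ge> 2" by (rule ord_ge_2[OF H])
  moreover have "finite {z::complex. z ^ ord H = 1}" using ge2 finite_roots_unity[of "ord H"] by simp
  \<comment> \<open>There are \<open>ord H\<close> eigenvalues by injectivity, all of them roots of
    unity of that order, so they exhaust these roots and a primitive one occurs.\<close>
  ultimately have X: "X = {z. z ^ ord H = 1}"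
    using card_roots_unity_eq[of "ord H"] cardX by (intro card_subset_eq) auto
  define \<zeta> where "\<zeta> = cis (2 * pi / ord H)"
  have pow: "\<zeta> ^ n = cis (2 * pi * n / ord H)" for n
    unfolding \<zeta>_def Complex.DeMoivre by (rule arg_cong[of _ _ cis]) simp
  have root: "\<zeta> ^ ord H = 1" using ge2 by (simp add: pow)
  then have "\<zeta> \<in> ev ` stab H" using X unfolding X_def by blast
  then obtain g where g: "g \<in> stab H" "ev g = \<zeta>" by blast
  have gW: "g \<in> W" using g by (simp add: stab_def)
  have ig: "matrix_inv (matrix_inv g) = g" by (rule matrix_inv_involutive[OF W_invertible[OF gW]])
  have "local_reflection (\<alpha> H) (normal H) (matrix_inv g) \<zeta> (ord H)"
  proof unfold_locales
    show "invertible (matrix_inv g)" using W_invertible W_inv gW by blast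
    show "matrix_inv (matrix_inv g) *v v = v + ((\<zeta> - 1) * pairing (\<alpha> H) v) *s normal H" for v
      unfolding ig using formula[OF g(1)] g(2) by simp
    show "\<zeta> ^ n \<noteq> 1" if n: "0 < n" "n < ord H" for n
    proof
      assume "\<zeta> ^ n = 1"
      then have "cis (2 * pi * real n / real (ord H)) = cis (2 * pi * real 0 / real (ord H))" by (simp add: pow)
      moreover have "inj_on (\<lambda>k. cis (2 * pi * real k / real (ord H))) {..<ord H}"
        using Complex.bij_betw_roots_unity[of "ord H"] ge2 by (simp add: bij_betw_def)
      ultimately show False using n inj_onD[of _ "{..<ord H}" n 0] by fastforce
    qed
  qed (use ge2 root in auto)
  then show thesis using that W_inv gW by blast
qed

text \<open>Divisibility makes the second form vanish on the first hyperplane; the two forms are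
  then proportional.\<close>

lemma unit_other_form:
  assumes "H \<in> \<A>" "K \<in> \<A>" "H \<noteq> K" shows "\<not> lin_form (\<alpha> H) dvd (lin_form (\<alpha> K) :: 'n mpol)"
proof
  interpret linear_form "\<alpha> H" "normal H" by (rule linear_form_H[OF assms(1)])
  assume "lin_form (\<alpha> H) dvd (lin_form (\<alpha> K) :: 'n mpol)"
  then obtain q where q: "lin_form (\<alpha> K) = lin_form (\<alpha> H) * (q :: 'n mpol)" by (auto simp: dvd_def)
  have 1: "pairing (\<alpha> K) v = 0" if "pairing (\<alpha> H) v = 0" for v
    using arg_cong[OF q, of "poly_eval (\<lambda>i. Cst (v $ i) :: 'n mpol)"] that
    by (simp add: poly_eval_mult lin_form_eval)
  have 2: "pairing (\<alpha> K) (v - pairing (\<alpha> H) v *s normal H) = 0" for v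
    by (rule 1) (simp add: pairing_add pairing_ac)
  have eq: "pairing (\<alpha> K) v = pairing (\<alpha> H) v * pairing (\<alpha> K) (normal H)" for v
    using 2[of v] by (simp add: pairing_add)
  have "pairing (\<alpha> K) (normal H) \<noteq> 0" using eq[of "normal K"] normal_pairing[OF assms(2)] by auto
  then have "pairing (\<alpha> K) v = 0 \<longleftrightarrow> pairing (\<alpha> H) v = 0" for v using eq[of v] by simp
  then have "H = K" using mem_H_iff assms by blast
  with assms show False by simp
qed

end

section \<open>Functions with poles along the arrangement\<close>

context reflection_setup begin

definition Qpow :: "('n cvec set \<Rightarrow> int) \<Rightarrow> 'n ratfun" where
  "Qpow \<nu> = (\<Prod>H\<in>\<A>. to_F (lin_form (\<alpha> H)) powi \<nu> H)"

lemma form_nz: "H \<in> \<A> \<Longrightarrow> (to_F (lin_form (\<alpha> H)) :: 'n ratfun) \<noteq> 0"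
  using linear_form.\<pi>_nz[OF linear_form_H] .

lemma Qpow_nz: "Qpow \<nu> \<noteq> 0"
  using form_nz finite_arrangement by (simp add: Qpow_def power_int_eq_0_iff)

lemma Qpow_mult: "Qpow \<nu> * Qpow \<mu> = Qpow (\<lambda>H. \<nu> H + \<mu> H)"
  unfolding Qpow_def prod.distrib[symmetric]
  by (intro prod.cong refl power_int_add[symmetric]) (use form_nz in blast)

lemma Qpow_inverse: "inverse (Qpow \<nu>) = Qpow (\<lambda>H. - \<nu> H)"
  unfolding Qpow_def prod_inversef[symmetric] by (simp add: power_int_minus)

text \<open>At \<open>H\<close> all other forms are units of the local ring, so only the factor
  belonging to \<open>H\<close> counts.\<close>

lemma Qpow_split:
  assumes H: "H \<in> \<A>"
  obtains u where "Qpow \<nu> = to_F (lin_form (\<alpha> H)) powi \<nu> H * u" "u \<in> loc_at (\<alpha> H)" "inverse u \<in> loc_at (\<alpha> H)" "u \<noteq> 0"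
proof -
  interpret linear_form "\<alpha> H" "normal H" by (rule linear_form_H[OF H])
  have unit: "to_F (lin_form (\<alpha> K)) powi n \<in> loc" if K: "K \<in> \<A>" "K \<noteq> H" for K n
  proof -
    have "inverse (to_F (lin_form (\<alpha> K)) :: 'n ratfun) \<in> loc"
      using locI[of "lin_form (\<alpha> K)" 1] unit_other_form[OF H K(1)] K(2) by (simp add: field_simps)
    then show ?thesis using is_subring_power[OF loc_subring] by (simp add: power_int_def)
  qed
  define v where "v \<mu> = (\<Prod>K\<in>\<A> - {H}. to_F (lin_form (\<alpha> K)) powi \<mu> K :: 'n ratfun)" for \<mu>
  have "v \<mu> \<in> loc" for \<mu> unfolding v_def using unit by (intro is_subring_prod[OF loc_subring]) auto
  moreover have "inverse (v \<mu>) \<in> loc" for \<mu>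
  proof -
    have "inverse (v \<mu>) = v (\<lambda>H. - \<mu> H)"
      unfolding v_def prod_inversef[symmetric] by (simp add: power_int_minus)
    then show ?thesis using calculation by simp
  qed
  moreover have "v \<mu> \<noteq> 0" for \<mu> unfolding v_def using form_nz finite_arrangement by (simp add: power_int_eq_0_iff)
  moreover have "Qpow \<nu> = \<pi> powi \<nu> H * v \<nu>"
    unfolding Qpow_def v_def using H finite_arrangement by (simp add: prod.remove)
  ultimately show thesis using that[of "v \<nu>"] by blast
qed

definition S' :: "'n ratfun set" where
  "S' = {f. \<exists>n::nat. Qpow (\<lambda>H. int n) * f \<in> range to_F}"

lemma Qpow_nat: "Qpow (\<lambda>H. int (n H)) = to_F (\<Prod>H\<in>\<A>. lin_form (\<alpha> H) ^ n H)"
  by (simp add: Qpow_def to_F_prod to_F_power)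

lemma range_to_F_subring: "is_subring (range (to_F :: 'n mpol \<Rightarrow> 'n ratfun))"
proof -
  have "to_F p - to_F q \<in> range to_F \<and> to_F p * to_F q \<in> range to_F" for p q :: "'n mpol"
    by (simp flip: to_F_diff to_F_mult)
  moreover have "(1 :: 'n ratfun) \<in> range to_F" using to_F_1 by (metis rangeI)
  ultimately show ?thesis by (auto simp: is_subring_def)
qed

lemma S'_iff: "f \<in> S' \<longleftrightarrow> (\<exists>p n. f = Fract p (defining_poly W \<alpha> ^ n))"
proof -
  have Q: "Qpow (\<lambda>H. int n) = to_F (defining_poly W \<alpha> ^ n)" for n
    by (simp add: Qpow_nat defining_poly_def prod_power_distrib)
  have "to_F (defining_poly W \<alpha> ^ n) \<noteq> 0" for n using Qpow_nz[of "\<lambda>_. int n"] unfolding Q .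
  then have "Qpow (\<lambda>H. int n) * f = to_F p \<longleftrightarrow> f = Fract p (defining_poly W \<alpha> ^ n)" for n p
    unfolding Q Fract_to_F by (simp add: nonzero_eq_divide_eq mult.commute)
  then show ?thesis unfolding S'_def by (auto simp: image_iff)
qed

lemma S'_weaken: "Qpow (\<lambda>H. int n) * f \<in> range to_F \<Longrightarrow> n \<le> m \<Longrightarrow> Qpow (\<lambda>H. int m) * f \<in> range to_F"
proof -
  assume a: "Qpow (\<lambda>H. int n) * f \<in> range to_F" "n \<le> m"
  have "Qpow (\<lambda>H. int m) = Qpow (\<lambda>H. int (m - n)) * Qpow (\<lambda>H. int n)"
    unfolding Qpow_mult using a(2) by (simp add: of_nat_diff)
  then have "Qpow (\<lambda>H. int m) * f = Qpow (\<lambda>H. int (m - n)) * (Qpow (\<lambda>H. int n) * f)" by (simp add: mult.assoc)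
  also have "\<dots> \<in> range to_F"
    unfolding Qpow_nat[of "\<lambda>_. m - n"] by (rule is_subringD(4)[OF range_to_F_subring rangeI a(1)])
  finally show ?thesis .
qed

lemma S'_to_F: "to_F p \<in> S'"
  by (auto simp: S'_def Qpow_def intro!: exI[of _ 0])

lemma S'_subring: "is_subring S'"
proof -
  have "x - y \<in> S' \<and> x * y \<in> S'" if xy: "x \<in> S'" "y \<in> S'" for x y
  proof -
    obtain m n where m: "Qpow (\<lambda>H. int m) * x \<in> range to_F" and n: "Qpow (\<lambda>H. int n) * y \<in> range to_F"
      using xy by (auto simp: S'_def)
    have "Qpow (\<lambda>H. int (m + n)) * x - Qpow (\<lambda>H. int (m + n)) * y \<in> range to_F"
      using S'_weaken[OF m, of "m + n"] S'_weaken[OF n, of "m + n"]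
      by (intro is_subringD(3)[OF range_to_F_subring]) simp_all
    then have "x - y \<in> S'"
      unfolding S'_def by (intro CollectI exI[of _ "m + n"]) (simp only: right_diff_distrib)
    moreover have "(Qpow (\<lambda>H. int m) * x) * (Qpow (\<lambda>H. int n) * y) \<in> range to_F"
      by (rule is_subringD(4)[OF range_to_F_subring m n])
    then have "Qpow (\<lambda>H. int (m + n)) * (x * y) \<in> range to_F"
      using Qpow_mult[of "\<lambda>_. int m" "\<lambda>_. int n"] by (simp add: mult_ac)
    then have "x * y \<in> S'" unfolding S'_def by (intro CollectI exI[of _ "m + n"])
    ultimately show ?thesis by blast
  qed
  then show ?thesis using S'_to_F[of 1] by (auto simp: is_subring_def)
qed

lemma Qpow_in_S': "Qpow \<nu> \<in> S'"
proof -
  define n where "n = (\<Sum>H\<in>\<A>. nat \<bar>\<nu> H\<bar>)"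
  have n: "\<nu> H + int n \<ge> 0" if "H \<in> \<A>" for H
  proof -
    have "nat \<bar>\<nu> H\<bar> \<le> n" unfolding n_def using that finite_arrangement by (intro member_le_sum) auto
    then show ?thesis by linarith
  qed
  have "Qpow (\<lambda>H. int n) * Qpow \<nu> = Qpow (\<lambda>H. int (nat (\<nu> H + int n)))"
    unfolding Qpow_mult unfolding Qpow_def 
  proof (rule prod.cong[OF refl])
    fix H assume "H \<in> \<A>"
    from n[OF this] show "to_F (lin_form (\<alpha> H)) powi (int n + \<nu> H) =
        (to_F (lin_form (\<alpha> H)) powi int (nat (\<nu> H + int n)) :: 'n ratfun)"
      by (simp add: add.commute)
  qed
  then show ?thesis unfolding S'_def Qpow_nat by blast
qed

lemma S'_pdiff: assumes "f \<in> S'" shows "pdiff_F i f \<in> S'"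
proof -
  obtain p n where f: "f = Fract p (defining_poly W \<alpha> ^ n)" using assms S'_iff by blast
  have Q: "to_F (defining_poly W \<alpha> ^ n) = Qpow (\<lambda>H. int n)"
    by (simp add: Qpow_nat defining_poly_def prod_power_distrib)
  have "to_F (defining_poly W \<alpha> ^ n) \<noteq> 0" unfolding Q by (rule Qpow_nz)
  then have nz: "defining_poly W \<alpha> ^ n \<noteq> 0" by (simp only: to_F_eq_0_iff not_False_eq_True)
  have "pdiff_F i f = to_F (pdiff i p * defining_poly W \<alpha> ^ n - p * pdiff i (defining_poly W \<alpha> ^ n)) *
      (inverse (Qpow (\<lambda>H. int n)) * inverse (Qpow (\<lambda>H. int n)))"
    unfolding f pdiff_F_Fract[OF nz] unfolding Fract_to_F to_F_mult[of "defining_poly W \<alpha> ^ n" "defining_poly W \<alpha> ^ n"] Q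
    by (simp add: field_simps)
  also have "\<dots> \<in> S'"
    unfolding Qpow_inverse by (intro is_subringD(4)[OF S'_subring] S'_to_F Qpow_in_S')
  finally show ?thesis .
qed

text \<open>A function in \<open>S'\<close> has poles at most along the arrangement; regularity at a
  hyperplane cancels its form from the denominator, one hyperplane after the other.\<close>

lemma S'_local_imp_polynomial:
  assumes "f \<in> S'" "\<And>H. H \<in> \<A> \<Longrightarrow> f \<in> loc_at (\<alpha> H)" shows "f \<in> range to_F"
proof -
  obtain n where n: "Qpow (\<lambda>H. int n) * f \<in> range to_F" using assms(1) by (auto simp: S'_def)
  have "to_F (\<Prod>H\<in>X. lin_form (\<alpha> H) ^ n) * f \<in> range to_F \<Longrightarrow> f \<in> range to_F" if "X \<subseteq> \<A>" for X
    using finite_subset[OF that finite_arrangement] that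
  proof (induction X rule: finite_induct)
    case (insert H X)
    then have "H \<in> \<A>" by simp
    interpret linear_form "\<alpha> H" "normal H" by (rule linear_form_H) fact
    from insert show ?case using cancel_L[of f n "\<Prod>H\<in>X. lin_form (\<alpha> H) ^ n"] assms(2)[of H] by simp
  qed simp
  from this[of \<A>] n show ?thesis by (simp add: Qpow_nat)
qed

text \<open>Passes from orders at single hyperplanes to divisibility by a product: after
  multiplication by the opposite powers no hyperplane is left where a pole could occur.\<close>

lemma divide_Qpow:
  assumes "f \<in> S'" "\<And>H. H \<in> \<A> \<Longrightarrow> f \<in> linear_form.lo (\<alpha> H) (\<nu> H)"
  obtains p where "f = Qpow \<nu> * to_F p"
proof -
  have "Qpow (\<lambda>H. - \<nu> H) * f \<in> range to_F"
  proof (rule S'_local_imp_polynomial)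
    show "Qpow (\<lambda>H. - \<nu> H) * f \<in> S'" by (rule is_subringD(4)[OF S'_subring Qpow_in_S' assms(1)])
    fix H assume H: "H \<in> \<A>"
    interpret linear_form "\<alpha> H" "normal H" by (rule linear_form_H[OF H])
    obtain u where u: "Qpow (\<lambda>H. - \<nu> H) = \<pi> powi - \<nu> H * u" "u \<in> loc" by (rule Qpow_split[OF H])
    have "\<pi> powi - \<nu> H * (u * f) \<in> lo (\<nu> H - \<nu> H)"
      using assms(2)[OF H] u(2) unfolding lo_powi_iff by (intro lo_mult_loc) simp_all
    then show "Qpow (\<lambda>H. - \<nu> H) * f \<in> loc" by (simp add: u(1) lo_0 mult.assoc)
  qed
  then obtain p where p: "Qpow (\<lambda>H. - \<nu> H) * f = to_F p" by blast
  have "Qpow \<nu> * to_F p = (Qpow \<nu> * Qpow (\<lambda>H. - \<nu> H)) * f" unfolding p[symmetric] by (simp add: mult.assoc)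
  also have "Qpow \<nu> * Qpow (\<lambda>H. - \<nu> H) = 1" unfolding Qpow_inverse[symmetric] using Qpow_nz by simp
  finally have "f = Qpow \<nu> * to_F p" by simp
  then show thesis by (rule that)
qed

lemma Qpow_lo: assumes H: "H \<in> \<A>" shows "Qpow \<nu> \<in> linear_form.lo (\<alpha> H) m \<longleftrightarrow> m \<le> \<nu> H"
proof -
  interpret linear_form "\<alpha> H" "normal H" by (rule linear_form_H[OF H])
  obtain u where u: "Qpow \<nu> = \<pi> powi \<nu> H * u" "u \<in> loc" "inverse u \<in> loc" "u \<noteq> 0" by (rule Qpow_split[OF H])
  have "Qpow \<nu> \<in> lo m \<longleftrightarrow> \<pi> powi \<nu> H \<in> lo m"
  proof
    assume "Qpow \<nu> \<in> lo m"
    then have "inverse u * Qpow \<nu> \<in> lo m" by (rule lo_mult_loc[OF u(3)])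
    then show "\<pi> powi \<nu> H \<in> lo m"
      by (simp add: u(1,4) mult.left_commute[of _ "\<pi> powi \<nu> H"])
  next
    assume "\<pi> powi \<nu> H \<in> lo m"
    then have "u * \<pi> powi \<nu> H \<in> lo m" by (rule lo_mult_loc[OF u(2)])
    then show "Qpow \<nu> \<in> lo m" using u(1) by (simp add: mult.commute)
  qed
  then show ?thesis by (simp add: powi_in_lo_iff)
qed

definition W_inv_der :: "'n der \<Rightarrow> bool" where
  "W_inv_der \<theta> \<longleftrightarrow> (\<forall>g\<in>W. \<forall>f. act_F g (der_app \<theta> f) = der_app \<theta> (act_F g f))"

lemma act_F_inv: assumes "g \<in> W" shows "act_F (matrix_inv g) (act_F g f) = f" "act_F g (act_F (matrix_inv g) f) = f"
proof -
  have c: "act_F (matrix_inv h) (act_F h f) = f" if "invertible h" "invertible (matrix_inv h)" for h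
  proof -
    obtain p q where f: "q \<noteq> 0" "f = to_F p / to_F q" by (rule ratfun_cases)
    then show ?thesis using act_nz[OF that(1) f(1)] by (simp add: act_F_divide that act_matrix_inv)
  qed
  have i: "invertible g" "invertible (matrix_inv g)" using assms W_invertible W_inv by auto
  show "act_F (matrix_inv g) (act_F g f) = f" by (rule c[OF i])
  show "act_F g (act_F (matrix_inv g) f) = f"
    using c[of "matrix_inv g"] i by (simp add: matrix_inv_involutive)
qed

lemma invariant_ders_eq: "invariant_ders W M = {\<theta> \<in> M. W_inv_der \<theta>}"
proof -
  have "(\<forall>f. act_F g (der_app \<theta> (act_F (matrix_inv g) f)) = der_app \<theta> f) \<longleftrightarrow>
      (\<forall>f. act_F g (der_app \<theta> f) = der_app \<theta> (act_F g f))" if "g \<in> W" for g and \<theta> :: "'n der"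
  proof (intro iffI allI)
    fix f assume "\<forall>f. act_F g (der_app \<theta> (act_F (matrix_inv g) f)) = der_app \<theta> f"
    from this[rule_format, of "act_F g f"] show "act_F g (der_app \<theta> f) = der_app \<theta> (act_F g f)"
      by (simp add: act_F_inv[OF that])
  next
    fix f assume "\<forall>f. act_F g (der_app \<theta> f) = der_app \<theta> (act_F g f)"
    then show "act_F g (der_app \<theta> (act_F (matrix_inv g) f)) = der_app \<theta> f"
      by (simp add: act_F_inv[OF that])
  qed
  then show ?thesis unfolding invariant_ders_def W_inv_der_def by blast
qed

end

section \<open>Degrees and the flat system\<close>

text \<open>The commutator of two derivations is a derivation, so comparing on the variables
  suffices. Consequently partial derivatives lower the Euler eigenvalue by one.\<close>

lemma pdiff_F_euler:
  fixes f :: "'n::{finite,linorder} ratfun"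
  shows "pdiff_F i (der_app euler f) = der_app euler (pdiff_F i f) + pdiff_F i f"
proof -
  let ?\<delta> = "\<lambda>f. pdiff_F i (der_app euler f) - der_app euler (pdiff_F i f)"
  have d: "twisted_derivation (\<lambda>x. x) (pdiff_F i :: 'n ratfun \<Rightarrow> _)" by (rule twisted_derivation_pdiff_F)
  then have p: "pdiff_F i (a + b) = pdiff_F i a + pdiff_F i b"
    "pdiff_F i (a * b) = pdiff_F i a * b + a * pdiff_F i b" "pdiff_F i (const_F c) = 0" for a b :: "'n ratfun" and c
    by (auto simp: twisted_derivation_def)
  have "twisted_derivation (\<lambda>x. x) ?\<delta>"
    unfolding twisted_derivation_def using p(3)[of 0]
    by (simp add: p der_app_add der_app_mult algebra_simps)
  from twisted_derivation_chain[OF field_hom_id this, of f]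
  have "?\<delta> f = (\<Sum>j\<in>UNIV. pdiff_F j f * (pdiff_F i (to_F (Var j)) - der_app euler (pdiff_F i (to_F (Var j)))))"
    by (simp add: euler_def)
  also have "\<dots> = (\<Sum>j\<in>UNIV. pdiff_F j f * (if j = i then 1 else 0))"
    by (intro sum.cong refl) (simp add: pdiff_Var)
  also have "\<dots> = pdiff_F i f" by (simp add: if_distrib[of "\<lambda>x. _ * x"] cong: if_cong)
  finally show ?thesis by (simp add: algebra_simps)
qed

lemma homog_der_euler:
  assumes "homog_der \<theta> m" shows "der_app euler (\<theta> $ i) = const_F (of_int m) * \<theta> $ i"
proof -
  obtain p q f g where \<theta>: "\<theta> $ i = Fract (f i) (g i)" "homog p (f i)" "g i \<noteq> 0" "homog q (g i)" "m = int p - int q"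
    using assms unfolding homog_der_def by blast
  have e: "\<theta> $ i * to_F (g i) = to_F (f i)" using \<theta> by (simp add: Fract_to_F)
  have "der_app euler (\<theta> $ i * to_F (g i)) = of_nat p * (\<theta> $ i * to_F (g i))"
    unfolding e using \<theta>(2) by (rule euler_homog)
  then have "der_app euler (\<theta> $ i) * to_F (g i) = (of_nat p - of_nat q) * \<theta> $ i * to_F (g i)"
    unfolding der_app_mult euler_homog[OF \<theta>(4)] by (simp add: algebra_simps)
  then have "der_app euler (\<theta> $ i) = (of_nat p - of_nat q) * \<theta> $ i" using \<theta>(3) by simp
  then show ?thesis by (simp add: \<theta>(5) Cst_diff to_F_diff const_F_simps(5))
qed

lemma euler_der_app:
  assumes "\<And>i. der_app euler (\<theta> $ i) = const_F a * \<theta> $ i" "der_app euler f = const_F b * f"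
  shows "der_app euler (der_app \<theta> f) = const_F (a + b - 1) * der_app \<theta> f"
proof -
  have e: "der_app euler (pdiff_F i f) = const_F (b - 1) * pdiff_F i f" for i
  proof -
    have "const_F b * pdiff_F i f = der_app euler (pdiff_F i f) + pdiff_F i f"
      using pdiff_F_euler[of i f] twisted_derivation_pdiff_F[of i]
      unfolding assms(2) twisted_derivation_def by simp
    then show ?thesis by (simp add: Cst_diff to_F_diff algebra_simps)
  qed
  have "der_app euler (\<theta> $ i * pdiff_F i f) = const_F (a + b - 1) * (\<theta> $ i * pdiff_F i f)" for i
    unfolding der_app_mult assms(1) e by (simp add: Cst_diff Cst_add to_F_diff to_F_add algebra_simps)
  then show ?thesis by (simp add: der_app_def[of \<theta>] der_app_sum sum_distrib_left)
qed

text \<open>Families over \<open>1, \<dots>, \<ell>\<close> are transported to the index type \<open>'n\<close>, so that the library's determinants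
  apply; \<open>\<eta>\<close> and the coexponents are read in reverse order, as in the rows of \<open>M_eta\<close>.\<close>

definition idx :: "'n::finite \<Rightarrow> nat" where
  "idx = (SOME f. bij_betw f UNIV {1..CARD('n)})"

lemma bij_idx: "bij_betw (idx :: 'n::finite \<Rightarrow> nat) UNIV {1..CARD('n)}"
proof -
  obtain h where "bij_betw h {1..CARD('n)} (UNIV :: 'n set)"
    using ex_bij_betw_nat_finite_1[of "UNIV :: 'n set"] by auto
  then have "\<exists>f. bij_betw f (UNIV :: 'n set) {1..CARD('n)}" using bij_betw_inv by blast
  from someI_ex[OF this] show ?thesis by (simp only: idx_def)
qed

lemma idx_mem: "idx (i :: 'n::finite) \<in> {1..CARD('n)}"
  using bij_idx bij_betwE by blast

lemma idx_eq_iff [simp]: "idx i = idx j \<longleftrightarrow> i = j"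
  using bij_idx unfolding bij_betw_def by (metis UNIV_I inj_on_def)

lemma idx_surj: "m \<in> {1..CARD('n::finite)} \<Longrightarrow> \<exists>i :: 'n. idx i = m"
  using bij_idx[where 'n = 'n] unfolding bij_betw_def by (metis imageE)

lemma sum_idx: "(\<Sum>m=1..CARD('n::finite). f m) = (\<Sum>i\<in>(UNIV :: 'n set). f (idx i))"
  using sum.reindex_bij_betw[OF bij_idx[where 'n = 'n], of f] by simp

definition rev_idx :: "'n::finite \<Rightarrow> nat" where
  "rev_idx i = CARD('n) + 1 - idx i"

lemma bij_rev_idx: "bij_betw (rev_idx :: 'n::finite \<Rightarrow> nat) UNIV {1..CARD('n)}"
proof -
  have "bij_betw (\<lambda>m. CARD('n) + 1 - m) {1..CARD('n)} {1..CARD('n)}"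
    by (rule bij_betwI[of _ _ _ "\<lambda>m. CARD('n) + 1 - m"]) auto
  from bij_betw_trans[OF bij_idx this] show ?thesis by (simp add: rev_idx_def[abs_def] o_def)
qed

lemma rev_idx_mem: "rev_idx (i :: 'n::finite) \<in> {1..CARD('n)}"
  using bij_rev_idx bij_betwE by blast

lemma rev_idx_image: "rev_idx ` (UNIV :: 'n::finite set) = {1..CARD('n)}"
  using bij_rev_idx[where 'n = 'n] by (simp add: bij_betw_def)

lemma sum_rev_idx: "(\<Sum>m=1..CARD('n::finite). f m) = (\<Sum>i\<in>(UNIV :: 'n set). f (rev_idx i))"
  using sum.reindex_bij_betw[OF bij_rev_idx[where 'n = 'n], of f] by simp

lemma family_basis_expand:
  fixes M :: "'n::{finite,linorder} der set"
  assumes "family_basis A M b" "x \<in> M"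
  shows "\<exists>c :: 'n \<Rightarrow> 'n ratfun. (\<forall>i. c i \<in> A) \<and> x = (\<Sum>i\<in>UNIV. c i *s b (rev_idx i))"
proof -
  have inj: "inj_on b {1..CARD('n)}" and free: "free_with_basis A M (b ` {1..CARD('n)})"
    using assms(1) by (auto simp: family_basis_def)
  obtain c where c: "\<And>y. c y \<in> A" "x = (\<Sum>y\<in>b ` {1..CARD('n)}. c y *s y)"
    using free_with_basisD[OF free assms(2)] by blast
  have "x = (\<Sum>m=1..CARD('n). c (b m) *s b m)"
    unfolding c(2) using sum.reindex[OF inj, of "\<lambda>y. c y *s y"] by (simp add: o_def)
  then have "x = (\<Sum>i\<in>(UNIV :: 'n set). c (b (rev_idx i)) *s b (rev_idx i))"
    unfolding sum_rev_idx[where 'n = 'n] .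
  with c(1) show ?thesis by (intro exI[of _ "\<lambda>i. c (b (rev_idx i))"]) simp
qed

lemma family_basis_mem:
  fixes M :: "'n::{finite,linorder} der set"
  assumes "family_basis A M b" shows "b (rev_idx (i :: 'n)) \<in> M"
  using assms rev_idx_mem[of i] unfolding family_basis_def free_with_basis_def by blast

section \<open>The flat system in matrix form\<close>

locale flat_setup = reflection_setup W I \<alpha>
  for W :: "'n::{finite,linorder} cmat set" and I \<alpha> +
  fixes d es :: "nat \<Rightarrow> nat" and t :: "nat \<Rightarrow> 'n mpol" and \<eta> :: "nat \<Rightarrow> 'n der"
  assumes coexp: "coexponents W es" and flat: "flat_system W \<alpha> d es t \<eta>"
begin

definition tt :: "'n \<Rightarrow> 'n ratfun" where "tt i = to_F (t (idx i))"
definition ee :: "'n \<Rightarrow> 'n der" where "ee i = \<eta> (rev_idx i)"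
definition pt :: "'n \<Rightarrow> 'n der" where "pt i = partial_t t (idx i)"
definition last_ix :: 'n where "last_ix = (SOME i. idx i = CARD('n))"
abbreviation D :: "'n der" where "D \<equiv> pt last_ix"
abbreviation R :: "'n ratfun set" where "R \<equiv> to_F ` invariant_polys W"
abbreviation T :: "'n ratfun set" where "T \<equiv> T_ring t"
abbreviation J :: "'n fmat" where "J \<equiv> jacobian tt"
definition M :: "'n \<Rightarrow> 'n \<Rightarrow> 'n ratfun" where "M i j = der_app (ee i) (tt j)"
definition B :: "'n \<Rightarrow> complex" where "B i = B_inf W d (idx i)"
abbreviation h :: complex where "h \<equiv> coxeter_number W"

lemma idx_top: "idx last_ix = CARD('n)"
proof -
  have "\<exists>i :: 'n. idx i = CARD('n)" by (rule idx_surj) (simp add: Suc_leI)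
  from someI_ex[OF this] show ?thesis by (simp only: last_ix_def)
qed

lemma M_eta_eq: "M_eta t \<eta> (idx i) (idx j) = M i j"
  by (simp add: M_eta_def M_def ee_def tt_def rev_idx_def)

lemma flat_facts:
  shows "basic_invariants W d t"
    and "family_basis R (Der_R_log W \<alpha> t) \<eta>"
    and "homog_der (ee i) (int (es (rev_idx i)))"
    and "M i j - (if i = j then tt last_ix else 0) \<in> T"
    and "\<eta> 1 = euler_der W"
    and "linear_iso T (Der_R_log W \<alpha> t) (Der_R W t) (nabla (primitive_der t))"
    and "nabla_D_inv W \<alpha> t (pt i) = - (const_F (inverse (B i)) *s (\<Sum>j\<in>UNIV. M i j *s pt j))"
    and "\<exists>N. inverse_matrices CARD('n) (M_eta t \<eta>) N"
proof -
  show "basic_invariants W d t" "family_basis R (Der_R_log W \<alpha> t) \<eta>" "\<eta> 1 = euler_der W"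
    "linear_iso T (Der_R_log W \<alpha> t) (Der_R W t) (nabla (primitive_der t))"
    "\<exists>N. inverse_matrices CARD('n) (M_eta t \<eta>) N"
    using flat unfolding flat_system_def by blast+
  show "homog_der (ee i) (int (es (rev_idx i)))"
    using flat rev_idx_mem[of i] unfolding flat_system_def ee_def by blast
  have "M_eta t \<eta> (idx i) (idx j) - (if idx i = idx j then to_F (t CARD('n)) else 0) \<in> T"
    using flat idx_mem[of i] idx_mem[of j] unfolding flat_system_def by blast
  then show "M i j - (if i = j then tt last_ix else 0) \<in> T" by (simp only: M_eta_eq idx_eq_iff tt_def idx_top)
  have "nabla_D_inv W \<alpha> t (partial_t t (idx i)) = - (const_F (inverse (B_inf W d (idx i))) *s
      (\<Sum>j=1..CARD('n). M_eta t \<eta> (idx i) j *s partial_t t j))"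
    using flat idx_mem[of i] unfolding flat_system_def by blast
  then show "nabla_D_inv W \<alpha> t (pt i) = - (const_F (inverse (B i)) *s (\<Sum>j\<in>UNIV. M i j *s pt j))"
    unfolding sum_idx[where 'n = 'n] M_eta_eq pt_def B_def .
qed

lemma primitive_der_eq: "primitive_der t = D"
  by (simp add: primitive_der_def pt_def idx_top)

text \<open>The flat system comes with an inverse of \<open>M_eta\<close>. Up to transposition this
  matrix is the Jacobian times the matrix of the \<open>ee\<close>, so the nonvanishing of
  \<open>det J\<close> is obtained here as well.\<close>

lemma det_M_nz: "det (J ** columns_mat ee) \<noteq> 0"
proof -
  obtain N where N: "inverse_matrices CARD('n) (M_eta t \<eta>) N" using flat_facts(8) by blast
  define N' :: "'n fmat" where "N' = (\<chi> i j. N (idx i) (idx j))"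
  define M' :: "'n fmat" where "M' = (\<chi> i j. M i j)"
  have "(M' ** N') $ i $ j = mat 1 $ i $ j" for i j
  proof -
    have "(\<Sum>k=1..CARD('n). M_eta t \<eta> (idx i) k * N k (idx j)) = (if idx i = idx j then 1 else 0)"
      using N idx_mem[of i] idx_mem[of j] unfolding inverse_matrices_def by blast
    then show ?thesis
      unfolding sum_idx[where 'n = 'n] M_eta_eq by (simp add: M'_def N'_def matrix_matrix_mult_def mat_def)
  qed
  then have "M' ** N' = mat 1" by (simp add: vec_eq_iff)
  then have "det M' * det N' = 1" by (metis det_I det_mul)
  moreover have "J ** columns_mat ee = transpose M'"
    by (simp add: vec_eq_iff jacobian_mult_columns transpose_def M'_def M_def)
  ultimately show ?thesis by (auto simp: det_transpose)
qed

lemma det_J_nz: "det J \<noteq> 0"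
  using det_M_nz by (simp add: det_mul)

lemma der_ext:
  assumes "\<And>j. der_app \<theta> (tt j) = der_app \<theta>' (tt j)" shows "\<theta> = \<theta>'"
proof -
  have eq: "J *v \<theta> = J *v \<theta>'" using assms by (simp add: vec_eq_iff jacobian_mult_vec)
  obtain K where "K ** J = mat 1" using det_J_nz invertible_det_nz[of J] by (auto simp: invertible_def)
  then have "K *v (J *v x) = x" for x by (simp add: matrix_vector_mul_assoc)
  with eq show ?thesis by metis
qed

text \<open>Existence from the inverse Jacobian and uniqueness from \<open>der_ext\<close> justify
  the definite description in \<open>partial_t\<close>.\<close>

lemma pt_tt: "der_app (pt i) (tt j) = (if i = j then 1 else 0)"
proof -
  obtain K where K: "J ** K = mat 1" using det_J_nz invertible_det_nz[of J] by (auto simp: invertible_def)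
  define \<theta> where "\<theta> = K *v axis i 1"
  have "J *v \<theta> = axis i 1" unfolding \<theta>_def by (simp add: matrix_vector_mul_assoc K)
  then have \<theta>: "der_app \<theta> (tt j) = (if j = i then 1 else 0)" for j
    using jacobian_mult_vec[of tt \<theta> j] by (simp add: axis_def)
  let ?P = "\<lambda>\<theta>. \<forall>m\<in>{1..CARD('n)}. der_app \<theta> (to_F (t m)) = (if m = idx i then 1 else 0)"
  have P: "?P \<theta>' \<longleftrightarrow> (\<forall>j. der_app \<theta>' (tt j) = (if j = i then 1 else 0))" for \<theta>'
  proof
    assume a: "?P \<theta>'"
    show "\<forall>j. der_app \<theta>' (tt j) = (if j = i then 1 else 0)"
    proof
      fix j show "der_app \<theta>' (tt j) = (if j = i then 1 else 0)"
        using a[rule_format, OF idx_mem[of j]] by (simp add: tt_def)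
    qed
  next
    assume a: "\<forall>j. der_app \<theta>' (tt j) = (if j = i then 1 else 0)"
    show "?P \<theta>'"
    proof
      fix m assume "m \<in> {1..CARD('n)}"
      then obtain j :: 'n where "idx j = m" using idx_surj by blast
      then show "der_app \<theta>' (to_F (t m)) = (if m = idx i then 1 else 0)"
        using a[rule_format, of j] by (auto simp: tt_def)
    qed
  qed
  have "pt i = \<theta>"
    unfolding pt_def partial_t_def
  proof (rule the_equality)
    show "?P \<theta>" using P \<theta> by blast
    show "\<theta>' = \<theta>" if "?P \<theta>'" for \<theta>' using that \<theta> unfolding P by (intro der_ext) simp
  qed
  then show ?thesis using \<theta>[of j] by auto
qed

lemma der_expand: "\<theta> = (\<Sum>j\<in>UNIV. der_app \<theta> (tt j) *s pt j)"
  by (rule der_ext)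
    (simp add: der_app_vec_sum der_app_smult pt_tt if_distrib[of "\<lambda>x. _ * x"] cong: if_cong)

lemma R_iff: "x \<in> R \<longleftrightarrow> x \<in> range to_F \<and> (\<forall>g\<in>W. act_F g x = x)"
  using act_F_to_F[OF W_invertible] by (auto simp: invariant_polys_def)

lemma R_subring: "is_subring R"
proof -
  have "x - y \<in> R \<and> x * y \<in> R" if "x \<in> R" "y \<in> R" for x y
  proof -
    have "act_F g (x - y) = act_F g x - act_F g y" "act_F g (x * y) = act_F g x * act_F g y" if "g \<in> W" for g
    proof -
      have fh: "field_hom (act_F g)" using field_hom_act_F W_invertible that by blast
      then have "act_F g (x - y) + act_F g y = act_F g (x - y + y)" unfolding field_hom_def by metis
      then show "act_F g (x - y) = act_F g x - act_F g y" by (simp add: algebra_simps)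
      show "act_F g (x * y) = act_F g x * act_F g y" using fh by (simp add: field_hom_def)
    qed
    then show ?thesis using that is_subringD[OF range_to_F_subring] unfolding R_iff by simp
  qed
  moreover have "1 \<in> R" unfolding R_iff
    using is_subringD(1)[OF range_to_F_subring] field_hom_act_F W_invertible unfolding field_hom_def by blast
  ultimately show ?thesis by (auto simp: is_subring_def)
qed

lemmas R_ring = is_subringD[OF R_subring]

lemma R_const: "const_F x \<in> R"
  unfolding R_iff using act_F_const W_invertible by blast

lemma R_eq: "R = to_F ` poly_subalg {1..CARD('n)} t"
  using flat_facts(1) by (simp add: basic_invariants_def)

lemma R_tt: "tt i \<in> R"
  unfolding R_eq tt_def by (intro imageI poly_subalg_gen idx_mem)

lemma R_induct [consumes 1, case_names const gen add mult]:
  assumes "x \<in> R" and "\<And>c. P (const_F c)" and "\<And>i. P (tt i)"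
    and "\<And>x y. P x \<Longrightarrow> P y \<Longrightarrow> P (x + y)" and "\<And>x y. P x \<Longrightarrow> P y \<Longrightarrow> P (x * y)"
  shows "P x"
proof -
  obtain p where p: "p \<in> poly_subalg {1..CARD('n)} t" "x = to_F p" using assms(1) unfolding R_eq by blast
  from p(1) have "P (to_F p)"
  proof (induction rule: poly_subalg_induct)
    case (gen m)
    then obtain i :: 'n where "idx i = m" using idx_surj by blast
    then show ?case using assms(3)[of i] by (simp add: tt_def)
  qed (simp_all add: assms to_F_add to_F_mult)
  then show ?thesis by (simp add: p)
qed

lemma T_induct [consumes 1, case_names const gen add mult]:
  assumes "x \<in> T" and "\<And>c. P (const_F c)" and "\<And>i. i \<noteq> last_ix \<Longrightarrow> P (tt i)"
    and "\<And>x y. P x \<Longrightarrow> P y \<Longrightarrow> P (x + y)" and "\<And>x y. P x \<Longrightarrow> P y \<Longrightarrow> P (x * y)"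
  shows "P x"
proof -
  obtain p where p: "p \<in> poly_subalg {1..CARD('n) - 1} t" "x = to_F p" using assms(1) unfolding T_ring_def by blast
  from p(1) have "P (to_F p)"
  proof (induction rule: poly_subalg_induct)
    case (gen m)
    moreover have "CARD('n) > 0" by simp
    ultimately have m: "m \<in> {1..CARD('n)}" "m \<noteq> CARD('n)" unfolding atLeastAtMost_iff by linarith+
    then obtain i :: 'n where "idx i = m" using idx_surj by blast
    then show ?case using assms(3)[of i] idx_top m by (auto simp: tt_def)
  qed (simp_all add: assms to_F_add to_F_mult)
  then show ?thesis by (simp add: p)
qed

lemma T_const: "const_F x \<in> T"
  unfolding T_ring_def by (intro imageI poly_subalg_Cst)

lemma T_subring: "is_subring T"
proof -
  have a: "x + y \<in> T" and m: "x * y \<in> T" if "x \<in> T" "y \<in> T" for x y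
    using that unfolding T_ring_def
    by (auto simp flip: to_F_add to_F_mult intro: poly_subalg_add poly_subalg_mult)
  have "x - y \<in> T" if "x \<in> T" "y \<in> T" for x y
    using a[OF that(1) m[OF T_const[of "- 1"] that(2)]] by (simp add: const_F_simps(3))
  then show ?thesis using m T_const[of 1] by (simp add: is_subring_def)
qed

lemmas T_ring_closed = is_subringD[OF T_subring]

lemma T_tt: "i \<noteq> last_ix \<Longrightarrow> tt i \<in> T"
  unfolding T_ring_def tt_def
proof (intro imageI poly_subalg_gen)
  assume "i \<noteq> last_ix"
  then have "idx i \<noteq> CARD('n)" using idx_top idx_eq_iff by metis
  then show "idx i \<in> {1..CARD('n) - 1}" using idx_mem[of i] by auto
qed

lemma T_sub_R: "x \<in> T \<Longrightarrow> x \<in> R"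
  by (induction rule: T_induct) (auto intro: R_const R_tt R_ring)

lemma D_T: "x \<in> T \<Longrightarrow> der_app D x = 0"
  by (induction rule: T_induct) (auto simp: pt_tt der_app_add der_app_mult)

lemma M_decompose: obtains M0 where "\<And>i j. M0 i j \<in> T" "\<And>i j. M i j = (if i = j then tt last_ix else 0) + M0 i j"
  using that[of "\<lambda>i j. M i j - (if i = j then tt last_ix else 0)"] flat_facts(4) by simp

lemma M_R: "M i j \<in> R"
proof -
  obtain M0 where M0: "\<And>i j. M0 i j \<in> T" "\<And>i j. M i j = (if i = j then tt last_ix else 0) + M0 i j"
    by (rule M_decompose) blast
  show ?thesis using M0(1)[of i j] unfolding M0(2) by (auto intro: R_ring R_tt T_sub_R)
qed

lemma D_M: "der_app D (M i j) = (if i = j then 1 else 0)"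
proof -
  obtain M0 where M0: "\<And>i j. M0 i j \<in> T" "\<And>i j. M i j = (if i = j then tt last_ix else 0) + M0 i j"
    by (rule M_decompose) blast
  show ?thesis unfolding M0(2) by (simp add: der_app_add D_T[OF M0(1)] pt_tt)
qed

lemma ee_eq: "ee i = (\<Sum>j\<in>UNIV. M i j *s pt j)"
  unfolding M_def by (rule der_expand)

lemma euler_tt: "der_app euler (tt i) = const_F (of_nat (d (idx i))) * tt i"
proof -
  have "homog (d (idx i)) (t (idx i))" using flat_facts(1) idx_mem[of i] unfolding basic_invariants_def by blast
  from euler_homog[OF this] show ?thesis by (simp add: tt_def const_F_simps(5))
qed

lemma euler_T: "x \<in> T \<Longrightarrow> der_app euler x \<in> T"
proof -
  assume "x \<in> T"
  then have "x \<in> T \<and> der_app euler x \<in> T"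
  proof (induction rule: T_induct)
    case (const c)
    show ?case using T_const[of c] T_ring_closed(2) by simp
  next
    case (gen i)
    then show ?case unfolding euler_tt by (intro conjI T_ring_closed(4) T_const T_tt)
  qed (auto simp: der_app_add der_app_mult intro: T_ring_closed)
  then show ?thesis by blast
qed

text \<open>\<open>D\<close> kills \<open>T\<close> but sends \<open>tt last_ix\<close> to
  1.\<close>

lemma top_not_T: "const_F x * tt last_ix \<in> T \<Longrightarrow> x = 0"
  using D_T[of "const_F x * tt last_ix"] by (simp add: der_app_mult pt_tt)

text \<open>The row of \<open>M\<close> at \<open>last_ix\<close> comes from
  \<open>\<eta> 1\<close>, the Euler derivation divided by \<open>h\<close>, so its diagonal entry
  is the top degree over \<open>h\<close> times the top invariant. Applying \<open>D\<close> must
  give 1.\<close>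

lemma degree_top: "h = of_nat (d (idx last_ix))"
proof -
  define x where "x = 1 / h"
  have "ee last_ix = euler_der W" using flat_facts(5) by (simp add: ee_def rev_idx_def idx_top)
  moreover have "der_app (euler_der W) f = const_F x * der_app euler f" for f
    by (simp add: der_app_def euler_der_def euler_def Cst_mult to_F_mult sum_distrib_left mult.assoc x_def)
  ultimately have "M last_ix last_ix = const_F x * (const_F (of_nat (d (idx last_ix))) * tt last_ix)"
    by (simp add: M_def euler_tt)
  then have "der_app D (M last_ix last_ix) = const_F (x * of_nat (d (idx last_ix)))"
    by (simp add: der_app_mult pt_tt Cst_mult to_F_mult)
  then have "const_F (x * of_nat (d (idx last_ix))) = (const_F 1 :: 'n ratfun)" by (simp add: D_M)
  then have e: "x * of_nat (d (idx last_ix)) = 1" unfolding to_F_eq_iff Cst_eq_iff .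
  then have h: "h \<noteq> 0" by (auto simp: x_def)
  from e show "h = of_nat (d (idx last_ix))" using h by (simp add: x_def)
qed

lemma euler_ee: "der_app euler (ee i $ j) = const_F (of_nat (es (rev_idx i))) * ee i $ j"
  using homog_der_euler[OF flat_facts(3)[of i]] by simp

text \<open>The entry \<open>M i i\<close> is an Euler eigenvector with the left-hand side as
  eigenvalue, and it equals the top invariant, of degree \<open>h\<close>, plus an element of
  \<open>T\<close>. As the Euler derivation preserves \<open>T\<close>, the two eigenvalues must
  agree.\<close>

lemma degree_sum: "of_nat (es (rev_idx (i :: 'n))) + of_nat (d (idx i)) - 1 = h"
proof -
  define n where "n = of_nat (es (rev_idx i)) + of_nat (d (idx i)) - (1 :: complex)"
  define \<tau> where "\<tau> = M i i - tt last_ix"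
  have \<tau>: "\<tau> \<in> T" using flat_facts(4)[of i i] by (simp add: \<tau>_def)
  have M: "M i i = tt last_ix + \<tau>" by (simp add: \<tau>_def)
  have "der_app euler (M i i) = const_F n * M i i"
    unfolding M_def n_def by (rule euler_der_app[OF euler_ee euler_tt])
  then have "const_F (h - n) * tt last_ix = const_F n * \<tau> - der_app euler \<tau>"
    unfolding M by (simp add: der_app_add euler_tt degree_top Cst_diff to_F_diff algebra_simps)
  also have "\<dots> \<in> T" by (intro T_ring_closed T_const euler_T \<tau>)
  finally show ?thesis using top_not_T[of "h - n"] by (simp add: n_def)
qed

text \<open>Summing gives the rank times \<open>h\<close>, which is the sum of the orders by the
  definition of the Coxeter number.\<close>

lemma degree_sum_total:
  "(\<Sum>i\<in>UNIV. of_nat (es (rev_idx (i :: 'n)))) + (\<Sum>i\<in>UNIV. of_nat (d (idx (i :: 'n))) - 1) =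
    (of_nat (\<Sum>H\<in>\<A>. ord H) :: complex)"
proof -
  have "(\<Sum>i\<in>UNIV. of_nat (es (rev_idx (i :: 'n)))) + (\<Sum>i\<in>UNIV. of_nat (d (idx (i :: 'n))) - 1) =
      (\<Sum>i\<in>(UNIV :: 'n set). h)"
    unfolding sum.distrib[symmetric] using degree_sum by (intro sum.cong) (auto simp: algebra_simps)
  then show ?thesis by (simp add: coxeter_number_def)
qed

text \<open>The defect of \<open>\<theta>\<close> from commuting with \<open>g\<close> is a
  derivation along \<open>g\<close>. Vanishing on the basic invariants puts its values on the
  variables into the kernel of the Jacobian transformed by \<open>g\<close>, which is
  invertible.\<close>

lemma W_inv_der_iff: "W_inv_der \<theta> \<longleftrightarrow> (\<forall>g\<in>W. \<forall>i. act_F g (der_app \<theta> (tt i)) = der_app \<theta> (tt i))"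
proof
  assume "W_inv_der \<theta>"
  then show "\<forall>g\<in>W. \<forall>i. act_F g (der_app \<theta> (tt i)) = der_app \<theta> (tt i)"
    using R_tt unfolding W_inv_der_def R_iff by simp
next
  assume a: "\<forall>g\<in>W. \<forall>i. act_F g (der_app \<theta> (tt i)) = der_app \<theta> (tt i)"
  show "W_inv_der \<theta>"
    unfolding W_inv_der_def
  proof (intro ballI allI)
    fix g f assume g: "g \<in> W"
    let ?\<phi> = "act_F g"
    have fh: "field_hom ?\<phi>" using field_hom_act_F W_invertible g by blast
    have p: "?\<phi> (x + y) = ?\<phi> x + ?\<phi> y" "?\<phi> (x * y) = ?\<phi> x * ?\<phi> y" for x y
      using fh by (auto simp: field_hom_def)
    let ?\<delta> = "\<lambda>f. ?\<phi> (der_app \<theta> f) - der_app \<theta> (?\<phi> f)"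
    have td: "twisted_derivation ?\<phi> ?\<delta>" by (rule twisted_derivation_commutator[OF W_invertible[OF g]])
    define y where "y = (\<chi> i. ?\<delta> (to_F (Var i)))"
    define K where "K = (\<chi> m i. ?\<phi> (J $ m $ i))"
    have "det K = ?\<phi> (det J)" unfolding K_def
      by (rule det_map) (use p fh in \<open>auto simp: field_hom_def\<close>)
    then have "det K \<noteq> 0" using field_hom_nz[OF fh det_J_nz] by simp
    then obtain K' where K': "K' ** K = mat 1" using invertible_det_nz[of K] by (auto simp: invertible_def)
    have "(K *v y) $ m = ?\<delta> (tt m)" for m
      using twisted_derivation_chain[OF fh td, of "tt m"] by (simp add: K_def y_def matrix_vector_mult_def)
    moreover have "?\<delta> (tt m) = 0" for m using a g R_tt[of m] unfolding R_iff by simp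
    ultimately have "K *v y = 0" by (simp add: vec_eq_iff)
    then have "K' *v (K *v y) = 0" by simp
    then have "y = 0" by (simp add: matrix_vector_mul_assoc K')
    then have "?\<delta> (to_F (Var i)) = 0" for i by (simp add: y_def vec_eq_iff)
    then have "?\<delta> f = 0" using twisted_derivation_chain[OF fh td, of f] by simp
    then show "act_F g (der_app \<theta> f) = der_app \<theta> (act_F g f)" by simp
  qed
qed

lemma pt_W_inv: "W_inv_der (pt i)"
  unfolding W_inv_der_iff pt_tt using R_ring(1,2) unfolding R_iff by simp

lemma Der_R_iff: "\<theta> \<in> Der_R W t \<longleftrightarrow> (\<forall>j. der_app \<theta> (tt j) \<in> R)"
proof
  assume "\<theta> \<in> Der_R W t"
  then obtain r where r: "\<theta> = (\<Sum>m=1..CARD('n). to_F (r m) *s partial_t t m)" "\<forall>m\<in>{1..CARD('n)}. r m \<in> invariant_polys W"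
    unfolding Der_R_def by blast
  have "\<theta> = (\<Sum>i\<in>UNIV. to_F (r (idx i)) *s pt i)" unfolding r(1) sum_idx[where 'n = 'n] pt_def ..
  then have "der_app \<theta> (tt j) = to_F (r (idx j))" for j
    by (simp add: der_app_vec_sum der_app_smult pt_tt if_distrib[of "\<lambda>x. _ * x"] cong: if_cong)
  then show "\<forall>j. der_app \<theta> (tt j) \<in> R" using r(2) idx_mem[where 'n = 'n] by blast
next
  assume a: "\<forall>j. der_app \<theta> (tt j) \<in> R"
  have "\<exists>p. p \<in> invariant_polys W \<and> der_app \<theta> (tt j) = to_F p" for j using a by blast
  then obtain q where q: "\<And>j. q j \<in> invariant_polys W" "\<And>j. der_app \<theta> (tt j) = to_F (q j)" by metis
  define r where "r m = q (inv_into UNIV idx m)" for m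
  have r: "r (idx j) = q j" for j using bij_idx[where 'n = 'n] by (simp add: r_def inv_f_f bij_betw_def)
  have "\<theta> = (\<Sum>m=1..CARD('n). to_F (r m) *s partial_t t m)"
    unfolding sum_idx[where 'n = 'n] r pt_def[symmetric] q(2)[symmetric] by (rule der_expand)
  moreover have "\<forall>m\<in>{1..CARD('n)}. r m \<in> invariant_polys W" using q(1) by (simp add: r_def)
  ultimately show "\<theta> \<in> Der_R W t" unfolding Der_R_def by blast
qed

lemma Der_R_W_inv: "\<theta> \<in> Der_R W t \<Longrightarrow> W_inv_der \<theta>"
  unfolding Der_R_iff W_inv_der_iff R_iff by blast

end

context reflection_setup begin

lemma der_app_Qpow:
  "der_app \<theta> (Qpow \<nu>) =
    (\<Sum>H\<in>\<A>. of_int (\<nu> H) * (der_app \<theta> (to_F (lin_form (\<alpha> H))) / to_F (lin_form (\<alpha> H)))) * Qpow \<nu>"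
proof -
  have e: "der_app \<theta> (to_F (lin_form (\<alpha> H)) powi \<nu> H) * (\<Prod>K\<in>\<A> - {H}. to_F (lin_form (\<alpha> K)) powi \<nu> K) =
      of_int (\<nu> H) * (der_app \<theta> (to_F (lin_form (\<alpha> H))) / to_F (lin_form (\<alpha> H))) * Qpow \<nu>" if H: "H \<in> \<A>" for H
  proof -
    let ?x = "to_F (lin_form (\<alpha> H)) :: 'n ratfun"
    have nz: "?x \<noteq> 0" by (rule form_nz[OF H])
    have "Qpow \<nu> = ?x powi \<nu> H * (\<Prod>K\<in>\<A> - {H}. to_F (lin_form (\<alpha> K)) powi \<nu> K)"
      unfolding Qpow_def using finite_arrangement H by (rule prod.remove)
    moreover have "?x powi (\<nu> H - 1) = ?x powi \<nu> H / ?x" using nz by (simp add: power_int_diff)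
    ultimately show ?thesis unfolding der_app_powi[OF nz] by simp
  qed
  show ?thesis
    unfolding Qpow_def[of \<nu>] der_app_prod[OF finite_arrangement] sum_distrib_right
    using e unfolding Qpow_def by (intro sum.cong refl) blast
qed

lemma euler_lin_form: "der_app euler (to_F (lin_form a)) = to_F (lin_form a)"
  by (simp add: der_app_lin_form euler_def) (simp add: lin_form_def to_F_sum to_F_mult)

lemma euler_Qpow: "der_app euler (Qpow \<nu>) = const_F (of_int (\<Sum>H\<in>\<A>. \<nu> H)) * Qpow \<nu>"
proof -
  have "(\<Sum>H\<in>\<A>. of_int (\<nu> H) * (der_app euler (to_F (lin_form (\<alpha> H))) / to_F (lin_form (\<alpha> H)))) =
      (\<Sum>H\<in>\<A>. of_int (\<nu> H) :: 'n ratfun)"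
    by (intro sum.cong refl) (simp only: euler_lin_form divide_self[OF form_nz] mult_1_right)
  also have "\<dots> = of_int (\<Sum>H\<in>\<A>. \<nu> H)" by (rule of_int_sum[symmetric])
  finally show ?thesis unfolding der_app_Qpow by (simp only: const_F_of_int)
qed

lemma euler_quotient:
  fixes x y :: "'n ratfun"
  assumes "der_app euler (x * y) = const_F a * (x * y)" "der_app euler x = const_F b * x" "x \<noteq> 0"
  shows "der_app euler y = const_F (a - b) * y"
proof -
  have "x * der_app euler y = x * (const_F (a - b) * y)"
    using assms(1) unfolding der_app_mult assms(2) by (simp add: Cst_diff to_F_diff algebra_simps)
  then show ?thesis using assms(3) by simp
qed

lemma det_polynomial: "(\<And>i j. (X :: 'n fmat) $ i $ j \<in> range to_F) \<Longrightarrow> det X \<in> range to_F"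
  by (rule is_subring_det[OF range_to_F_subring])

lemma range_to_F_S': "x \<in> range to_F \<Longrightarrow> x \<in> S'"
  using S'_to_F by blast

end

section \<open>Determinants fixed by their degrees\<close>

context flat_setup begin

text \<open>A homogeneous basis of the invariant polynomial derivations, with degrees in the same
  reversed order as for \<open>ee\<close>. Its relation to \<open>ee\<close> is only settled by
  \<open>det_ee_th\<close>.\<close>

definition th :: "'n \<Rightarrow> 'n der" where
  "th = (SOME th. (\<forall>i. th i \<in> invariant_ders W Der_S \<and> homog_der (th i) (int (es (rev_idx i)))) \<and>
    (\<forall>x\<in>invariant_ders W Der_S. \<exists>c. (\<forall>i. c i \<in> R) \<and> x = (\<Sum>i\<in>UNIV. c i *s th i)))"

lemma th_props:
  shows "th i \<in> invariant_ders W Der_S" "homog_der (th i) (int (es (rev_idx i)))"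
    and "x \<in> invariant_ders W Der_S \<Longrightarrow> \<exists>c. (\<forall>i. c i \<in> R) \<and> x = (\<Sum>i\<in>UNIV. c i *s th i)"
proof -
  obtain b :: "nat \<Rightarrow> 'n der" where b: "family_basis R (invariant_ders W Der_S) b"
    "\<forall>j\<in>{1..CARD('n)}. homog_der (b j) (int (es j))"
    using coexp unfolding coexponents_def by blast
  have "\<exists>th :: 'n \<Rightarrow> 'n der. (\<forall>i. th i \<in> invariant_ders W Der_S \<and> homog_der (th i) (int (es (rev_idx i)))) \<and>
    (\<forall>x\<in>invariant_ders W Der_S. \<exists>c. (\<forall>i. c i \<in> R) \<and> x = (\<Sum>i\<in>UNIV. c i *s th i))"
  proof (intro exI[of _ "\<lambda>i. b (rev_idx i)"] conjI allI ballI)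
    fix i :: 'n
    show "b (rev_idx i) \<in> invariant_ders W Der_S" by (rule family_basis_mem[OF b(1)])
    show "homog_der (b (rev_idx i)) (int (es (rev_idx i)))" using b(2) rev_idx_mem[of i] by blast
  next
    fix x assume "x \<in> invariant_ders W Der_S"
    then show "\<exists>c. (\<forall>i. c i \<in> R) \<and> x = (\<Sum>i\<in>(UNIV :: 'n set). c i *s b (rev_idx i))"
      by (rule family_basis_expand[OF b(1)])
  qed
  from someI_ex[OF this, folded th_def]
  show "th i \<in> invariant_ders W Der_S" "homog_der (th i) (int (es (rev_idx i)))"
    "x \<in> invariant_ders W Der_S \<Longrightarrow> \<exists>c. (\<forall>i. c i \<in> R) \<and> x = (\<Sum>i\<in>UNIV. c i *s th i)" by blast+
qed

lemma th_S: "th i $ j \<in> range to_F" and th_inv: "W_inv_der (th i)"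
  using th_props(1)[of i] by (auto simp: invariant_ders_eq Der_S_def)

lemma pdiff_tt_S: "J $ m $ i \<in> range to_F"
  by (simp add: tt_def)

lemma det_J_S: "det J \<in> range to_F"
  by (rule det_polynomial) (rule pdiff_tt_S)

text \<open>The product of all translates of \<open>det J\<close> is invariant and contains
  \<open>det J\<close> as a factor, so it clears the denominators produced by inverting the
  Jacobian.\<close>

lemma invariant_multiple:
  obtains n where "n \<in> R" "n \<noteq> 0" "\<And>i j. n * pt i $ j \<in> range to_F"
proof -
  obtain p where p: "det J = to_F p" using det_J_S by blast
  then have p0: "p \<noteq> 0" using det_J_nz by auto
  define q where "q = (\<Prod>w\<in>W. act w p)"
  have q0: "q \<noteq> 0" using act_nz[OF W_invertible p0] finite_W by (auto simp: q_def)
  have "act g q = q" if g: "g \<in> W" for g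
  proof -
    have bij: "bij_betw ((**) g) W W"
    proof (rule bij_betwI[of _ _ _ "(**) (matrix_inv g)"])
      show "(**) g \<in> W \<rightarrow> W" "(**) (matrix_inv g) \<in> W \<rightarrow> W" using W_mult W_inv g by auto
      show "matrix_inv g ** (g ** x) = x" "g ** (matrix_inv g ** x) = x" for x
        using matrix_inv_both[OF W_invertible[OF g]] by (simp_all add: matrix_mul_assoc)
    qed
    have "act g q = (\<Prod>w\<in>W. act (g ** w) p)"
      unfolding q_def act_prod using act_act[OF W_invertible[OF g] W_invertible] by (intro prod.cong) auto
    also have "\<dots> = q" unfolding q_def by (rule prod.reindex_bij_betw[OF bij])
    finally show ?thesis .
  qed
  then have qR: "to_F q \<in> R" by (simp add: invariant_polys_def)
  have "act (mat 1) p = p"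
  proof -
    have "act (mat 1) (act (mat 1) p) = act (mat 1) p"
      using act_act[of "mat 1" "mat 1" p] by (simp add: W_invertible[OF W_one])
    then show ?thesis using act_matrix_inv[OF W_invertible[OF W_one]] by metis
  qed
  then have "q = p * (\<Prod>w\<in>W - {mat 1}. act w p)"
    unfolding q_def using prod.remove[OF finite_W W_one, of "\<lambda>w. act w p"] by simp
  then obtain r where r: "q = p * r" by blast
  have "to_F q * pt i $ j \<in> range to_F" for i j
  proof -
    have v: "(J *v pt i) $ m \<in> range to_F" for m
      unfolding jacobian_mult_vec pt_tt using is_subringD(1,2)[OF range_to_F_subring] by auto
    have "pt i $ j * det J = det (\<chi> m l. if l = j then (J *v pt i) $ m else J $ m $ l)"
      by (simp only: cramer_lemma)
    also have "\<dots> \<in> range to_F"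
    proof (rule det_polynomial)
      fix m l show "(\<chi> m l. if l = j then (J *v pt i) $ m else J $ m $ l) $ m $ l \<in> range to_F"
        using v[of m] pdiff_tt_S[of m l] by simp
    qed
    finally have "to_F r * (pt i $ j * det J) \<in> range to_F" by (rule is_subringD(4)[OF range_to_F_subring rangeI])
    then show ?thesis by (simp add: r p to_F_mult mult_ac)
  qed
  then show thesis using that[OF qR] q0 by simp
qed

text \<open>An invariant multiple of each \<open>pt i\<close> is an invariant polynomial derivation
  and thus lies in the span of \<open>th\<close>. The \<open>pt i\<close> are dual to the basic
  invariants, so their matrix is nonsingular, and \<open>th\<close> inherits this.\<close>

lemma det_th_nz: "det (columns_mat th) \<noteq> 0"
proof -
  obtain n where n: "n \<in> R" "n \<noteq> 0" "\<And>i j. n * pt i $ j \<in> range to_F" by (rule invariant_multiple) blast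
  have mem: "n *s pt i \<in> invariant_ders W Der_S" for i
  proof -
    have "der_app (n *s pt i) (tt j) \<in> R" for j
      using n(1) R_ring(1,2) by (simp add: der_app_smult pt_tt)
    then have "W_inv_der (n *s pt i)" unfolding W_inv_der_iff R_iff by blast
    moreover have "n *s pt i \<in> Der_S" using n(3) by (simp add: Der_S_def)
    ultimately show ?thesis by (simp add: invariant_ders_eq)
  qed
  have "\<forall>i. \<exists>c. (\<forall>m. c m \<in> R) \<and> n *s pt i = (\<Sum>m\<in>UNIV. c m *s th m)" using th_props(3)[OF mem] by blast
  from choice[OF this] obtain c where "\<forall>i. (\<forall>m. c i m \<in> R) \<and> n *s pt i = (\<Sum>m\<in>UNIV. c i m *s th m)" by blast
  then have c: "\<And>i. n *s pt i = (\<Sum>m\<in>UNIV. c i m *s th m)" by blast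
  define C :: "'n fmat" where "C = (\<chi> m i. c i m)"
  have "columns_mat (\<lambda>i. n *s pt i) = columns_mat th ** C"
    by (simp add: vec_eq_iff c C_def matrix_matrix_mult_def sum_component mult.commute)
  then have "det (J ** columns_mat (\<lambda>i. n *s pt i)) = det J * det (columns_mat th) * det C"
    by (simp add: det_mul)
  moreover have "det (J ** columns_mat (\<lambda>i. n *s pt i)) = (\<Prod>i\<in>UNIV. (J ** columns_mat (\<lambda>i. n *s pt i)) $ i $ i)"
    by (rule det_diagonal) (simp add: jacobian_mult_columns der_app_smult pt_tt)
  moreover have "\<dots> \<noteq> 0" using n(2) by (simp add: jacobian_mult_columns der_app_smult pt_tt)
  ultimately show ?thesis by auto
qed

lemma R_loc: "x \<in> R \<Longrightarrow> H \<in> \<A> \<Longrightarrow> x \<in> loc_at (\<alpha> H)"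
  using linear_form.loc_to_F[OF linear_form_H] by auto

lemma euler_th: "der_app euler (th i $ j) = const_F (of_nat (es (rev_idx i))) * th i $ j"
  using homog_der_euler[OF th_props(2)[of i]] by simp

lemma euler_det_columns:
  assumes "\<And>i j. der_app euler (V i $ j) = const_F (b i) * V i $ j"
  shows "der_app euler (det (columns_mat V)) = const_F (\<Sum>i\<in>UNIV. b i) * det (columns_mat V)"
  using der_app_det[of euler "columns_mat V" "\<lambda>_. 0" "\<lambda>i. const_F (b i)"] assms by (simp add: Cst_sum to_F_sum)

lemma euler_det_J: "der_app euler (det J) = const_F (\<Sum>i\<in>UNIV. of_nat (d (idx (i :: 'n))) - 1) * det J"
proof -
  have "der_app euler (J $ m $ i) = const_F (of_nat (d (idx m)) - 1) * J $ m $ i" for m i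
  proof -
    have "pdiff_F i (const_F x * f) = const_F x * pdiff_F i f" for x and f :: "'n ratfun"
      using twisted_derivation_pdiff_F[of i] unfolding twisted_derivation_def by simp
    then have "const_F (of_nat (d (idx m))) * pdiff_F i (tt m) = der_app euler (pdiff_F i (tt m)) + pdiff_F i (tt m)"
      using pdiff_F_euler[of i "tt m"] unfolding euler_tt by simp
    then show ?thesis by (simp add: Cst_diff to_F_diff algebra_simps)
  qed
  then show ?thesis
    using der_app_det[of euler J "\<lambda>m. const_F (of_nat (d (idx m)) - 1)" "\<lambda>_. 0"] by (simp add: Cst_sum to_F_sum)
qed

lemma det_J_lo: assumes H: "H \<in> \<A>" shows "det J \<in> linear_form.lo (\<alpha> H) (int (ord H) - 1)"
proof -
  obtain s \<zeta> where s: "s \<in> W" "local_reflection (\<alpha> H) (normal H) s \<zeta> (ord H)"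
    by (rule local_reflection_exists[OF H])
  interpret local_reflection "\<alpha> H" "normal H" s \<zeta> "ord H" by (rule s(2))
  show ?thesis
    by (rule jacobian_lo(1)) (use R_tt R_loc[OF _ H] s(1) in \<open>auto simp: R_iff\<close>)
qed

text \<open>The value on the form of \<open>H\<close> has character \<open>\<zeta>\<close>, which is
  not 1.\<close>

lemma W_inv_polynomial_lo:
  assumes H: "H \<in> \<A>" and S: "\<And>j. \<theta> $ j \<in> range to_F" and inv: "W_inv_der \<theta>"
  shows "der_app \<theta> (to_F (lin_form (\<alpha> H))) \<in> linear_form.lo (\<alpha> H) 1"
proof -
  obtain s \<zeta> where s: "s \<in> W" "local_reflection (\<alpha> H) (normal H) s \<zeta> (ord H)"
    by (rule local_reflection_exists[OF H])
  interpret local_reflection "\<alpha> H" "normal H" s \<zeta> "ord H" by (rule s(2))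
  have "\<theta> $ j \<in> loc" for j
  proof -
    obtain p where "\<theta> $ j = to_F p" using S[of j] by blast
    then show ?thesis by simp
  qed
  then have "der_app \<theta> \<pi> \<in> loc"
    unfolding der_app_lin_form by (intro is_subring_sum[OF loc_subring] loc_ring(4) loc_to_F)
  moreover have "act_s (der_app \<theta> \<pi>) = const_F \<zeta> * der_app \<theta> \<pi>"
    using inv s(1) by (intro s_inv_\<pi>) (simp add: s_inv_def W_inv_der_def)
  moreover have "\<zeta> \<noteq> 1" using primitive[of 1] e_ge_2 by simp
  ultimately show ?thesis by (rule semi_invariant_lo_1)
qed

lemma th_lo: "H \<in> \<A> \<Longrightarrow> der_app (th i) (to_F (lin_form (\<alpha> H))) \<in> linear_form.lo (\<alpha> H) 1"
  by (rule W_inv_polynomial_lo[OF _ th_S th_inv])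

lemma der_S_locl:
  assumes H: "H \<in> \<A>" and "\<And>j. \<theta> $ j \<in> range to_F"
    "der_app \<theta> (to_F (lin_form (\<alpha> H))) \<in> linear_form.lo (\<alpha> H) m"
  shows "linear_form.locl (\<alpha> H) (normal H) \<theta> m"
proof -
  interpret linear_form "\<alpha> H" "normal H" by (rule linear_form_H[OF H])
  have "\<theta> $ j \<in> loc" for j
  proof -
    obtain p where "\<theta> $ j = to_F p" using assms(2)[of j] by blast
    then show ?thesis by simp
  qed
  then have "der_app \<theta> (to_F (lin_form b)) \<in> loc" for b
    unfolding der_app_lin_form by (intro is_subring_sum[OF loc_subring] loc_ring(4) loc_to_F)
  then show ?thesis using assms(3) by (simp add: locl_def)
qed

text \<open>Both determinants are divisible by the expected products of linear forms; since the degrees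
  add up to \<open>\<Sum>\<^sub>H e\<^sub>H\<close>, neither leaves room for another factor.\<close>

lemma det_J_det_th:
  obtains x y where "det J = const_F x * Qpow (\<lambda>H. int (ord H) - 1)" "x \<noteq> 0"
    "det (columns_mat th) = const_F y * Qpow (\<lambda>_. 1)" "y \<noteq> 0"
proof -
  obtain u where u: "det J = Qpow (\<lambda>H. int (ord H) - 1) * to_F u"
    using divide_Qpow[OF range_to_F_S'[OF det_J_S] det_J_lo] by blast
  have "det (columns_mat th) \<in> linear_form.lo (\<alpha> H) 1" if H: "H \<in> \<A>" for H
  proof -
    interpret linear_form "\<alpha> H" "normal H" by (rule linear_form_H[OF H])
    show ?thesis by (intro det_locl der_S_locl[OF H] th_S th_lo[OF H])
  qed
  moreover have "det (columns_mat th) \<in> S'" by (intro range_to_F_S' det_polynomial) (simp add: th_S)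
  ultimately obtain v where v: "det (columns_mat th) = Qpow (\<lambda>_. 1) * to_F v"
    using divide_Qpow[of _ "\<lambda>_. 1"] by blast
  have nz: "u \<noteq> 0" "v \<noteq> 0" using det_J_nz det_th_nz unfolding u v by auto
  have eu: "der_app euler (to_F u) =
      const_F ((\<Sum>i\<in>UNIV. of_nat (d (idx (i :: 'n))) - 1) - of_int (\<Sum>H\<in>\<A>. int (ord H) - 1)) * to_F u"
    using euler_det_J unfolding u by (rule euler_quotient[OF _ euler_Qpow Qpow_nz])
  have ev: "der_app euler (to_F v) =
      const_F ((\<Sum>i\<in>UNIV. of_nat (es (rev_idx (i :: 'n)))) - of_int (\<Sum>H\<in>\<A>. 1)) * to_F v"
    using euler_det_columns[of th, OF euler_th] unfolding v by (rule euler_quotient[OF _ euler_Qpow Qpow_nz])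
  obtain m :: nat where m: "(\<Sum>i\<in>UNIV. of_nat (d (idx (i :: 'n))) - 1) - of_int (\<Sum>H\<in>\<A>. int (ord H) - 1) = (of_nat m :: complex)"
    "m = 0 \<Longrightarrow> \<exists>c. u = Cst c"
    by (rule euler_eigenvalue[OF eu nz(1)]) blast
  obtain n :: nat where n: "(\<Sum>i\<in>UNIV. of_nat (es (rev_idx (i :: 'n)))) - of_int (\<Sum>H\<in>\<A>. 1) = (of_nat n :: complex)"
    "n = 0 \<Longrightarrow> \<exists>c. v = Cst c"
    by (rule euler_eigenvalue[OF ev nz(2)]) blast
  have "(of_nat (m + n) :: complex) =
      (\<Sum>i\<in>UNIV. of_nat (es (rev_idx (i :: 'n)))) + (\<Sum>i\<in>UNIV. of_nat (d (idx (i :: 'n))) - 1) -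
      of_int ((\<Sum>H\<in>\<A>. int (ord H) - 1) + (\<Sum>H\<in>\<A>. 1))"
    unfolding of_nat_add m(1)[symmetric] n(1)[symmetric] by (simp add: algebra_simps)
  also have "(\<Sum>H\<in>\<A>. int (ord H) - 1) + (\<Sum>H\<in>\<A>. 1) = int (\<Sum>H\<in>\<A>. ord H)"
    by (simp add: sum_subtractf)
  also have "(\<Sum>i\<in>UNIV. of_nat (es (rev_idx (i :: 'n)))) + (\<Sum>i\<in>UNIV. of_nat (d (idx (i :: 'n))) - 1) -
      of_int (int (\<Sum>H\<in>\<A>. ord H)) = (0 :: complex)"
    unfolding degree_sum_total by simp
  finally have "m = 0" "n = 0" by (simp_all flip: of_nat_add)
  then obtain x y where "u = Cst x" "v = Cst y" using m n by blast
  then show thesis using that[of x y] u v nz by (auto simp: mult.commute)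
qed

lemma discriminant_eq: "to_F (discriminant W \<alpha>) = Qpow (\<lambda>H. int (ord H))"
  by (simp add: Qpow_nat discriminant_def)

lemma th_tt_R: "der_app (th i) (tt j) \<in> R"
proof -
  have "der_app (th i) (tt j) = (\<Sum>m\<in>UNIV. th i $ m * J $ j $ m)" by (simp add: der_app_def)
  also have "\<dots> \<in> range to_F"
    by (intro is_subring_sum[OF range_to_F_subring] is_subringD(4)[OF range_to_F_subring] th_S pdiff_tt_S)
  finally have "der_app (th i) (tt j) \<in> range to_F" .
  then show ?thesis using th_inv[of i] unfolding W_inv_der_iff by (simp only: R_iff) blast
qed

text \<open>The discriminant is, up to a constant, the determinant of the values of
  \<open>th\<close> on the basic invariants, and all these values are invariant polynomials.\<close>

lemma discriminant_R: "Qpow (\<lambda>H. int (ord H)) \<in> R"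
proof -
  obtain x y where xy: "det J = const_F x * Qpow (\<lambda>H. int (ord H) - 1)" "x \<noteq> 0"
    "det (columns_mat th) = const_F y * Qpow (\<lambda>_. 1)" "y \<noteq> 0" by (rule det_J_det_th)
  have "det (J ** columns_mat th) \<in> R"
    by (intro is_subring_det[OF R_subring]) (simp add: jacobian_mult_columns th_tt_R)
  moreover have "det (J ** columns_mat th) = const_F (x * y) * Qpow (\<lambda>H. int (ord H))"
    using Qpow_mult[of "\<lambda>H. int (ord H) - 1" "\<lambda>_. 1"] by (simp add: det_mul xy Cst_mult to_F_mult mult_ac)
  ultimately have "const_F (inverse (x * y)) * (const_F (x * y) * Qpow (\<lambda>H. int (ord H))) \<in> R"
    using R_ring(4)[OF R_const] by simp
  moreover have "const_F (inverse (x * y)) * const_F (x * y) = (1 :: 'n ratfun)"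
  proof -
    have "inverse (x * y) * (x * y) = 1" using xy(2,4) by (intro left_inverse) simp
    then show ?thesis unfolding to_F_mult[symmetric] Cst_mult[symmetric] by (simp only: Cst_1 to_F_1)
  qed
  ultimately show ?thesis by (simp only: mult.assoc[symmetric] mult_1)
qed

text \<open>The quotient by the discriminant is a sum of logarithmic derivatives, each a polynomial
  because \<open>th i\<close> maps the form of \<open>H\<close> to a multiple of itself. Its
  invariance follows by cancelling the invariant discriminant.\<close>

lemma th_Der_R_log: "th i \<in> Der_R_log W \<alpha> t"
proof -
  define r where "r = (\<Sum>H\<in>\<A>. of_int (int (ord H)) *
    (der_app (th i) (to_F (lin_form (\<alpha> H))) / to_F (lin_form (\<alpha> H))))"
  let ?\<Delta> = "Qpow (\<lambda>H. int (ord H))"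
  have r: "der_app (th i) ?\<Delta> = r * ?\<Delta>" unfolding r_def by (rule der_app_Qpow)
  have "r \<in> range to_F"
    unfolding r_def
  proof (intro is_subring_sum[OF range_to_F_subring] is_subringD(4)[OF range_to_F_subring])
    fix H assume H: "H \<in> \<A>"
    interpret linear_form "\<alpha> H" "normal H" by (rule linear_form_H[OF H])
    show "of_int (int (ord H)) \<in> range to_F" using const_F_of_int[of "int (ord H)"] by (metis rangeI)
    have "der_app (th i) \<pi> \<in> range to_F"
      unfolding der_app_lin_form
      by (intro is_subring_sum[OF range_to_F_subring] is_subringD(4)[OF range_to_F_subring] th_S rangeI)
    then obtain p where p: "der_app (th i) \<pi> = to_F p" by blast
    then have "L dvd p" using th_lo[OF H, of i] to_F_in_lo_1_iff by simp
    then obtain q where "p = L * q" by blast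
    then show "der_app (th i) \<pi> / \<pi> \<in> range to_F" using p \<pi>_nz by (simp add: to_F_mult)
  qed
  moreover have "act_F g r = r" if g: "g \<in> W" for g
  proof -
    have fh: "field_hom (act_F g)" using field_hom_act_F W_invertible g by blast
    have g\<Delta>: "act_F g ?\<Delta> = ?\<Delta>" using discriminant_R g unfolding R_iff by blast
    have "act_F g (der_app (th i) ?\<Delta>) = der_app (th i) ?\<Delta>"
      using th_inv[of i] g g\<Delta> unfolding W_inv_der_def by simp
    then have "act_F g r * ?\<Delta> = r * ?\<Delta>" unfolding r using fh g\<Delta> by (simp add: field_hom_def)
    then show ?thesis using Qpow_nz by simp
  qed
  ultimately have "r \<in> R" unfolding R_iff by blast
  then obtain p where "p \<in> invariant_polys W" "r = to_F p" by blast
  then have "\<exists>p\<in>invariant_polys W. der_app (th i) (to_F (discriminant W \<alpha>)) = to_F (p * discriminant W \<alpha>)"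
    using r by (auto simp: discriminant_eq to_F_mult)
  moreover have "th i \<in> Der_R W t" unfolding Der_R_iff using th_tt_R by blast
  ultimately show ?thesis by (simp add: Der_R_log_def)
qed

text \<open>\<open>th\<close> is expanded in the basis \<open>\<eta>\<close>. Both families have the
  degrees \<open>es\<close>, so the determinant of the transition matrix has degree 0.\<close>

lemma det_ee_th:
  obtains G :: "'n fmat" and g where "\<And>i j. G $ i $ j \<in> R" "\<And>i. th i = (\<Sum>m\<in>UNIV. G $ m $ i *s ee m)"
    "det G = const_F g" "g \<noteq> 0" "columns_mat th = columns_mat ee ** G"
proof -
  have "\<forall>i. \<exists>c. (\<forall>m. c m \<in> R) \<and> th i = (\<Sum>m\<in>UNIV. c m *s ee m)"
    unfolding ee_def using family_basis_expand[OF flat_facts(2) th_Der_R_log] by blast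
  from choice[OF this] obtain c where "\<forall>i. (\<forall>m. c i m \<in> R) \<and> th i = (\<Sum>m\<in>UNIV. c i m *s ee m)" by blast
  then have c: "\<And>i m. c i m \<in> R" "\<And>i. th i = (\<Sum>m\<in>UNIV. c i m *s ee m)" by blast+
  define G :: "'n fmat" where "G = (\<chi> m i. c i m)"
  have cols: "columns_mat th = columns_mat ee ** G"
    by (simp add: vec_eq_iff c(2) G_def matrix_matrix_mult_def sum_component mult.commute)
  let ?n = "\<Sum>i\<in>UNIV. of_nat (es (rev_idx (i :: 'n))) :: complex"
  have "der_app euler (det (columns_mat ee) * det G) = const_F ?n * (det (columns_mat ee) * det G)"
    unfolding det_mul[symmetric] cols[symmetric] by (rule euler_det_columns[of th, OF euler_th])
  moreover have "det (columns_mat ee) \<noteq> 0" "det G \<noteq> 0" using det_th_nz by (auto simp: cols det_mul)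
  ultimately have eG: "der_app euler (det G) = const_F (?n - ?n) * det G"
    using euler_det_columns[of ee, OF euler_ee] by (intro euler_quotient)
  have "det G \<in> R" by (rule is_subring_det[OF R_subring]) (simp add: G_def c)
  then obtain p where p: "det G = to_F p" by blast
  obtain n :: nat where n: "?n - ?n = of_nat n" "n = 0 \<Longrightarrow> \<exists>c. p = Cst c"
    using euler_eigenvalue[of p "?n - ?n"] eG \<open>det G \<noteq> 0\<close> unfolding p by auto
  then obtain g where "p = Cst g" by auto
  with p have "det G = const_F g" "g \<noteq> 0" using \<open>det G \<noteq> 0\<close> by auto
  then show thesis using that[of G g] c cols by (simp add: G_def)
qed

text \<open>The transition matrix is invertible over \<open>R\<close>, so the flat derivations are
  \<open>R\<close>-combinations of \<open>th\<close> and inherit polynomial coefficients.\<close>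

lemma ee_S: "ee i $ j \<in> range to_F"
proof -
  obtain G :: "'n fmat" and g where G: "\<And>i j. G $ i $ j \<in> R" "det G = const_F g" "g \<noteq> 0" "columns_mat th = columns_mat ee ** G"
    by (rule det_ee_th) blast
  have dG: "det G \<noteq> 0" using G(2,3) by simp
  then obtain K where K: "G ** K = mat 1" using invertible_det_nz[of G] by (auto simp: invertible_def)
  define x where "x = K *v axis i 1"
  have Gx: "G *v x = axis i 1" by (simp add: x_def matrix_vector_mul_assoc K)
  have "x $ m \<in> R" for m
  proof (rule is_subring_cramer[OF R_subring G(1)])
    have "inverse (det G) = const_F (inverse g)" using G(2) by (simp add: const_F_inverse)
    then show "inverse (det G) \<in> R" using R_const by simp
    show "det G \<noteq> 0" by (rule dG)
    show "(G *v x) $ m \<in> R" for m unfolding Gx using R_ring(1,2) by (simp add: axis_def)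
  qed
  then have xS: "x $ m \<in> range to_F" for m unfolding R_iff by blast
  have "columns_mat th *v x = columns_mat ee *v (G *v x)" by (simp add: G(4) matrix_vector_mul_assoc)
  also have "\<dots> = ee i"
    unfolding Gx by (simp add: vec_eq_iff matrix_vector_mult_def axis_def if_distrib[of "\<lambda>x. _ * x"] cong: if_cong)
  finally have "ee i $ j = (\<Sum>m\<in>UNIV. th m $ j * x $ m)" by (simp add: matrix_vector_mult_def vec_eq_iff)
  also have "\<dots> \<in> range to_F"
    by (intro is_subring_sum[OF range_to_F_subring] is_subringD(4)[OF range_to_F_subring] th_S xS)
  finally show ?thesis .
qed

lemma det_M: obtains x where "det (J ** columns_mat ee) = const_F x * Qpow (\<lambda>H. int (ord H))" "x \<noteq> 0"
proof -
  obtain x y where xy: "det J = const_F x * Qpow (\<lambda>H. int (ord H) - 1)" "x \<noteq> 0"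
    "det (columns_mat th) = const_F y * Qpow (\<lambda>_. 1)" "y \<noteq> 0" by (rule det_J_det_th)
  obtain G :: "'n fmat" and g where G: "det G = const_F g" "g \<noteq> 0" "columns_mat th = columns_mat ee ** G"
    by (rule det_ee_th) blast
  have "det (columns_mat ee) * const_F g = const_F y * Qpow (\<lambda>_. 1)" using xy(3) by (simp add: G det_mul)
  then have "det (columns_mat ee) = const_F (y * inverse g) * Qpow (\<lambda>_. 1)"
    using G(2) unfolding Cst_mult to_F_mult const_F_inverse by (simp add: field_simps)
  then have "det (J ** columns_mat ee) = const_F (x * (y * inverse g)) * (Qpow (\<lambda>H. int (ord H) - 1) * Qpow (\<lambda>_. 1))"
    unfolding det_mul xy(1) Cst_mult to_F_mult by (simp only: mult_ac)
  then have "det (J ** columns_mat ee) = const_F (x * (y * inverse g)) * Qpow (\<lambda>H. int (ord H))"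
    by (simp add: Qpow_mult)
  moreover have "x * (y * inverse g) \<noteq> 0" using xy(2,4) G(2) by simp
  ultimately show thesis by (rule that)
qed

lemma Der_R_log_sub: "\<theta> \<in> Der_R_log W \<alpha> t \<Longrightarrow> \<theta> \<in> Der_R W t"
  by (simp add: Der_R_log_def)

lemma Der_R_log_S: assumes "\<theta> \<in> Der_R_log W \<alpha> t" shows "\<theta> $ j \<in> range to_F"
proof -
  obtain c :: "'n \<Rightarrow> 'n ratfun" where c: "\<forall>m. c m \<in> R" "\<theta> = (\<Sum>m\<in>UNIV. c m *s \<eta> (rev_idx m))"
    using family_basis_expand[OF flat_facts(2) assms] by blast
  have "\<theta> $ j = (\<Sum>m\<in>UNIV. c m * ee m $ j)" by (simp add: c(2) sum_component ee_def)
  also have "\<dots> \<in> range to_F"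
    using c(1) ee_S unfolding R_iff by (intro is_subring_sum[OF range_to_F_subring] is_subringD(4)[OF range_to_F_subring]) blast+
  finally show ?thesis .
qed

end

section \<open>Iterated covariant derivatives\<close>

lemma nabla_add: "nabla \<theta> (x + y) = nabla \<theta> x + nabla \<theta> y"
  and nabla_smult: "nabla \<theta> (a *s x) = der_app \<theta> a *s x + a *s nabla \<theta> x"
  by (simp_all add: nabla_def vec_eq_iff der_app_add der_app_mult)

lemma nabla_0 [simp]: "nabla \<theta> 0 = 0"
  by (simp add: nabla_def vec_eq_iff)

lemma nabla_sum: "nabla \<theta> (sum f A) = (\<Sum>a\<in>A. nabla \<theta> (f a))"
  by (induction A rule: infinite_finite_induct) (simp_all add: nabla_add)

lemma nabla_const: "nabla \<theta> (const_F c *s x) = const_F c *s nabla \<theta> x"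
  by (simp add: nabla_smult)

lemma smult_minus_self: "const_F x *s u - u = const_F (x - 1) *s u"
  and smult_plus_self: "u + const_F x *s u = const_F (x + 1) *s u"
  by (simp_all add: vec_eq_iff Cst_diff Cst_add to_F_diff to_F_add algebra_simps)

lemma submod_sum:
  assumes "submod A M" "\<And>j. j \<in> X \<Longrightarrow> f j \<in> M" shows "sum f X \<in> M"
  using assms(2) by (induction X rule: infinite_finite_induct) (use assms(1) in \<open>auto simp: submod_def\<close>)

context flat_setup begin

lemma tt_nz: "tt i \<noteq> 0"
  using pt_tt[of i i] by auto

text \<open>A basic invariant of degree 0 would be a constant, which every derivation kills. One of
  degree 1 would be an invariant linear form; it vanishes at the normal of a reflection, so its
  kernel is a nonzero stable subspace and irreducibility makes the form zero.\<close>

lemma d_ge_2: "d (idx (i :: 'n)) \<ge> 2"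
proof (rule ccontr)
  assume "\<not> 2 \<le> d (idx i)"
  then consider "d (idx i) = 0" | "d (idx i) = 1" by linarith
  then show False
  proof cases
    case 1
    have "der_app euler (to_F (t (idx i))) = const_F 0 * to_F (t (idx i))"
      using euler_tt[of i] by (simp add: tt_def 1)
    moreover have "t (idx i) \<noteq> 0" using tt_nz[of i] by (simp add: tt_def)
    ultimately obtain n :: nat where "0 = (of_nat n :: complex)" "n = 0 \<Longrightarrow> \<exists>c. t (idx i) = Cst c"
      by (rule euler_eigenvalue) blast
    then obtain c where "t (idx i) = Cst c" by auto
    then show False using pt_tt[of i i] by (simp add: tt_def)
  next
    case 2
    define p where "p = t (idx i)"
    have e: "der_app euler (to_F p) = to_F p" using euler_tt[of i] by (simp add: tt_def p_def 2)
    have "\<exists>c. pdiff j p = Cst c" for j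
    proof (cases "pdiff j p = 0")
      case False
      have "der_app euler (to_F (pdiff j p)) = const_F 0 * to_F (pdiff j p)"
        using pdiff_F_euler[of j "to_F p"] by (simp add: e)
      then obtain n :: nat where "0 = (of_nat n :: complex)" "n = 0 \<Longrightarrow> \<exists>c. pdiff j p = Cst c"
        using False by (rule euler_eigenvalue) blast
      then show ?thesis by auto
    qed (auto intro: exI[of _ 0])
    then have "\<forall>j. \<exists>c. pdiff j p = Cst c" by blast
    from choice[OF this] obtain c where c: "\<forall>j. pdiff j p = Cst (c j)" by blast
    define a :: "'n cvec" where "a = (\<chi> j. c j)"
    have p: "p = lin_form a"
      using e c by (simp add: der_app_euler lin_form_def a_def mult.commute)
    have inv: "pairing a (g *v v) = pairing a v" if g: "g \<in> W" for g v
    proof -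
      have "tt i \<in> R" by (rule R_tt)
      then have "act (matrix_inv g) p = p"
        using W_inv[OF g] by (auto simp: tt_def p_def invariant_polys_def)
      then have "a v* g = a"
        unfolding p act_lin_form lin_form_eq_iff matrix_inv_involutive[OF W_invertible[OF g]] .
      then show ?thesis using pairing_vector_matrix[of a g v] by simp
    qed
    obtain H where H: "H \<in> \<A>" using arrangement_nonempty by blast
    obtain s \<zeta> where s: "s \<in> W" "local_reflection (\<alpha> H) (normal H) s \<zeta> (ord H)"
      by (rule local_reflection_exists[OF H])
    interpret local_reflection "\<alpha> H" "normal H" s \<zeta> "ord H" by (rule s(2))
    have "matrix_inv s *v normal H = \<zeta> *s normal H"
      by (simp add: inv_s pairing_ac vec_eq_iff algebra_simps)
    then have "\<zeta> * pairing a (normal H) = pairing a (normal H)"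
      using inv[OF W_inv[OF s(1)], of "normal H"] by (simp add: pairing_add)
    moreover have "\<zeta> \<noteq> 1" using primitive[of 1] e_ge_2 by simp
    ultimately have 0: "pairing a (normal H) = 0" by simp
    define U where "U = {v. pairing a v = 0}"
    have "vec.subspace U" by (rule vec.subspaceI) (auto simp: U_def pairing_add, simp add: pairing_def)
    moreover have "\<forall>g\<in>W. \<forall>u\<in>U. g *v u \<in> U" using inv by (simp add: U_def)
    ultimately have "U = {0} \<or> U = UNIV" using irred unfolding irreducible_group_def by blast
    moreover have "normal H \<noteq> 0" using pairing_ac by (auto simp: pairing_def)
    moreover have "normal H \<in> U" using 0 by (simp add: U_def)
    ultimately have "U = UNIV" by blast
    then have "pairing a v = 0" for v by (auto simp: U_def)
    then have "a $ j = 0" for j using pairing_axis(2)[of a j] by simp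
    then have "p = 0" by (simp add: p lin_form_def)
    then show False using tt_nz[of i] by (simp add: tt_def p_def)
  qed
qed

lemma B_plus_nz: "B i + of_int k \<noteq> 0"
proof
  assume a: "B i + of_int k = 0"
  define m where "m = d (idx last_ix)"
  have mono: "mono_on {1..CARD('n)} d" using flat_facts(1) by (simp add: basic_invariants_def)
  have dm: "d (idx i) \<le> m"
    unfolding m_def using mono_onD[OF mono idx_mem[of i] idx_mem[of last_ix]] idx_mem[of i] by (simp add: idx_top)
  have m: "m > 0" using d_ge_2[of last_ix] by (simp add: m_def)
  have "(of_nat (d (idx i)) - 1) / of_nat m - 1 + of_int k = (0 :: complex)"
    using a by (simp add: B_def B_inf_def degree_top m_def)
  then have "of_nat (d (idx i)) - 1 = (1 - of_int k) * (of_nat m :: complex)"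
    using m by (simp add: field_simps)
  \<comment> \<open>Now an equation between integers: \<open>d - 1\<close> would be a multiple of
    the top degree, although it lies strictly between 0 and that degree.\<close>
  then have "(of_int (int (d (idx i)) - 1) :: complex) = of_int ((1 - k) * int m)" by simp
  then have e: "int (d (idx i)) - 1 = (1 - k) * int m" by (simp only: of_int_eq_iff)
  have "0 < (1 - k) * int m" "(1 - k) * int m < 1 * int m"
    unfolding e[symmetric] using d_ge_2[of i] dm by simp_all
  then have "0 < 1 - k" "1 - k < 1"
    using m by (simp_all only: zero_less_mult_iff mult_less_cancel_right) auto
  then show False by simp
qed

lemma B_nz: "B i \<noteq> 0"
  using B_plus_nz[of i 0] by simp

abbreviation nab :: "'n der \<Rightarrow> 'n der" where "nab \<equiv> nabla D"
abbreviation nab_inv :: "'n der \<Rightarrow> 'n der" where "nab_inv \<equiv> nabla_D_inv W \<alpha> t"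

lemma nab_bij: "bij_betw nab (Der_R_log W \<alpha> t) (Der_R W t)"
  using flat_facts(6) by (simp add: linear_iso_def primitive_der_eq)

lemma nab_inv_mem: "x \<in> Der_R W t \<Longrightarrow> nab_inv x \<in> Der_R_log W \<alpha> t"
  and nab_nab_inv: "x \<in> Der_R W t \<Longrightarrow> nab (nab_inv x) = x"
  using nab_bij unfolding nabla_D_inv_def primitive_der_eq
  by (auto simp: bij_betw_def inv_into_into f_inv_into_f)

lemma nab_inv_nab: "y \<in> Der_R_log W \<alpha> t \<Longrightarrow> nab_inv (nab y) = y"
  using nab_bij unfolding nabla_D_inv_def primitive_der_eq by (auto simp: bij_betw_def inv_into_f_f)

lemma nab_inv_eqI: "y \<in> Der_R_log W \<alpha> t \<Longrightarrow> nab y = x \<Longrightarrow> nab_inv x = y"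
  using nab_inv_nab by blast

lemma Der_R_log_submod: "submod R (Der_R_log W \<alpha> t)"
  using flat_facts(2) by (simp add: family_basis_def free_with_basis_def)

lemma Der_R_log_smult: "a \<in> R \<Longrightarrow> x \<in> Der_R_log W \<alpha> t \<Longrightarrow> a *s x \<in> Der_R_log W \<alpha> t"
  using Der_R_log_submod unfolding submod_def by blast

definition U :: "int \<Rightarrow> 'n \<Rightarrow> 'n der" where
  "U k i = (if k \<ge> 0 then (nab ^^ nat k) (pt i) else (nab_inv ^^ nat (- k)) (pt i))"

lemma U_0: "U 0 i = pt i" by (simp add: U_def)

lemma U_plus: "k \<ge> 0 \<Longrightarrow> U (k + 1) i = nab (U k i)"
  by (simp add: U_def nat_add_distrib)

lemma U_minus: assumes "k \<le> 0" shows "U (k - 1) i = nab_inv (U k i)"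
proof -
  have "nat (- (k - 1)) = Suc (nat (- k))" using assms by simp
  then show ?thesis using assms by (cases "k = 0") (simp_all add: U_def)
qed

lemma pt_Der_R: "pt i \<in> Der_R W t"
  unfolding Der_R_iff pt_tt using R_ring(1,2) by simp

text \<open>\<open>nab_inv\<close> is controlled only on \<open>Der_R\<close>. Its values lie in
  \<open>Der_R_log\<close>, a part of \<open>Der_R\<close>, so the iteration never leaves the
  domain.\<close>

lemma U_nonpos_Der_R: "U (- int n) i \<in> Der_R W t"
proof (induction n)
  case 0
  show ?case using pt_Der_R by (simp add: U_0)
next
  case (Suc n)
  have "U (- int n - 1) i = nab_inv (U (- int n) i)" by (rule U_minus) simp
  then have "U (- int n - 1) i \<in> Der_R W t" using nab_inv_mem[OF Suc] Der_R_log_sub by simp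
  moreover have "- int (Suc n) = - int n - 1" by simp
  ultimately show ?case by (simp only:)
qed

lemma U_neg_Der_R_log: assumes "k < 0" shows "U k i \<in> Der_R_log W \<alpha> t"
proof -
  have k: "k + 1 = - int (nat (- k - 1))" using assms by simp
  have "U ((k + 1) - 1) i = nab_inv (U (k + 1) i)" using assms by (intro U_minus) simp
  moreover have "U (k + 1) i \<in> Der_R W t" unfolding k by (rule U_nonpos_Der_R)
  ultimately show ?thesis using nab_inv_mem by simp
qed

lemma nab_U: "nab (U k i) = U (k + 1) i"
proof (cases "k \<ge> 0")
  case True
  then show ?thesis by (simp add: U_plus)
next
  case False
  have k: "k + 1 = - int (nat (- k - 1))" using False by simp
  have "U ((k + 1) - 1) i = nab_inv (U (k + 1) i)" using False by (intro U_minus) simp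
  moreover have "U (k + 1) i \<in> Der_R W t" unfolding k by (rule U_nonpos_Der_R)
  ultimately show ?thesis using nab_nab_inv by simp
qed

lemma nab_M_U: "nab (\<Sum>j\<in>UNIV. M i j *s U k j) = U k i + (\<Sum>j\<in>UNIV. M i j *s U (k + 1) j)"
proof -
  have "nab (M i j *s U k j) = (if i = j then U k j else 0) + M i j *s U (k + 1) j" for j
    by (simp add: nabla_smult D_M nab_U)
  then show ?thesis by (simp add: nabla_sum sum.distrib)
qed

text \<open>At 0 this is the flat identity for the inverse of the connection. Differentiating adds
  the term \<open>U k i\<close>, because \<open>D\<close> sends \<open>M\<close> to the identity,
  and this moves the constant by one.\<close>

lemma U_rec: "(\<Sum>j\<in>UNIV. M i j *s U k j) = const_F (- (B i + of_int k)) *s U (k - 1) i"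
proof (induction k rule: int_induct[where k = 0])
  case base
  have "U (0 - 1) i = nab_inv (pt i)" using U_minus[of 0 i] by (simp add: U_0)
  then have "const_F (- B i) *s U (- 1) i = (const_F (- B i) * const_F (- inverse (B i))) *s (\<Sum>j\<in>UNIV. M i j *s pt j)"
    by (simp add: flat_facts(7) vector_smult_assoc const_F_simps(3) vec_eq_iff)
  also have "const_F (- B i) * const_F (- inverse (B i)) = (1 :: 'n ratfun)"
  proof -
    have "(- B i) * (- inverse (B i)) = 1" using B_nz[of i] by simp
    then show ?thesis unfolding to_F_mult[symmetric] Cst_mult[symmetric] by (simp only: Cst_1 to_F_1)
  qed
  finally show ?case by (simp add: U_0)
next
  case (step1 k)
  have "nab (\<Sum>j\<in>UNIV. M i j *s U k j) = const_F (- (B i + of_int k)) *s U k i"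
    unfolding step1(2) nabla_const nab_U by simp
  then have "(\<Sum>j\<in>UNIV. M i j *s U (k + 1) j) = const_F (- (B i + of_int k)) *s U k i - U k i"
    unfolding nab_M_U by (simp add: algebra_simps)
  also have "\<dots> = const_F (- (B i + of_int k) - 1) *s U k i"
    by (rule smult_minus_self)
  also have "- (B i + of_int k) - 1 = - (B i + of_int (k + 1))" by simp
  finally show ?case by simp
next
  case (step2 k)
  \<comment> \<open>Downwards the identity is first obtained after applying \<open>nab\<close>; this
    can be undone because both sides lie in \<open>Der_R_log\<close>, where \<open>nab\<close> is
    injective.\<close>
  have log: "U (k - 1) j \<in> Der_R_log W \<alpha> t" "U (k - 1 - 1) j \<in> Der_R_log W \<alpha> t" for j
    using step2(1) by (intro U_neg_Der_R_log; simp)+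
  define y where "y = (\<Sum>j\<in>UNIV. M i j *s U (k - 1) j)"
  have y: "y \<in> Der_R_log W \<alpha> t"
    unfolding y_def by (intro submod_sum[OF Der_R_log_submod] Der_R_log_smult M_R log)
  have "nab y = U (k - 1) i + const_F (- (B i + of_int k)) *s U (k - 1) i"
    using nab_M_U[of i "k - 1"] step2(2) by (simp add: y_def)
  also have "\<dots> = const_F (- (B i + of_int k) + 1) *s U (k - 1) i"
    by (rule smult_plus_self)
  also have "- (B i + of_int k) + 1 = - (B i + of_int (k - 1))" by simp
  also have "const_F (- (B i + of_int (k - 1))) *s U (k - 1) i = nab (const_F (- (B i + of_int (k - 1))) *s U (k - 1 - 1) i)"
    unfolding nabla_const nab_U by simp
  finally have "nab_inv (nab (const_F (- (B i + of_int (k - 1))) *s U (k - 1 - 1) i)) = y"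
    using y nab_inv_nab by metis
  then show ?case using nab_inv_nab[OF Der_R_log_smult[OF R_const log(2)]] y_def by simp
qed

text \<open>The shift by one comes from \<open>ee i\<close> being row \<open>i\<close> of
  \<open>M\<close> applied to the \<open>pt\<close>: by the recursion at 0 this is
  \<open>- B i\<close> times \<open>U (- 1) i\<close>.\<close>

lemma xi_eq: "xi W \<alpha> t \<eta> k (rev_idx i) = const_F (- B i) *s U (k - 1) i"
proof (induction k rule: int_induct[where k = 0])
  case base
  have "xi W \<alpha> t \<eta> 0 (rev_idx i) = ee i" by (simp add: xi_def ee_def)
  then show ?case using ee_eq[of i] U_rec[of i 0] by (simp add: U_0)
next
  case (step1 k)
  then have "xi W \<alpha> t \<eta> (k + 1) (rev_idx i) = nab (xi W \<alpha> t \<eta> k (rev_idx i))"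
    by (simp add: xi_def nat_add_distrib primitive_der_eq)
  then show ?case unfolding step1(2) nabla_const nab_U by simp
next
  case (step2 k)
  have "nat (- (k - 1)) = Suc (nat (- k))" using step2(1) by simp
  then have "xi W \<alpha> t \<eta> (k - 1) (rev_idx i) = nab_inv (xi W \<alpha> t \<eta> k (rev_idx i))"
    using step2(1) by (cases "k = 0") (simp_all add: xi_def)
  also have "\<dots> = const_F (- B i) *s U (k - 1 - 1) i"
  proof (rule nab_inv_eqI)
    show "const_F (- B i) *s U (k - 1 - 1) i \<in> Der_R_log W \<alpha> t"
      using step2(1) by (intro Der_R_log_smult R_const U_neg_Der_R_log) simp
    show "nab (const_F (- B i) *s U (k - 1 - 1) i) = xi W \<alpha> t \<eta> k (rev_idx i)"
      unfolding step2(2) nabla_const nab_U by simp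
  qed
  finally show ?case .
qed

lemma Xi_eq: "Xi W \<alpha> t \<eta> k = (\<lambda>i. const_F (- B i) *s U (k - 1) i) ` UNIV"
  unfolding Xi_def rev_idx_image[where 'n = 'n, symmetric] image_image xi_eq ..

lemma det_U_rec:
  "det (columns_mat (U k)) * det (J ** columns_mat ee) =
    const_F (\<Prod>i\<in>UNIV. - (B i + of_int k)) * det (columns_mat (U (k - 1)))"
proof -
  define X :: "'n fmat" where "X = (\<chi> i j. if i = j then const_F (- (B i + of_int k)) else 0)"
  have dX: "det X = const_F (\<Prod>i\<in>UNIV. - (B i + of_int k))"
    by (subst det_diagonal) (simp_all add: X_def Cst_prod to_F_prod)
  have "(\<Sum>j\<in>UNIV. M i j * U k j $ l) = const_F (- (B i + of_int k)) * U (k - 1) i $ l" for i l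
    using arg_cong[OF U_rec[of i k], of "\<lambda>v. v $ l"] by (simp add: sum_component)
  then have "(columns_mat (U k) ** (J ** columns_mat ee)) $ l $ i = (columns_mat (U (k - 1)) ** X) $ l $ i" for l i
    by (simp add: matrix_matrix_mult_def[of "columns_mat (U k)"] matrix_matrix_mult_def[of "columns_mat (U (k - 1))"]
      jacobian_mult_columns X_def M_def mult.commute if_distrib[of "\<lambda>x. _ * x"] if_distrib[of "\<lambda>x. x * _"] cong: if_cong)
  then have "columns_mat (U k) ** (J ** columns_mat ee) = columns_mat (U (k - 1)) ** X"
    by (simp add: vec_eq_iff)
  from arg_cong[OF this, of det] show ?thesis by (simp only: det_mul dX mult.commute)
qed

lemma const_F_cancel:
  fixes a b :: "'n ratfun"
  assumes "x \<noteq> 0" "const_F x * a = b" shows "a = const_F (inverse x) * b"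
proof -
  have "inverse x * x = 1" using assms(1) by simp
  then have "const_F (inverse x) * const_F x = (1 :: 'n ratfun)"
    unfolding to_F_mult[symmetric] Cst_mult[symmetric] by (simp only: Cst_1 to_F_1)
  then have "const_F (inverse x) * (const_F x * a) = a" by (simp only: mult.assoc[symmetric] mult_1)
  then show ?thesis using assms(2) by simp
qed

text \<open>At 0 the matrix is the inverse Jacobian, which explains the exponent
  \<open>1 - ord H\<close>; each step multiplies or divides by the discriminant, up to constants
  that are nonzero by \<open>B_plus_nz\<close>.\<close>

lemma det_U: "\<exists>x. x \<noteq> 0 \<and> det (columns_mat (U k)) = const_F x * Qpow (\<lambda>H. 1 - (k + 1) * int (ord H))"
proof (induction k rule: int_induct[where k = 0])
  case base
  obtain x y where x: "det J = const_F x * Qpow (\<lambda>H. int (ord H) - 1)" "x \<noteq> 0"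
    by (rule det_J_det_th) blast
  have "J ** columns_mat (U 0) = mat 1"
    by (simp add: vec_eq_iff jacobian_mult_columns U_0 pt_tt mat_def)
  then have "det J * det (columns_mat (U 0)) = 1" by (metis det_I det_mul)
  then have "const_F x * (Qpow (\<lambda>H. int (ord H) - 1) * det (columns_mat (U 0))) = 1" by (simp add: x mult.assoc)
  from const_F_cancel[OF x(2) this]
  have 1: "Qpow (\<lambda>H. int (ord H) - 1) * det (columns_mat (U 0)) = const_F (inverse x)" by simp
  have "det (columns_mat (U 0)) = inverse (Qpow (\<lambda>H. int (ord H) - 1)) * (Qpow (\<lambda>H. int (ord H) - 1) * det (columns_mat (U 0)))"
    using Qpow_nz by simp
  then have "det (columns_mat (U 0)) = const_F (inverse x) * Qpow (\<lambda>H. 1 - (0 + 1) * int (ord H))"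
    unfolding 1 by (simp add: Qpow_inverse mult.commute)
  then show ?case using x(2) by (intro exI[of _ "inverse x"]) simp
next
  case (step1 k)
  then obtain x where x: "x \<noteq> 0" "det (columns_mat (U k)) = const_F x * Qpow (\<lambda>H. 1 - (k + 1) * int (ord H))" by blast
  obtain m where m: "det (J ** columns_mat ee) = const_F m * Qpow (\<lambda>H. int (ord H))" "m \<noteq> 0" by (rule det_M)
  define b where "b = (\<Prod>i\<in>UNIV. - (B i + of_int (k + 1)))"
  have b: "b \<noteq> 0"
    unfolding b_def prod_zero_iff[OF finite_class.finite_UNIV] neg_equal_0_iff_equal using B_plus_nz by blast
  have "const_F m * (Qpow (\<lambda>H. int (ord H)) * det (columns_mat (U (k + 1)))) =
      const_F (b * x) * Qpow (\<lambda>H. 1 - (k + 1) * int (ord H))"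
    using det_U_rec[of "k + 1"] unfolding m(1) b_def[symmetric]
    by (simp add: x(2) Cst_mult to_F_mult mult_ac)
  from const_F_cancel[OF m(2) this]
  have "Qpow (\<lambda>H. int (ord H)) * det (columns_mat (U (k + 1))) =
      const_F (inverse m * (b * x)) * Qpow (\<lambda>H. 1 - (k + 1) * int (ord H))"
    by (simp add: Cst_mult to_F_mult mult_ac)
  then have "Qpow (\<lambda>H. - int (ord H)) * (Qpow (\<lambda>H. int (ord H)) * det (columns_mat (U (k + 1)))) =
      const_F (inverse m * (b * x)) * (Qpow (\<lambda>H. - int (ord H)) * Qpow (\<lambda>H. 1 - (k + 1) * int (ord H)))"
    by (simp only: mult.left_commute)
  moreover have "Qpow (\<lambda>H. - int (ord H)) * (Qpow (\<lambda>H. int (ord H)) * f) = f" for f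
    using Qpow_nz by (simp add: mult.assoc[symmetric] flip: Qpow_inverse)
  moreover have "(\<lambda>H. - int (ord H) + (1 - (k + 1) * int (ord H))) = (\<lambda>H. 1 - (k + 1 + 1) * int (ord H))"
    by (simp add: algebra_simps)
  ultimately have "det (columns_mat (U (k + 1))) = const_F (inverse m * (b * x)) * Qpow (\<lambda>H. 1 - (k + 1 + 1) * int (ord H))"
    unfolding Qpow_mult by simp
  then show ?case using b x(1) m(2) by (intro exI[of _ "inverse m * (b * x)"]) simp
next
  case (step2 k)
  then obtain x where x: "x \<noteq> 0" "det (columns_mat (U k)) = const_F x * Qpow (\<lambda>H. 1 - (k + 1) * int (ord H))" by blast
  obtain m where m: "det (J ** columns_mat ee) = const_F m * Qpow (\<lambda>H. int (ord H))" "m \<noteq> 0" by (rule det_M)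
  define b where "b = (\<Prod>i\<in>UNIV. - (B i + of_int k))"
  have b: "b \<noteq> 0"
    unfolding b_def prod_zero_iff[OF finite_class.finite_UNIV] neg_equal_0_iff_equal using B_plus_nz by blast
  have "const_F b * det (columns_mat (U (k - 1))) =
      const_F (x * m) * (Qpow (\<lambda>H. 1 - (k + 1) * int (ord H)) * Qpow (\<lambda>H. int (ord H)))"
    using det_U_rec[of k] unfolding m(1) b_def[symmetric] x(2) by (simp add: Cst_mult to_F_mult mult_ac)
  moreover have "(\<lambda>H. 1 - (k + 1) * int (ord H) + int (ord H)) = (\<lambda>H. 1 - (k - 1 + 1) * int (ord H))"
    by (simp add: algebra_simps)
  ultimately have "const_F b * det (columns_mat (U (k - 1))) =
      const_F (x * m) * Qpow (\<lambda>H. 1 - (k - 1 + 1) * int (ord H))"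
    unfolding Qpow_mult by (simp only:)
  from const_F_cancel[OF b this]
  have "det (columns_mat (U (k - 1))) = const_F (inverse b * (x * m)) * Qpow (\<lambda>H. 1 - (k - 1 + 1) * int (ord H))"
    by (simp only: Cst_mult to_F_mult mult.assoc)
  then show ?case using b x(1) m(2) by (intro exI[of _ "inverse b * (x * m)"]) simp
qed

end

section \<open>Membership in the logarithmic modules\<close>

lemma (in linear_form) locl_0: "locl 0 m"
  using loc_ring(2) lo_zero by (simp add: locl_def)

lemma (in linear_form) locl_add: "locl \<theta> m \<Longrightarrow> locl \<theta>' m \<Longrightarrow> locl (\<theta> + \<theta>') m"
  by (auto simp: locl_def der_app_vec_add intro: loc_ring lo_add)

lemma (in linear_form) locl_smult: "x \<in> loc \<Longrightarrow> locl \<theta> m \<Longrightarrow> locl (x *s \<theta>) m"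
  by (auto simp: locl_def der_app_smult intro: loc_ring lo_mult_loc)

lemma (in linear_form) locl_mono: "locl \<theta> n \<Longrightarrow> m \<le> n \<Longrightarrow> locl \<theta> m"
  by (auto simp: locl_def intro: lo_mono)

context reflection_setup begin

lemma W_inv_derI:
  assumes "\<And>g i. g \<in> W \<Longrightarrow> act_F g (\<theta> $ i) = der_app \<theta> (act_F g (to_F (Var i)))"
  shows "W_inv_der \<theta>"
  unfolding W_inv_der_def
proof (intro ballI allI)
  fix g f assume g: "g \<in> W"
  let ?\<phi> = "act_F g"
  have fh: "field_hom ?\<phi>" using field_hom_act_F W_invertible g by blast
  note td = twisted_derivation_commutator[OF W_invertible[OF g], of \<theta>]
  have "?\<phi> (der_app \<theta> f) - der_app \<theta> (?\<phi> f) = 0"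
    unfolding twisted_derivation_chain[OF fh td, of f] by (simp add: assms[OF g])
  then show "?\<phi> (der_app \<theta> f) = der_app \<theta> (?\<phi> f)" by simp
qed

text \<open>\<open>nabla\<close> acts on coefficients, which on linear forms amounts to composing
  the two derivations. Group elements send variables to linear forms, so testing invariance on the
  variables stays within this case.\<close>

lemma W_inv_der_nabla:
  assumes \<delta>: "W_inv_der \<delta>" and \<theta>: "W_inv_der \<theta>" shows "W_inv_der (nabla \<delta> \<theta>)"
proof (rule W_inv_derI)
  fix g i assume g: "g \<in> W"
  have v: "act_F g (to_F (Var i)) = to_F (lin_form (matrix_inv g $ i))"
    by (simp add: act_F_to_F[OF W_invertible[OF g]]) (simp add: act_def)
  have "act_F g (nabla \<delta> \<theta> $ i) = act_F g (der_app \<delta> (der_app \<theta> (to_F (Var i))))" by (simp add: nabla_def)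
  also have "\<dots> = der_app \<delta> (der_app \<theta> (act_F g (to_F (Var i))))"
  proof -
    have "act_F g (der_app \<delta> x) = der_app \<delta> (act_F g x)" "act_F g (der_app \<theta> x) = der_app \<theta> (act_F g x)" for x
      using \<delta> \<theta> g unfolding W_inv_der_def by blast+
    then show ?thesis by (simp only:)
  qed
  also have "\<dots> = der_app (nabla \<delta> \<theta>) (act_F g (to_F (Var i)))"
    unfolding v der_app_nabla_lin_form ..
  finally show "act_F g (nabla \<delta> \<theta> $ i) = der_app (nabla \<delta> \<theta>) (act_F g (to_F (Var i)))" .
qed

lemma S'_der_app: "(\<And>i. \<theta> $ i \<in> S') \<Longrightarrow> f \<in> S' \<Longrightarrow> der_app \<theta> f \<in> S'"
  unfolding der_app_def by (intro is_subring_sum[OF S'_subring] is_subringD(4)[OF S'_subring] S'_pdiff)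

lemma log_ders_inf_iff:
  "\<theta> \<in> log_ders_inf W I \<alpha> \<longleftrightarrow> (\<forall>i. \<theta> $ i \<in> S') \<and>
    (\<forall>H\<in>\<A>. \<forall>b. pairing b (normal H) = 0 \<longrightarrow> der_app \<theta> (to_F (lin_form b)) \<in> loc_at (\<alpha> H))"
  unfolding log_ders_inf_def Der_S'_def S'_iff dual_form_eq_0_iff by blast

lemma log_ders_iff:
  "\<theta> \<in> log_ders W I \<alpha> \<nu> \<longleftrightarrow>
    (\<forall>i. \<theta> $ i \<in> S') \<and> (\<forall>H\<in>\<A>. linear_form.locl (\<alpha> H) (normal H) \<theta> (\<nu> H))"
proof -
  have "(\<lambda>s. to_F (lin_form (\<alpha> H)) powi \<nu> H * s) ` loc_at (\<alpha> H) = linear_form.lo (\<alpha> H) (\<nu> H)" if "H \<in> \<A>" for H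
    by (rule linear_form.lo_eq_image[OF linear_form_H[OF that]])
  moreover have "linear_form.locl (\<alpha> H) (normal H) \<theta> m \<longleftrightarrow>
      (\<forall>b. pairing b (normal H) = 0 \<longrightarrow> der_app \<theta> (to_F (lin_form b)) \<in> loc_at (\<alpha> H)) \<and>
      der_app \<theta> (to_F (lin_form (\<alpha> H))) \<in> linear_form.lo (\<alpha> H) m" if "H \<in> \<A>" for H m
    by (rule linear_form.locl_def[OF linear_form_H[OF that]])
  ultimately show ?thesis unfolding log_ders_def log_ders_inf_iff mem_Collect_eq by blast
qed

lemma submod_log_ders: "submod (range to_F) (log_ders W I \<alpha> \<nu>)"
  unfolding submod_def
proof (intro conjI ballI)
  show "0 \<in> log_ders W I \<alpha> \<nu>"
    unfolding log_ders_iff using is_subringD(2)[OF S'_subring] linear_form.locl_0[OF linear_form_H] by simp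
next
  fix x y assume "x \<in> log_ders W I \<alpha> \<nu>" "y \<in> log_ders W I \<alpha> \<nu>"
  then show "x + y \<in> log_ders W I \<alpha> \<nu>"
    unfolding log_ders_iff using is_subringD(6)[OF S'_subring] linear_form.locl_add[OF linear_form_H] by simp
next
  fix a :: "'n ratfun" and x assume "a \<in> range to_F" "x \<in> log_ders W I \<alpha> \<nu>"
  then show "a *s x \<in> log_ders W I \<alpha> \<nu>"
    unfolding log_ders_iff
    using is_subringD(4)[OF S'_subring range_to_F_S'] linear_form.locl_smult[OF linear_form_H] linear_form.loc_to_F[OF linear_form_H]
    by auto
qed

lemma submod_log_ders_inf: "submod (range to_F) (log_ders_inf W I \<alpha>)"
  unfolding submod_def
proof (intro conjI ballI)
  show "0 \<in> log_ders_inf W I \<alpha>"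
    unfolding log_ders_inf_iff using is_subringD(2)[OF S'_subring] linear_form.loc_ring(2)[OF linear_form_H] by simp
next
  fix x y assume "x \<in> log_ders_inf W I \<alpha>" "y \<in> log_ders_inf W I \<alpha>"
  then show "x + y \<in> log_ders_inf W I \<alpha>"
    unfolding log_ders_inf_iff der_app_vec_add
    using is_subringD(6)[OF S'_subring] linear_form.loc_ring(6)[OF linear_form_H] by simp
next
  fix a :: "'n ratfun" and x assume "a \<in> range to_F" "x \<in> log_ders_inf W I \<alpha>"
  then show "a *s x \<in> log_ders_inf W I \<alpha>"
    unfolding log_ders_inf_iff der_app_smult
    using is_subringD(4)[OF S'_subring range_to_F_S'] linear_form.loc_ring(4)[OF linear_form_H] linear_form.loc_to_F[OF linear_form_H]
    by auto
qed

lemma log_ders_mono: "(\<And>H. H \<in> \<A> \<Longrightarrow> \<mu> H \<le> \<nu> H) \<Longrightarrow> \<theta> \<in> log_ders W I \<alpha> \<nu> \<Longrightarrow> \<theta> \<in> log_ders W I \<alpha> \<mu>"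
  unfolding log_ders_iff using linear_form.locl_mono[OF linear_form_H] by blast

lemma log_ders_sub_inf: "log_ders W I \<alpha> \<nu> \<subseteq> log_ders_inf W I \<alpha>"
  by (auto simp: log_ders_def)

lemma log_ders_inf_bounded_pole:
  assumes \<theta>: "\<theta> \<in> log_ders_inf W I \<alpha>"
  obtains k :: nat where "\<theta> \<in> log_ders W I \<alpha> (\<lambda>H. - int k * int (ord H) + 1)"
proof -
  have S': "\<theta> $ i \<in> S'" for i using \<theta> by (simp add: log_ders_inf_iff)
  have "\<forall>H\<in>\<A>. \<exists>n::nat. der_app \<theta> (to_F (lin_form (\<alpha> H))) \<in> linear_form.lo (\<alpha> H) (- int n)"
  proof
    fix H assume H: "H \<in> \<A>"
    interpret linear_form "\<alpha> H" "normal H" by (rule linear_form_H[OF H])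
    have "der_app \<theta> \<pi> \<in> S'" using S' S'_to_F by (rule S'_der_app)
    then obtain n p where n: "Qpow (\<lambda>H. int n) * der_app \<theta> \<pi> = to_F p" by (auto simp: S'_def)
    have "der_app \<theta> \<pi> = to_F p / Qpow (\<lambda>H. int n)"
      by (rule eq_divide_imp[OF Qpow_nz]) (simp only: n[symmetric] mult.commute)
    also have "\<dots> = to_F p * Qpow (\<lambda>H. - int n)" by (simp only: divide_inverse Qpow_inverse)
    also have "\<dots> \<in> lo (- int n)" using Qpow_lo[OF H] by (intro lo_mult_loc) simp_all
    finally show "\<exists>n::nat. der_app \<theta> \<pi> \<in> lo (- int n)" by blast
  qed
  from bchoice[OF this] obtain n :: "'n cvec set \<Rightarrow> nat"
    where n: "\<forall>H\<in>\<A>. der_app \<theta> (to_F (lin_form (\<alpha> H))) \<in> linear_form.lo (\<alpha> H) (- int (n H))" by blast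
  \<comment> \<open>Adding 1 makes up for the summand 1 in the multiplicity; as \<open>ord H\<close>
    is at least 1, \<open>- k * ord H + 1\<close> is at most \<open>- n H\<close> for every
    \<open>H\<close>.\<close>
  define k where "k = sum n \<A> + 1"
  have "linear_form.locl (\<alpha> H) (normal H) \<theta> (- int k * int (ord H) + 1)" if H: "H \<in> \<A>" for H
  proof -
    interpret linear_form "\<alpha> H" "normal H" by (rule linear_form_H[OF H])
    have "n H \<le> sum n \<A>" using finite_arrangement H by (intro member_le_sum) auto
    then have "n H + 1 \<le> k" by (simp add: k_def)
    then have "int (n H) + 1 \<le> int k" by linarith
    also have "int k * 1 \<le> int k * int (ord H)" using ord_ge_2[OF H] by (intro mult_left_mono) auto
    finally have "- int k * int (ord H) + 1 \<le> - int (n H)" by simp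
    then have "der_app \<theta> \<pi> \<in> lo (- int k * int (ord H) + 1)" using n H lo_mono by blast
    then show ?thesis using \<theta> H by (simp add: locl_def log_ders_inf_iff)
  qed
  then show thesis using S' that[of k] by (simp add: log_ders_iff)
qed

end

context flat_setup begin

lemma D_W_inv: "W_inv_der D" by (rule pt_W_inv)

lemma U_W_inv: "W_inv_der (U k i)"
proof (cases "k \<ge> 0")
  case True
  then show ?thesis
  proof (induction k rule: int_ge_induct)
    case base
    show ?case by (simp add: U_0 pt_W_inv)
  next
    case (step k)
    then show ?case using W_inv_der_nabla[OF D_W_inv] by (simp add: U_plus)
  qed
next
  case False
  then show ?thesis by (intro Der_R_W_inv Der_R_log_sub U_neg_Der_R_log) simp
qed

lemma inverse_det_J_S': "inverse (det J) \<in> S'"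
proof -
  obtain x y where x: "det J = const_F x * Qpow (\<lambda>H. int (ord H) - 1)" "x \<noteq> 0"
    by (rule det_J_det_th) blast
  have "inverse (det J) = const_F (inverse x) * Qpow (\<lambda>H. - (int (ord H) - 1))"
    unfolding x(1) by (simp add: const_F_inverse Qpow_inverse del: minus_diff_eq)
  then show ?thesis using is_subringD(4)[OF S'_subring S'_to_F Qpow_in_S'] by simp
qed

lemma pt_S': "pt i $ j \<in> S'"
proof (rule is_subring_cramer[OF S'_subring _ inverse_det_J_S' det_J_nz])
  show "J $ m $ l \<in> S'" for m l by (rule range_to_F_S'[OF pdiff_tt_S])
  show "(J *v pt i) $ m \<in> S'" for m
    unfolding jacobian_mult_vec pt_tt using is_subringD(1,2)[OF S'_subring] by simp
qed

lemma U_S': "U k i $ j \<in> S'"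
proof (cases "k \<ge> 0")
  case True
  then show ?thesis
  proof (induction k arbitrary: j rule: int_ge_induct)
    case base
    show ?case by (simp add: U_0 pt_S')
  next
    case (step k)
    then show ?case by (simp add: U_plus nabla_def S'_der_app[OF pt_S'])
  qed
next
  case False
  then show ?thesis by (intro range_to_F_S' Der_R_log_S U_neg_Der_R_log) simp
qed

text \<open>At 0 the bound comes from the Jacobian, whose order is known exactly. Positive
  \<open>k\<close> are reached by \<open>nabla_locl\<close>; negative \<open>k\<close>, where the
  derivations are polynomial, by \<open>lower_pole\<close>, which requires the pole of
  \<open>D\<close> to have its full order.\<close>

lemma U_locl:
  assumes H: "H \<in> \<A>" shows "linear_form.locl (\<alpha> H) (normal H) (U k i) (1 - (k + 1) * int (ord H))"
proof -
  obtain s \<zeta> where s: "s \<in> W" "local_reflection (\<alpha> H) (normal H) s \<zeta> (ord H)"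
    by (rule local_reflection_exists[OF H])
  interpret local_reflection "\<alpha> H" "normal H" s \<zeta> "ord H" by (rule s(2))
  have s_inv: "s_inv \<theta>" if "W_inv_der \<theta>" for \<theta> using that s(1) by (simp add: s_inv_def W_inv_der_def)
  have pt: "locl (pt m) (1 - int (ord H))" for m
  proof (rule jacobian_lo(2))
    show "tt m \<in> loc" for m by (rule R_loc[OF R_tt H])
    show "act_s (tt m) = tt m" for m using R_tt[of m] s(1) unfolding R_iff by blast
    show "det J \<noteq> 0" by (rule det_J_nz)
    show "der_app (pt m) (tt j) \<in> loc" for j using loc_ring(1,2) by (simp add: pt_tt)
    obtain x y where x: "det J = const_F x * Qpow (\<lambda>H. int (ord H) - 1)" "x \<noteq> 0"
      by (rule det_J_det_th) blast
    obtain u where u: "Qpow (\<lambda>H. int (ord H) - 1) = \<pi> powi (int (ord H) - 1) * u" "inverse u \<in> loc"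
      by (rule Qpow_split[OF H, of "\<lambda>H. int (ord H) - 1"]) blast
    have "\<pi> powi (1 - int (ord H)) * det J = const_F x * (\<pi> powi (1 - int (ord H)) * (\<pi> powi (int (ord H) - 1) * u))"
      unfolding x(1) u(1) by (rule mult.left_commute)
    also have "\<dots> = const_F x * u" unfolding powi_cancel by simp
    finally have "inverse (\<pi> powi (1 - int (ord H)) * det J) = const_F (inverse x) * inverse u"
      by (simp add: const_F_inverse)
    then show "inverse (\<pi> powi (1 - int (ord H)) * det J) \<in> loc" using loc_ring(4)[OF loc_to_F u(2)] by simp
  qed
  have unit: "\<pi> powi (int (ord H) - 1) * der_app D \<pi> \<notin> lo 1"
  proof
    assume "\<pi> powi (int (ord H) - 1) * der_app D \<pi> \<in> lo 1"
    \<comment> \<open>\<open>D\<close> would have normal order 1, and one derivative would leave the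
      order \<open>1 - ord H\<close> of the \<open>pt i\<close> unchanged, whereas the determinant
      of \<open>U 1\<close> has order \<open>1 - 2 * ord H\<close>.\<close>
    then have D1: "locl D 1" by (rule locl_1_if_not_unit[OF s_inv[OF D_W_inv] pt])
    have "locl (U 1 i) (1 - int (ord H))" for i
    proof -
      have "locl (pt i) (1 + (- 1) * int (ord H))" using pt[of i] by simp
      then have "locl (nab (pt i)) (1 + (- 1) * int (ord H))"
        using s_inv[OF pt_W_inv] D1 e_ge_2 by (intro nabla_locl) auto
      then show ?thesis using U_plus[of 0 i] by (simp add: U_0)
    qed
    then have "det (columns_mat (U 1)) \<in> lo (1 - int (ord H))" by (rule det_locl)
    moreover obtain x where x: "x \<noteq> 0" "det (columns_mat (U 1)) = const_F x * Qpow (\<lambda>H. 1 - (1 + 1) * int (ord H))"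
      using det_U[of 1] by blast
    ultimately have "const_F (inverse x) * (const_F x * Qpow (\<lambda>H. 1 - (1 + 1) * int (ord H))) \<in> lo (1 - int (ord H))"
      by (simp only: lo_mult_loc[OF loc_to_F])
    then have "Qpow (\<lambda>H. 1 - (1 + 1) * int (ord H)) \<in> lo (1 - int (ord H))"
      by (simp only: const_F_cancel[OF x(1) refl, symmetric])
    then show False using Qpow_lo[OF H] e_ge_2 by simp
  qed
  show ?thesis
  proof (cases "k \<ge> 0")
    case True
    then show ?thesis
    proof (induction k rule: int_ge_induct)
      case base
      show ?case using pt by (simp add: U_0)
    next
      case (step k)
      have "locl (U k i) (1 + (- (k + 1)) * int (ord H))" using step.IH by (simp add: algebra_simps)
      then have "locl (nab (U k i)) ((1 - int (ord H)) + (- (k + 1)) * int (ord H))"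
        using s_inv[OF U_W_inv] pt[of last_ix] by (intro nabla_locl) auto
      then show ?case unfolding U_plus[OF step.hyps] by (simp add: algebra_simps)
    qed
  next
    case False
    have "U (- int n - 1) i \<in> Der_R_log W \<alpha> t" for n by (rule U_neg_Der_R_log) simp
    then have S: "U (- int n - 1) i $ j \<in> range to_F" for n j by (rule Der_R_log_S)
    have "der_app (U (- int n - 1) i) \<pi> \<in> lo (1 + int n * int (ord H))" for n
    proof (induction n)
      case 0
      show ?case using W_inv_polynomial_lo[OF H S[of 0] U_W_inv] by simp
    next
      case (Suc n)
      have "der_app D (der_app (U (- int (Suc n) - 1) i) \<pi>) = der_app (nab (U (- int (Suc n) - 1) i)) \<pi>"
        by (rule der_app_nabla_lin_form[symmetric])
      also have "nab (U (- int (Suc n) - 1) i) = U (- int n - 1) i"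
        unfolding nab_U by (rule arg_cong[of _ _ "\<lambda>k. U k i"]) simp
      finally have "der_app D (der_app (U (- int (Suc n) - 1) i) \<pi>) \<in> lo (1 + int n * int (ord H))" using Suc by simp
      then have "der_app (U (- int (Suc n) - 1) i) \<pi> \<in> lo (1 + (int n + 1) * int (ord H))"
        using s_inv[OF D_W_inv] pt[of last_ix] unit s_inv[OF U_W_inv] W_inv_polynomial_lo[OF H S U_W_inv, of "Suc n"]
        by (intro lower_pole)
      moreover have "int n + 1 = int (Suc n)" by simp
      ultimately show ?case by (simp only:)
    qed
    from this[of "nat (- k - 1)"] S[of "nat (- k - 1)"] show ?thesis
      using False by (intro der_S_locl[OF H]) (simp_all add: algebra_simps)
  qed
qed

lemma U_log_ders: "U (k - 1) i \<in> log_ders W I \<alpha> (\<lambda>H. - k * int (ord H) + 1)"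
proof -
  have "linear_form.locl (\<alpha> H) (normal H) (U (k - 1) i) (- k * int (ord H) + 1)" if "H \<in> \<A>" for H
    using U_locl[OF that, of "k - 1" i] by (simp add: algebra_simps)
  then show ?thesis using U_S' by (simp add: log_ders_iff)
qed

end

section \<open>Freeness\<close>

context flat_setup begin

abbreviation LD :: "int \<Rightarrow> 'n der set" where
  "LD k \<equiv> log_ders W I \<alpha> (\<lambda>H. - k * int (order_mult W H) + 1)"

lemma sum_smult_eq_columns: "(\<Sum>i\<in>UNIV. c i *s V i) = columns_mat V *v (\<chi> i. c i)"
  by (simp add: vec_eq_iff matrix_vector_mult_def sum_component mult.commute)

lemma det_U_nz: "det (columns_mat (U k)) \<noteq> 0"
proof -
  obtain x where "x \<noteq> 0" "det (columns_mat (U k)) = const_F x * Qpow (\<lambda>H. 1 - (k + 1) * int (ord H))"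
    using det_U[of k] by blast
  then show ?thesis using Qpow_nz by simp
qed

lemma U_indep: assumes "(\<Sum>i\<in>UNIV. c i *s U k i) = 0" shows "c i = 0"
proof -
  obtain K where K: "K ** columns_mat (U k) = mat 1"
    using det_U_nz[of k] invertible_det_nz[of "columns_mat (U k)"] by (auto simp: invertible_def)
  have "columns_mat (U k) *v (\<chi> i. c i) = 0" using assms unfolding sum_smult_eq_columns .
  then have "K *v (columns_mat (U k) *v (\<chi> i. c i)) = 0" by simp
  then have "(\<chi> i. c i) = 0" unfolding matrix_vector_mul_assoc K by simp
  then show ?thesis by (simp add: vec_eq_iff)
qed

text \<open>A Saito-type argument: each coefficient is a quotient of determinants. Replacing one
  column by \<open>\<theta>\<close> keeps all columns in the same logarithmic module, so at every
  hyperplane the numerator has at least the order of the denominator.\<close>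

lemma LD_span_S:
  assumes \<theta>: "\<theta> \<in> LD k"
  shows "\<exists>c. (\<forall>i. c i \<in> range to_F) \<and> \<theta> = (\<Sum>i\<in>UNIV. c i *s U (k - 1) i)"
proof -
  define X where "X = columns_mat (U (k - 1))"
  obtain K where K: "X ** K = mat 1"
    using det_U_nz[of "k - 1"] invertible_det_nz[of X] by (auto simp: invertible_def X_def)
  define c where "c = K *v \<theta>"
  have Xc: "X *v c = \<theta>" by (simp add: c_def matrix_vector_mul_assoc K)
  obtain x where x: "x \<noteq> 0" "det X = const_F x * Qpow (\<lambda>H. 1 - k * int (ord H))"
    using det_U[of "k - 1"] by (auto simp: X_def)
  have "c $ j \<in> range to_F" for j
  proof -
    define V where "V i = (if i = j then \<theta> else U (k - 1) i)" for i
    have V: "V i \<in> LD k" for i using \<theta> U_log_ders by (simp add: V_def)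
    have "c $ j * det X = det (\<chi> m l. if l = j then (X *v c) $ m else X $ m $ l)" by (simp only: cramer_lemma)
    also have "(\<chi> m l. if l = j then (X *v c) $ m else X $ m $ l) = columns_mat V"
      unfolding Xc by (simp add: vec_eq_iff V_def X_def)
    finally have det: "c $ j * det X = det (columns_mat V)" .
    have "det (columns_mat V) \<in> linear_form.lo (\<alpha> H) (1 - k * int (ord H))" if H: "H \<in> \<A>" for H
    proof -
      interpret linear_form "\<alpha> H" "normal H" by (rule linear_form_H[OF H])
      have "locl (V i) (1 - k * int (ord H))" for i using V[of i] H unfolding log_ders_iff by (simp add: algebra_simps)
      then show ?thesis by (rule det_locl)
    qed
    moreover have "det (columns_mat V) \<in> S'"
      using V by (intro is_subring_det[OF S'_subring]) (simp add: log_ders_iff)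
    ultimately obtain p where p: "det (columns_mat V) = Qpow (\<lambda>H. 1 - k * int (ord H)) * to_F p"
      using divide_Qpow[of _ "\<lambda>H. 1 - k * int (ord H)"] by blast
    have "Qpow (\<lambda>H. 1 - k * int (ord H)) * (const_F x * c $ j) = Qpow (\<lambda>H. 1 - k * int (ord H)) * to_F p"
      using det unfolding p x(2) by (simp only: mult_ac)
    then have "const_F x * c $ j = to_F p" using Qpow_nz by simp
    from const_F_cancel[OF x(1) this] show ?thesis unfolding to_F_mult[symmetric] by blast
  qed
  moreover have "\<theta> = (\<Sum>i\<in>UNIV. c $ i *s U (k - 1) i)"
    using Xc unfolding sum_smult_eq_columns X_def by (simp add: vec_lambda_eta)
  ultimately show ?thesis by (intro exI[of _ "\<lambda>i. c $ i"]) simp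
qed

text \<open>The \<open>U\<close> are invariant and independent over the fraction field, so applying
  a group element to the expansion must fix every coefficient.\<close>

lemma LD_inv_span_R:
  assumes \<theta>: "\<theta> \<in> invariant_ders W (LD k)"
  shows "\<exists>c. (\<forall>i. c i \<in> R) \<and> \<theta> = (\<Sum>i\<in>UNIV. c i *s U (k - 1) i)"
proof -
  have LD: "\<theta> \<in> LD k" and inv: "W_inv_der \<theta>" using \<theta> by (auto simp: invariant_ders_eq)
  from LD_span_S[OF LD] obtain c where c: "\<forall>i. c i \<in> range to_F" "\<theta> = (\<Sum>i\<in>UNIV. c i *s U (k - 1) i)" by blast
  have "act_F g (c i) = c i" if g: "g \<in> W" for g i
  proof -
    have fh: "field_hom (act_F g)" using field_hom_act_F W_invertible g by blast
    then have p: "act_F g (x * y) = act_F g x * act_F g y" for x y by (simp add: field_hom_def)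
    have Ug: "act_F g (der_app (U (k - 1) m) (tt j)) = der_app (U (k - 1) m) (tt j)" for m j
      using U_W_inv g unfolding W_inv_der_iff by blast
    have "(\<Sum>m\<in>UNIV. (act_F g (c m) - c m) *s U (k - 1) m) = 0"
    proof (rule der_ext)
      fix j
      have "act_F g (der_app \<theta> (tt j)) = der_app \<theta> (tt j)" using inv g unfolding W_inv_der_iff by blast
      then have "(\<Sum>m\<in>UNIV. act_F g (c m) * der_app (U (k - 1) m) (tt j)) = (\<Sum>m\<in>UNIV. c m * der_app (U (k - 1) m) (tt j))"
        unfolding c(2) der_app_vec_sum der_app_smult field_hom_sum[OF fh] p Ug .
      then show "der_app (\<Sum>m\<in>UNIV. (act_F g (c m) - c m) *s U (k - 1) m) (tt j) = der_app 0 (tt j)"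
        unfolding der_app_vec_sum der_app_smult left_diff_distrib sum_subtractf by simp
    qed
    from U_indep[OF this, of i] show ?thesis by simp
  qed
  then have "c i \<in> R" for i using c(1) unfolding R_iff by blast
  then show ?thesis using c(2) by blast
qed

lemma submod_subset: "submod A N \<Longrightarrow> A' \<subseteq> A \<Longrightarrow> submod A' N"
  unfolding submod_def by blast

lemma submod_invariant_ders:
  assumes "submod (range to_F) N" shows "submod R (invariant_ders W N)"
  unfolding submod_def
proof (intro conjI ballI)
  have N: "0 \<in> N" "\<And>x y. x \<in> N \<Longrightarrow> y \<in> N \<Longrightarrow> x + y \<in> N" "\<And>a x. a \<in> range to_F \<Longrightarrow> x \<in> N \<Longrightarrow> a *s x \<in> N"
    using assms by (auto simp: submod_def)
  have hom: "act_F g (x + y) = act_F g x + act_F g y" "act_F g (x * y) = act_F g x * act_F g y" "act_F g 0 = 0"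
    if "g \<in> W" for g x y
    using field_hom_act_F[OF W_invertible[OF that]] field_hom_0 unfolding field_hom_def by blast+
  show "0 \<in> invariant_ders W N" using N(1) hom by (simp add: invariant_ders_eq W_inv_der_def)
  show "x + y \<in> invariant_ders W N" if "x \<in> invariant_ders W N" "y \<in> invariant_ders W N" for x y
    using that N(2) hom by (simp add: invariant_ders_eq W_inv_der_iff der_app_vec_add)
  show "a *s x \<in> invariant_ders W N" if "a \<in> R" "x \<in> invariant_ders W N" for a x
    using that N(3) hom by (simp add: invariant_ders_eq W_inv_der_iff der_app_smult R_iff[unfolded mem_Collect_eq])
qed

lemma U_invariant_ders: "U (k - 1) i \<in> invariant_ders W (LD k)"
  using U_log_ders U_W_inv by (simp add: invariant_ders_eq)

lemma LD_mono: assumes "k \<le> k'" shows "invariant_ders W (LD k) \<subseteq> invariant_ders W (LD k')"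
proof -
  have le: "- k' * int (ord H) + 1 \<le> - k * int (ord H) + 1" for H using assms by (simp add: mult_right_mono)
  have "LD k \<subseteq> LD k'" by (intro subsetI log_ders_mono[OF le])
  then show ?thesis by (auto simp: invariant_ders_eq)
qed

lemma B_units:
  "const_F (- B i) \<in> T" "inverse (const_F (- B i)) \<in> T" "const_F (- B i) \<noteq> (0 :: 'n ratfun)"
  using T_const[of "- B i"] T_const[of "inverse (- B i)"] B_nz[of i] by (simp_all only: const_F_inverse) simp

lemma sum_extend:
  fixes c :: "'n \<Rightarrow> 'n ratfun"
  shows "(\<Sum>j\<in>X. c j *s V j) = (\<Sum>j\<in>UNIV. (if j \<in> X then c j else 0) *s V j)"
  by (rule sum.mono_neutral_cong_left) auto

lemma free_over_UNIV:
  assumes A: "is_subring A" "T \<subseteq> A" and N: "submod A N" "\<And>i. U (k - 1) i \<in> N"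
    and span: "\<And>x. x \<in> N \<Longrightarrow> \<exists>c. (\<forall>i. c i \<in> A) \<and> x = (\<Sum>i\<in>UNIV. c i *s U (k - 1) i)"
  shows "free_with_basis A N (Xi W \<alpha> t \<eta> k)"
  unfolding Xi_eq
proof (rule free_with_basis_familyI[OF A(1) N(1)])
  fix i
  show "const_F (- B i) \<in> A" "inverse (const_F (- B i)) \<in> A" "const_F (- B i) \<noteq> (0 :: 'n ratfun)"
    using B_units[of i] A(2) by blast+
  then show "const_F (- B i) *s U (k - 1) i \<in> N" using N unfolding submod_def by blast
next
  fix x assume "x \<in> N"
  from span[OF this] show "\<exists>J c. finite J \<and> J \<subseteq> UNIV \<and> (\<forall>j\<in>J. c j \<in> A) \<and> x = (\<Sum>j\<in>J. c j *s U (k - 1) j)"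
    by (intro exI[of _ UNIV]) auto
next
  fix X and c :: "'n \<Rightarrow> 'n ratfun"
  assume "(\<Sum>j\<in>X. c j *s U (k - 1) j) = 0"
  then have "(\<Sum>j\<in>UNIV. (if j \<in> X then c j else 0) *s U (k - 1) j) = 0" by (rule trans[OF sum_extend[symmetric]])
  from U_indep[OF this] have z: "(if j \<in> X then c j else 0) = 0" for j .
  show "\<forall>j\<in>X. c j = 0"
  proof
    fix j assume "j \<in> X"
    with z[of j] show "c j = 0" by simp
  qed
qed

lemma log_ders_free: "free_with_basis (range to_F) (LD k) (Xi W \<alpha> t \<eta> k)"
  using T_sub_R LD_span_S U_log_ders
  by (intro free_over_UNIV range_to_F_subring submod_log_ders) auto

lemma invariant_log_ders_free: "free_with_basis R (invariant_ders W (LD k)) (Xi W \<alpha> t \<eta> k)"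
  using T_sub_R LD_inv_span_R U_invariant_ders
  by (intro free_over_UNIV R_subring submod_invariant_ders submod_log_ders) auto

subsection \<open>Bases over \<open>T\<close>\<close>

text \<open>Indexing by pairs \<open>(p, i)\<close> instead of by vectors avoids having to know that
  the generators are distinct; \<open>U (p - 1) i\<close> is the element of \<open>Xi\<close> at
  level \<open>p\<close> up to a constant.\<close>

definition tspan :: "int set \<Rightarrow> 'n der set" where
  "tspan P = {x. \<exists>X c. finite X \<and> X \<subseteq> P \<times> UNIV \<and> (\<forall>j\<in>X. c j \<in> T) \<and>
    x = (\<Sum>j\<in>X. c j *s U (fst j - 1) (snd j))}"

lemma tspanI:
  "finite X \<Longrightarrow> X \<subseteq> P \<times> UNIV \<Longrightarrow> (\<And>j. j \<in> X \<Longrightarrow> c j \<in> T) \<Longrightarrow>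
    (\<Sum>j\<in>X. c j *s U (fst j - 1) (snd j)) \<in> tspan P"
  unfolding tspan_def by blast

lemma tspan_0: "0 \<in> tspan P"
  using tspanI[of "{}" P] by simp

lemma tspan_add: assumes "x \<in> tspan P" "y \<in> tspan P" shows "x + y \<in> tspan P"
proof -
  obtain X c where X: "finite X" "X \<subseteq> P \<times> UNIV" "\<forall>j\<in>X. c j \<in> T" "x = (\<Sum>j\<in>X. c j *s U (fst j - 1) (snd j))"
    using assms(1) unfolding tspan_def by blast
  obtain Y e where Y: "finite Y" "Y \<subseteq> P \<times> UNIV" "\<forall>j\<in>Y. e j \<in> T" "y = (\<Sum>j\<in>Y. e j *s U (fst j - 1) (snd j))"
    using assms(2) unfolding tspan_def by blast
  define c' e' where "c' j = (if j \<in> X then c j else 0)" and "e' j = (if j \<in> Y then e j else 0)" for j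
  have "x = (\<Sum>j\<in>X \<union> Y. c' j *s U (fst j - 1) (snd j))" "y = (\<Sum>j\<in>X \<union> Y. e' j *s U (fst j - 1) (snd j))"
    unfolding X(4) Y(4) using X(1) Y(1) by (auto intro!: sum.mono_neutral_cong_left simp: c'_def e'_def)
  then have "x + y = (\<Sum>j\<in>X \<union> Y. (c' j + e' j) *s U (fst j - 1) (snd j))"
    by (simp add: sum.distrib vector_sadd_rdistrib)
  also have "\<dots> \<in> tspan P"
    using X Y T_ring_closed by (intro tspanI) (auto simp: c'_def e'_def)
  finally show ?thesis .
qed

lemma tspan_sum: "(\<And>i. i \<in> X \<Longrightarrow> f i \<in> tspan P) \<Longrightarrow> sum f X \<in> tspan P"
  by (induction X rule: infinite_finite_induct) (auto intro: tspan_0 tspan_add)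

lemma tspan_smult: assumes "a \<in> T" "x \<in> tspan P" shows "a *s x \<in> tspan P"
proof -
  obtain X c where X: "finite X" "X \<subseteq> P \<times> UNIV" "\<forall>j\<in>X. c j \<in> T" "x = (\<Sum>j\<in>X. c j *s U (fst j - 1) (snd j))"
    using assms(2) unfolding tspan_def by blast
  have "a *s x = (\<Sum>j\<in>X. (a * c j) *s U (fst j - 1) (snd j))"
    by (simp add: X(4) vec_eq_iff sum_component sum_distrib_left mult.assoc)
  also have "\<dots> \<in> tspan P" using X assms(1) T_ring_closed by (intro tspanI) auto
  finally show ?thesis .
qed

lemma tspan_gen: "p \<in> P \<Longrightarrow> U (p - 1) i \<in> tspan P"
  using tspanI[of "{(p, i)}" P "\<lambda>_. 1"] T_ring_closed(1) by simp

lemma tspan_mono: "P \<subseteq> P' \<Longrightarrow> tspan P \<subseteq> tspan P'"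
  unfolding tspan_def by blast

text \<open>By the recursion for \<open>U\<close>, multiplication by \<open>t\<^sub>\<ell>\<close> lowers the filtration by one step modulo \<open>T\<close>.\<close>

lemma last_smult_U: assumes "p \<le> k" shows "tt last_ix *s U (p - 1) i \<in> tspan {..k}"
proof -
  obtain M0 where M0: "\<And>i j. M0 i j \<in> T" "\<And>i j. M i j = (if i = j then tt last_ix else 0) + M0 i j"
    by (rule M_decompose) blast
  have "(\<Sum>j\<in>UNIV. M i j *s U (p - 1) j) = tt last_ix *s U (p - 1) i + (\<Sum>j\<in>UNIV. M0 i j *s U (p - 1) j)"
    unfolding M0(2) by (simp add: vector_sadd_rdistrib sum.distrib if_distrib[of "\<lambda>x. x *s _"] cong: if_cong)
  then have rec: "const_F (- (B i + of_int (p - 1))) *s U (p - 1 - 1) i =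
      tt last_ix *s U (p - 1) i + (\<Sum>j\<in>UNIV. M0 i j *s U (p - 1) j)"
    unfolding U_rec .
  have neg: "(\<Sum>j\<in>UNIV. (- M0 i j) *s U (p - 1) j) = - (\<Sum>j\<in>UNIV. M0 i j *s U (p - 1) j)"
    by (simp add: vec_eq_iff sum_negf)
  have "tt last_ix *s U (p - 1) i =
      const_F (- (B i + of_int (p - 1))) *s U (p - 1 - 1) i + (\<Sum>j\<in>UNIV. (- M0 i j) *s U (p - 1) j)"
    unfolding rec neg by simp
  also have "\<dots> \<in> tspan {..k}"
    using assms M0(1) T_ring_closed(5)
    by (intro tspan_add tspan_sum tspan_smult T_const tspan_gen) auto
  finally show ?thesis .
qed

text \<open>\<open>R\<close> is generated over \<open>T\<close> by \<open>tt last_ix\<close>, where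
  the recursion applies. The index set is a half-line because each such multiplication may lower
  \<open>p\<close>.\<close>

lemma R_smult_tspan: assumes "r \<in> R" shows "x \<in> tspan {..k} \<Longrightarrow> r *s x \<in> tspan {..k}"
  using assms
proof (induction arbitrary: x rule: R_induct)
  case (const c)
  then show ?case by (intro tspan_smult T_const)
next
  case (gen i)
  show ?case
  proof (cases "i = last_ix")
    case False
    then show ?thesis using gen by (intro tspan_smult T_tt)
  next
    case True
    obtain X c where X: "X \<subseteq> {..k} \<times> UNIV" "\<forall>j\<in>X. c j \<in> T" "x = (\<Sum>j\<in>X. c j *s U (fst j - 1) (snd j))"
      using gen unfolding tspan_def by blast
    have "tt i *s x = (\<Sum>j\<in>X. c j *s (tt last_ix *s U (fst j - 1) (snd j)))"
      by (simp add: X(3) True vec_eq_iff sum_component sum_distrib_left mult.assoc mult.left_commute)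
    also have "\<dots> \<in> tspan {..k}"
      using X by (intro tspan_sum tspan_smult last_smult_U) auto
    finally show ?thesis .
  qed
next
  case (add a b)
  then show ?case by (simp add: vector_sadd_rdistrib tspan_add)
next
  case (mult a b)
  have "(a * b) *s x = a *s (b *s x)" by (simp only: vector_smult_assoc)
  then show ?case using mult.IH(1)[OF mult.IH(2)[OF mult.prems]] by (simp only:)
qed

lemma LD_inv_tspan: assumes "\<theta> \<in> invariant_ders W (LD k)" shows "\<theta> \<in> tspan {..k}"
proof -
  obtain c where c: "\<forall>i. c i \<in> R" "\<theta> = (\<Sum>i\<in>UNIV. c i *s U (k - 1) i)"
    using LD_inv_span_R[OF assms] by blast
  show ?thesis unfolding c(2) using c(1) by (intro tspan_sum R_smult_tspan tspan_gen) auto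
qed

section \<open>Degree in the last flat invariant\<close>

abbreviation Dop :: "'n ratfun \<Rightarrow> 'n ratfun" where "Dop \<equiv> der_app D"

lemma Dop_pow_add: "(Dop ^^ n) (x + y) = (Dop ^^ n) x + (Dop ^^ n) y"
  by (induction n) (simp_all add: der_app_add)

lemma Dop_pow_0: "(Dop ^^ n) 0 = 0"
  by (induction n) simp_all

lemma Dop_pow_sum: "(Dop ^^ n) (sum f X) = (\<Sum>i\<in>X. (Dop ^^ n) (f i))"
  by (induction X rule: infinite_finite_induct) (simp_all add: Dop_pow_0 Dop_pow_add)

text \<open>Induction on \<open>a + b\<close>: in each summand of the product rule one of the two
  nilpotency orders drops.\<close>

lemma Dop_pow_mult_0:
  "(Dop ^^ a) x = 0 \<Longrightarrow> (Dop ^^ b) y = 0 \<Longrightarrow> (Dop ^^ (a + b)) (x * y) = 0"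
proof (induction "a + b" arbitrary: a b x y)
  case 0
  then show ?case by simp
next
  case (Suc n)
  show ?case
  proof (cases "a = 0 \<or> b = 0")
    case True
    then have "x * y = 0" using Suc.prems by auto
    then show ?thesis by (simp only: Dop_pow_0)
  next
    case False
    then obtain a' b' where ab: "a = Suc a'" "b = Suc b'" by (meson not0_implies_Suc)
    then have n: "n = a' + b" "n = a + b'" "a + b = Suc n" using Suc.hyps(2) by simp_all
    have "(Dop ^^ a') (Dop x) = 0" "(Dop ^^ b') (Dop y) = 0"
      using Suc.prems unfolding ab funpow_Suc_right o_apply .
    then have "(Dop ^^ n) (Dop x * y) = 0" "(Dop ^^ n) (x * Dop y) = 0"
      using Suc.hyps(1)[OF n(1), of "Dop x" y] Suc.hyps(1)[OF n(2), of x "Dop y"] Suc.prems n(1,2) by simp_all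
    moreover have "(Dop ^^ (a + b)) (x * y) = (Dop ^^ n) (Dop x * y) + (Dop ^^ n) (x * Dop y)"
      unfolding n(3) funpow_Suc_right o_apply der_app_mult Dop_pow_add ..
    ultimately show ?thesis by simp
  qed
qed

lemma Dop_nilpotent: "x \<in> R \<Longrightarrow> \<exists>n. (Dop ^^ n) x = 0"
proof (induction rule: R_induct)
  case (const c)
  show ?case by (rule exI[of _ 1]) simp
next
  case (gen i)
  show ?case by (rule exI[of _ 2]) (simp add: pt_tt numeral_2_eq_2)
next
  case (add x y)
  then obtain a b where "(Dop ^^ a) x = 0" "(Dop ^^ b) y = 0" by blast
  then have "(Dop ^^ (b + a)) x = 0" "(Dop ^^ (a + b)) y = 0" by (simp_all only: funpow_add o_apply Dop_pow_0)
  then show ?case by (intro exI[of _ "a + b"]) (simp add: Dop_pow_add add.commute)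
next
  case (mult x y)
  then show ?case using Dop_pow_mult_0 by blast
qed

lemma Dop_pow_const_mult: "Dop m = 0 \<Longrightarrow> (Dop ^^ n) (x * m) = (Dop ^^ n) x * m"
  by (induction n) (simp_all add: der_app_mult)

text \<open>\<open>D\<close> sends the last invariant to 1 and 1 to 0, so only two terms of the
  Leibniz formula survive.\<close>

lemma Dop_pow_last: "(Dop ^^ Suc n) (x * tt last_ix) = (Dop ^^ Suc n) x * tt last_ix + of_nat (Suc n) * (Dop ^^ n) x"
proof (induction n)
  case 0
  show ?case by (simp add: der_app_mult pt_tt)
next
  case (Suc n)
  have "(Dop ^^ Suc (Suc n)) (x * tt last_ix) = Dop ((Dop ^^ Suc n) (x * tt last_ix))" by simp
  also have "\<dots> = Dop ((Dop ^^ Suc n) x * tt last_ix + const_F (of_nat (Suc n)) * (Dop ^^ n) x)"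
    unfolding Suc const_F_simps(5) ..
  also have "\<dots> = (Dop ^^ Suc (Suc n)) x * tt last_ix + (1 + const_F (of_nat (Suc n))) * (Dop ^^ Suc n) x"
    by (simp add: der_app_add der_app_mult pt_tt algebra_simps)
  also have "1 + const_F (of_nat (Suc n)) = (of_nat (Suc (Suc n)) :: 'n ratfun)"
    unfolding const_F_simps(5) by simp
  finally show ?case .
qed

text \<open>Since \<open>M\<close> is monic of degree one in \<open>t\<^sub>\<ell>\<close>, the row \<open>r M\<close> has positive degree in \<open>t\<^sub>\<ell>\<close> unless
  \<open>r = 0\<close>; the degree is measured by the nilpotency of \<open>D\<close>.\<close>

lemma row_M_not_T:
  assumes r: "\<And>i. r i \<in> R" and a: "\<And>j. (\<Sum>i\<in>UNIV. r i * M i j) \<in> T"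
  shows "r i = 0"
proof (rule ccontr)
  assume nz: "r i \<noteq> 0"
  obtain M0 where M0: "\<And>i j. M0 i j \<in> T" "\<And>i j. M i j = (if i = j then tt last_ix else 0) + M0 i j"
    by (rule M_decompose) blast
  have "\<forall>i. \<exists>n. (Dop ^^ n) (r i) = 0" using Dop_nilpotent[OF r] by blast
  from choice[OF this] obtain n where n: "\<forall>i. (Dop ^^ n i) (r i) = 0" by blast
  have "(Dop ^^ (sum n UNIV)) (r i) = 0" for i
  proof -
    have "sum n UNIV = sum n (UNIV - {i}) + n i" by (simp add: sum.remove[of UNIV i] add.commute)
    then show ?thesis using n by (simp only: funpow_add o_apply Dop_pow_0)
  qed
  then have ex: "\<exists>m. \<forall>i. (Dop ^^ m) (r i) = 0" by blast
  \<comment> \<open>\<open>m - 1\<close> is the highest degree in the last invariant among the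
    entries of \<open>r\<close>.\<close>
  define m where "m = (LEAST m. \<forall>i. (Dop ^^ m) (r i) = 0)"
  have m: "\<forall>i. (Dop ^^ m) (r i) = 0" unfolding m_def using ex by (rule LeastI_ex)
  have "m \<noteq> 0"
  proof
    assume "m = 0"
    with m[rule_format, of i] nz show False by simp
  qed
  then obtain k where k: "m = Suc k" by (meson not0_implies_Suc)
  have "(Dop ^^ k) (r j) = 0" for j
  proof -
    \<comment> \<open>Applying \<open>D\<close> \<open>k + 1\<close> times kills the left side,
      which is in \<open>T\<close>, and the products with \<open>M0\<close>; the product with the
      last invariant leaves a nonzero multiple of the top coefficient.\<close>
    have "(\<Sum>i\<in>UNIV. r i * M i j) = r j * tt last_ix + (\<Sum>i\<in>UNIV. r i * M0 i j)"
      unfolding M0(2) by (simp add: distrib_left sum.distrib if_distrib[of "\<lambda>x. _ * x"] cong: if_cong)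
    then have "(Dop ^^ Suc k) (\<Sum>i\<in>UNIV. r i * M i j) =
        (Dop ^^ Suc k) (r j * tt last_ix) + (Dop ^^ Suc k) (\<Sum>i\<in>UNIV. r i * M0 i j)"
      by (simp only: Dop_pow_add)
    moreover have "(Dop ^^ Suc k) (\<Sum>i\<in>UNIV. r i * M0 i j) = 0"
      unfolding Dop_pow_sum Dop_pow_const_mult[OF D_T[OF M0(1)]] m[unfolded k, rule_format] by simp
    moreover have "(Dop ^^ Suc k) (\<Sum>i\<in>UNIV. r i * M i j) = 0"
      by (simp only: funpow_Suc_right o_apply D_T[OF a] Dop_pow_0)
    ultimately have "of_nat (Suc k) * (Dop ^^ k) (r j) = 0"
      by (simp only: Dop_pow_last m[unfolded k, rule_format] mult_zero_left add_0 add_0_right)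
    then show ?thesis by (simp only: mult_eq_0_iff of_nat_ratfun_eq_0_iff) simp
  qed
  then have "m \<le> k" unfolding m_def by (intro Least_le) blast
  then show False using k by simp
qed

text \<open>The part of a relation with the largest index \<open>k\<close> equals a combination of
  lower terms, hence lies in the next smaller module and expands over \<open>R\<close> in the
  \<open>U (k - 2)\<close>. The recursion rewrites this as a row \<open>r' M\<close> applied to the
  \<open>U (k - 1)\<close>; comparing coefficients puts that row over \<open>T\<close>, which forces
  it to vanish.\<close>

lemma T_indep:
  assumes X: "finite X" "X \<subseteq> UNIV \<times> UNIV" "\<forall>j\<in>X. c j \<in> T"
    and 0: "(\<Sum>j\<in>X. c j *s U (fst j - 1) (snd j)) = 0"
  shows "\<forall>j\<in>X. c j = 0"
proof (rule ccontr)
  assume "\<not> (\<forall>j\<in>X. c j = 0)"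
  define Y where "Y = {j \<in> X. c j \<noteq> 0}"
  have fin: "finite Y" using X(1) by (simp add: Y_def)
  have ne: "fst ` Y \<noteq> {}" using \<open>\<not> (\<forall>j\<in>X. c j = 0)\<close> by (auto simp: Y_def)
  define k where "k = Max (fst ` Y)"
  have kY: "k \<in> fst ` Y" unfolding k_def using fin ne by (intro Max_in) auto
  have le: "fst j \<le> k" if "j \<in> Y" for j unfolding k_def using fin that by (intro Max_ge) auto
  define a where "a i = (if (k, i) \<in> Y then c (k, i) else 0)" for i
  have aT: "a i \<in> T" for i using X(3) T_ring_closed(2) by (auto simp: a_def Y_def)
  define Z where "Z = {j \<in> Y. fst j \<noteq> k}"
  define f where "f j = c j *s U (fst j - 1) (snd j)" for j
  have "sum f X = sum f Y" using X(1) by (intro sum.mono_neutral_right) (auto simp: Y_def f_def)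
  also have "\<dots> = sum f (Y - Z) + sum f Z" using fin by (intro sum.subset_diff) (auto simp: Z_def)
  also have "sum f (Y - Z) = (\<Sum>i\<in>UNIV. a i *s U (k - 1) i)"
  proof -
    have "Y - Z = Pair k ` {i. (k, i) \<in> Y}" by (auto simp: Z_def)
    then have "sum f (Y - Z) = (\<Sum>i\<in>{i. (k, i) \<in> Y}. f (k, i))" by (simp add: sum.reindex inj_on_def)
    also have "\<dots> = (\<Sum>i\<in>UNIV. a i *s U (k - 1) i)"
      by (rule sum.mono_neutral_cong_left) (auto simp: a_def f_def)
    finally show ?thesis .
  qed
  finally have eq: "(\<Sum>i\<in>UNIV. a i *s U (k - 1) i) = - sum f Z"
    using 0 by (simp add: f_def[symmetric] eq_neg_iff_add_eq_0)
  have sub: "submod R (invariant_ders W (LD (k - 1)))"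
    by (intro submod_invariant_ders submod_log_ders)
  have "(- c j) *s U (fst j - 1) (snd j) \<in> invariant_ders W (LD (k - 1))" if "j \<in> Z" for j
  proof -
    have "fst j \<le> k - 1" using le[of j] that by (auto simp: Z_def)
    then have "U (fst j - 1) (snd j) \<in> invariant_ders W (LD (k - 1))"
      using LD_mono U_invariant_ders by blast
    moreover have "- c j \<in> R" using X(3) that by (intro R_ring(5) T_sub_R) (auto simp: Z_def Y_def)
    ultimately show ?thesis using sub unfolding submod_def by blast
  qed
  then have "(\<Sum>j\<in>Z. (- c j) *s U (fst j - 1) (snd j)) \<in> invariant_ders W (LD (k - 1))"
    by (rule submod_sum[OF sub])
  also have "(\<Sum>j\<in>Z. (- c j) *s U (fst j - 1) (snd j)) = (\<Sum>i\<in>UNIV. a i *s U (k - 1) i)"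
    unfolding eq f_def by (simp add: vec_eq_iff sum_component sum_negf)
  finally obtain r where r: "\<forall>i. r i \<in> R" "(\<Sum>i\<in>UNIV. a i *s U (k - 1) i) = (\<Sum>i\<in>UNIV. r i *s U (k - 1 - 1) i)"
    using LD_inv_span_R by blast
  define b where "b i = - (B i + of_int (k - 1))" for i
  have b: "b i \<noteq> 0" for i unfolding b_def neg_equal_0_iff_equal by (rule B_plus_nz)
  define r' where "r' i = r i * const_F (inverse (b i))" for i
  have r'R: "r' i \<in> R" for i unfolding r'_def using r(1) R_ring(4) R_const by blast
  have "r i *s U (k - 1 - 1) i = (\<Sum>j\<in>UNIV. (r' i * M i j) *s U (k - 1) j)" for i
  proof -
    have "inverse (b i) * b i = 1" using b by simp
    then have "const_F (inverse (b i)) * const_F (b i) = (1 :: 'n ratfun)"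
      unfolding to_F_mult[symmetric] Cst_mult[symmetric] by (simp only: Cst_1 to_F_1)
    then have "r i *s U (k - 1 - 1) i = r' i *s (const_F (b i) *s U (k - 1 - 1) i)"
      by (simp add: r'_def vector_smult_assoc mult.assoc)
    also have "const_F (b i) *s U (k - 1 - 1) i = (\<Sum>j\<in>UNIV. M i j *s U (k - 1) j)"
      unfolding b_def U_rec ..
    finally show ?thesis by (simp add: vec_eq_iff sum_component sum_distrib_left mult.assoc)
  qed
  then have "(\<Sum>i\<in>UNIV. r i *s U (k - 1 - 1) i) = (\<Sum>j\<in>UNIV. (\<Sum>i\<in>UNIV. r' i * M i j) *s U (k - 1) j)"
    by (simp add: vec_eq_iff sum_component sum_distrib_right) (intro allI sum.swap)
  with r(2) have "(\<Sum>j\<in>UNIV. (a j - (\<Sum>i\<in>UNIV. r' i * M i j)) *s U (k - 1) j) = 0"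
    by (simp add: vector_sub_rdistrib sum_subtractf)
  from U_indep[OF this] have a_eq: "a j = (\<Sum>i\<in>UNIV. r' i * M i j)" for j by simp
  have "r' i = 0" for i
    using row_M_not_T[of r', OF r'R] aT unfolding a_eq by blast
  then have a0: "a i = 0" for i by (simp add: a_eq)
  obtain i where "(k, i) \<in> Y" using kY by auto
  then show False using a0[of i] by (simp add: a_def Y_def)
qed

lemma free_over_T:
  assumes N: "submod T N" "\<And>p i. p \<in> P \<Longrightarrow> U (p - 1) i \<in> N" "N \<subseteq> tspan P"
  shows "free_with_basis T N (\<Union>p\<in>P. Xi W \<alpha> t \<eta> p)"
proof -
  have "free_with_basis T N ((\<lambda>j. const_F (- B (snd j)) *s U (fst j - 1) (snd j)) ` (P \<times> UNIV))"
  proof (rule free_with_basis_familyI[OF T_subring N(1)])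
    fix j :: "int \<times> 'n" assume j: "j \<in> P \<times> UNIV"
    show "const_F (- B (snd j)) \<in> T" "inverse (const_F (- B (snd j))) \<in> T" "const_F (- B (snd j)) \<noteq> (0 :: 'n ratfun)"
      by (rule B_units)+
    then show "const_F (- B (snd j)) *s U (fst j - 1) (snd j) \<in> N"
      using N(1,2) j unfolding submod_def by auto
  next
    fix x assume "x \<in> N"
    then show "\<exists>X c. finite X \<and> X \<subseteq> P \<times> UNIV \<and> (\<forall>j\<in>X. c j \<in> T) \<and> x = (\<Sum>j\<in>X. c j *s U (fst j - 1) (snd j))"
      using N(3) unfolding tspan_def by blast
  next
    fix X and c :: "int \<times> 'n \<Rightarrow> 'n ratfun"
    assume "finite X" "X \<subseteq> P \<times> UNIV" "\<forall>j\<in>X. c j \<in> T" "(\<Sum>j\<in>X. c j *s U (fst j - 1) (snd j)) = 0"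
    then show "\<forall>j\<in>X. c j = 0" by (intro T_indep) auto
  qed
  also have "(\<lambda>j. const_F (- B (snd j)) *s U (fst j - 1) (snd j)) ` (P \<times> UNIV) = (\<Union>p\<in>P. Xi W \<alpha> t \<eta> p)"
    unfolding Xi_eq by force
  finally show ?thesis .
qed

lemma T_submod: "submod (range to_F) N \<Longrightarrow> submod T (invariant_ders W N)"
  using submod_subset[OF submod_invariant_ders] T_sub_R by blast

lemma invariant_log_ders_free_over_T: "free_with_basis T (invariant_ders W (LD k)) (\<Union>p\<in>{..k}. Xi W \<alpha> t \<eta> p)"
proof (rule free_over_T)
  show "submod T (invariant_ders W (LD k))" by (intro T_submod submod_log_ders)
  show "U (p - 1) i \<in> invariant_ders W (LD k)" if "p \<in> {..k}" for p i
    using that LD_mono[of p k] U_invariant_ders by auto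
  show "invariant_ders W (LD k) \<subseteq> tspan {..k}" using LD_inv_tspan by blast
qed

text \<open>Every element has bounded poles, so it lies in a member of the filtration already
  treated.\<close>

lemma invariant_log_ders_inf_free_over_T: "free_with_basis T (invariant_ders W (log_ders_inf W I \<alpha>)) (\<Union>p. Xi W \<alpha> t \<eta> p)"
proof (rule free_over_T)
  show "submod T (invariant_ders W (log_ders_inf W I \<alpha>))" by (intro T_submod submod_log_ders_inf)
  show "U (p - 1) i \<in> invariant_ders W (log_ders_inf W I \<alpha>)" for p i
    using U_invariant_ders[of p i] log_ders_sub_inf by (auto simp: invariant_ders_eq)
  show "invariant_ders W (log_ders_inf W I \<alpha>) \<subseteq> tspan UNIV"
  proof
    fix \<theta> assume "\<theta> \<in> invariant_ders W (log_ders_inf W I \<alpha>)"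
    then have \<theta>: "\<theta> \<in> log_ders_inf W I \<alpha>" "W_inv_der \<theta>" by (auto simp: invariant_ders_eq)
    obtain k :: nat where "\<theta> \<in> LD (int k)" by (rule log_ders_inf_bounded_pole[OF \<theta>(1)])
    then have "\<theta> \<in> invariant_ders W (LD (int k))" using \<theta>(2) by (simp add: invariant_ders_eq)
    then show "\<theta> \<in> tspan UNIV" using LD_inv_tspan tspan_mono by blast
  qed
qed

end

theorem theorem4p2:
  fixes W :: "'n::{finite,linorder} cmat set"
    and I :: "'n cvec \<Rightarrow> 'n cvec \<Rightarrow> complex"
    and \<alpha> :: "'n cvec set \<Rightarrow> 'n cvec"
    and d es :: "nat \<Rightarrow> nat"
    and t :: "nat \<Rightarrow> 'n mpol"
    and \<eta> :: "nat \<Rightarrow> 'n der"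
    and k :: int
  assumes "reflection_group W" and "irreducible_group W" and "well_generated W"
    and "hermitian_inner I" and "invariant_form W I" and "normalized_forms W I \<alpha>"
    and "coexponents W es"
    and "flat_system W \<alpha> d es t \<eta>"
  shows
    "free_with_basis (range to_F)
       (log_ders W I \<alpha> (\<lambda>H. - k * int (order_mult W H) + 1)) (Xi W \<alpha> t \<eta> k) \<and>
     free_with_basis (to_F ` invariant_polys W)
       (invariant_ders W (log_ders W I \<alpha> (\<lambda>H. - k * int (order_mult W H) + 1))) (Xi W \<alpha> t \<eta> k) \<and>
     free_with_basis (T_ring t)
       (invariant_ders W (log_ders W I \<alpha> (\<lambda>H. - k * int (order_mult W H) + 1)))
       (\<Union>p\<in>{..k}. Xi W \<alpha> t \<eta> p) \<and>
     free_with_basis (T_ring t) (invariant_ders W (log_ders_inf W I \<alpha>)) (\<Union>p. Xi W \<alpha> t \<eta> p)"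
proof -
  interpret flat_setup W I \<alpha> d es t \<eta>
    using assms by unfold_locales
  show ?thesis using log_ders_free invariant_log_ders_free invariant_log_ders_free_over_T invariant_log_ders_inf_free_over_T by blast
qed

end
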